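(* Let $k$ be a field of characteristic different from $7$, with separable closure $k^{\mathrm s}$ and $G_k=\mathrm{Gal}(k^{\mathrm s}/k)$. Suppose that $\chi: G_k\to\mathbf{F}_7^\times$ is a (continuous) homomorphism with $\chi^3=1$, and let $E$ be an elliptic curve over $k$. Then $E$ has a $k$-rational subgroup of order $7$ on which $G_k$ acts via $\chi$ if and only if there is a $v\in k$ such that $E$ is isomorphic over $k$ to the elliptic curve $$A_v: y^2+a_1(v)xy+a_3(v)y=x^3+a_2(v)x^2+a_4(v)x+a_6(v)$$ over $k$ defined as follows. If $\chi=1$, let $a_1(v)=-v^2+v+1$, $a_2(v)=a_3(v)=-v^3+v^2$, $a_4(v)=a_6(v)=0$. If $\chi\neq1$, let $K$ be the cubic extension of $k$ cut out by $\chi$, let $\sigma\in\mathrm{Gal}(K/k)$ be the element with $\chi(\sigma)=4$, fix $t\in k$ adapted to $(K,\sigma)$ (as defined in the context), and let \begin{align*} c&=t^2+3t+9,\qquad f(v)=v^3-(t+3)v^2+tv+1,\\ a_1(v)&=c(v^2-v+1),\\ a_2(v)&=c f(v)\,t(2v-1),\\ a_3(v)&=c f(v)\,[(t^3-1)v^3+(t^3-1)v+t^2-t+1],\\ a_4(v)&=-c^2f(v)\,[(-3t^2-5t-2)v^5+(2t^3+8t^2+8t-7)v^4-(3t^3+6t^2+5t-20)v^3\\ &\qquad+(2t^3-t-23)v^2+2(t^2+2t+7)v-t-1],\\ a_6(v)&=c^2f(v)^2\,[(2t^5+9t^4+23t^3+35t^2+24t+11)v^6\\ &\qquad+(-t^6-6t^5-23t^4-38t^3-33t^2+36t)v^5\\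 &\qquad+(t^6+6t^5+18t^4-6t^3-60t^2-180t+13)v^4\\ &\qquad+(-t^6-2t^5+46t^3+84t^2+142t-139)v^3\\ &\qquad+(-t^5-5t^4-27t^3-15t^2+9t+182)v^2\\ &\qquad+(2t^4+3t^3-10t^2-32t-67)v+2t^3+5t^2+11t+11]. \end{align*}
   Context: A $k$-rational subgroup of $E$ is a subgroup of $E(k^{\mathrm s})$ stable under $G_k$; "$G_k$ acts on the order-$7$ subgroup $\Psi$ via $\chi$" means $P^\sigma=\chi(\sigma)P$ for all $P\in\Psi$, $\sigma\in G_k$. For a cyclic cubic extension $K/k$ and a generator $\sigma$ of $\mathrm{Gal}(K/k)$, an element $t\in k$ is adapted to $(K,\sigma)$ if (i) $K$ is the splitting field over $k$ of $f(x)=x^3-(t+3)x^2+tx+1$, and (ii) every root $\gamma$ of $f$ satisfies $\gamma^\sigma=1/(1-\gamma)$. (Such a $t$ always exists, by a lemma of Washington.) The field cut out by $\chi$ is the fixed field of $\ker\chi$. *)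

theory Defs
  imports
    "HOL-Algebra.Algebraic_Closure_Type"
    "HOL-Algebra.Generated_Fields"
    "HOL-Algebra.Bij"
    "HOL-Algebra.Coset"
    "HOL-Number_Theory.Residues"
    "HOL-Analysis.Function_Topology"
begin

section \<open>Separable closures and Galois groups\<close>

text \<open>The base field is the type \<open>'k\<close>, and a separable closure of it is a type \<open>'s\<close> together
  with an embedding \<open>\<iota>\<close>. Subextensions are subsets of \<open>'s\<close> containing the range of \<open>\<iota>\<close>.\<close>

definition separable_poly :: "'a::field poly \<Rightarrow> bool" where
  "separable_poly p \<longleftrightarrow> coprime p (pderiv p)"

definition separable_closure :: "('k::field \<Rightarrow> 's::field) \<Rightarrow> bool" where
  "separable_closure \<iota> \<longleftrightarrow>
     \<iota> \<in> ring_hom ring_of_type_algebra ring_of_type_algebra \<and>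
     (\<forall>x. \<exists>p. separable_poly p \<and> poly (map_poly \<iota> p) x = 0) \<and>
     (\<forall>q::'s poly. separable_poly q \<and> degree q > 0 \<longrightarrow> (\<exists>x. poly q x = 0))"

text \<open>As in \<^const>\<open>BijGroup\<close>, an automorphism of a subset \<open>K\<close> is represented by a function that
  is \<^const>\<open>undefined\<close> outside \<open>K\<close>.\<close>

definition galois_group :: "('k::field \<Rightarrow> 's::field) \<Rightarrow> 's set \<Rightarrow> ('s \<Rightarrow> 's) monoid" where
  "galois_group \<iota> K = (BijGroup K)\<lparr>carrier := {s \<in> Bij K.
     (\<forall>x\<in>K. \<forall>y\<in>K. s (x + y) = s x + s y \<and> s (x * y) = s x * s y) \<and>
     (\<forall>a. s (\<iota> a) = \<iota> a)}\<rparr>"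

abbreviation absolute_galois_group :: "('k::field \<Rightarrow> 's::field) \<Rightarrow> ('s \<Rightarrow> 's) monoid" where
  "absolute_galois_group \<iota> \<equiv> galois_group \<iota> UNIV"

text \<open>The Krull topology is the topology of pointwise convergence on the discrete set \<open>'s\<close>: a
  basic neighbourhood of \<open>s\<close> consists of the automorphisms that agree with \<open>s\<close> on a finite set.\<close>

definition krull_topology :: "('k::field \<Rightarrow> 's::field) \<Rightarrow> ('s \<Rightarrow> 's) topology" where
  "krull_topology \<iota> = subtopology (product_topology (\<lambda>_. discrete_topology UNIV) UNIV)
     (carrier (absolute_galois_group \<iota>))"

definition fixed_field :: "('s \<Rightarrow> 's) set \<Rightarrow> 's set" where
  "fixed_field H = {x. \<forall>s\<in>H. s x = x}"

definition F7_units :: "int monoid" where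
  "F7_units = units_of (residue_ring 7)"

definition continuous_F7_character ::
    "('k::field \<Rightarrow> 's::field) \<Rightarrow> (('s \<Rightarrow> 's) \<Rightarrow> int) \<Rightarrow> bool" where
  "continuous_F7_character \<iota> \<chi> \<longleftrightarrow>
     \<chi> \<in> hom (absolute_galois_group \<iota>) F7_units \<and>
     continuous_map (krull_topology \<iota>) (discrete_topology (carrier F7_units)) \<chi>"

definition trivial_character ::
    "('k::field \<Rightarrow> 's::field) \<Rightarrow> (('s \<Rightarrow> 's) \<Rightarrow> int) \<Rightarrow> bool" where
  "trivial_character \<iota> \<chi> \<longleftrightarrow>
     (\<forall>s \<in> carrier (absolute_galois_group \<iota>). \<chi> s = \<one>\<^bsub>F7_units\<^esub>)"

definition field_cut_out ::
    "('k::field \<Rightarrow> 's::field) \<Rightarrow> (('s \<Rightarrow> 's) \<Rightarrow> int) \<Rightarrow> 's set" where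
  "field_cut_out \<iota> \<chi> = fixed_field (kernel (absolute_galois_group \<iota>) F7_units \<chi>)"


section \<open>Adapted parameters\<close>

definition splitting_field_over ::
    "('k::field \<Rightarrow> 's::field) \<Rightarrow> 's set \<Rightarrow> 'k poly \<Rightarrow> bool" where
  "splitting_field_over \<iota> K p \<longleftrightarrow>
     (\<exists>rs. map_poly \<iota> p = smult (\<iota> (lead_coeff p)) (\<Prod>r\<leftarrow>rs. [:- r, 1:]) \<and>
           K = generate_field ring_of_type_algebra (range \<iota> \<union> set rs))"

definition adapted_cubic :: "'k::field \<Rightarrow> 'k poly" where
  "adapted_cubic t = [:1, t, - (t + 3), 1:]"

definition adapted :: "('k::field \<Rightarrow> 's::field) \<Rightarrow> 's set \<Rightarrow> ('s \<Rightarrow> 's) \<Rightarrow> 'k \<Rightarrow> bool" where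
  "adapted \<iota> K \<sigma> t \<longleftrightarrow>
     splitting_field_over \<iota> K (adapted_cubic t) \<and>
     (\<forall>\<gamma>. poly (map_poly \<iota> (adapted_cubic t)) \<gamma> = 0 \<longrightarrow> \<sigma> \<gamma> = 1 / (1 - \<gamma>))"


section \<open>Elliptic curves\<close>

text \<open>\<open>Weierstrass a1 a2 a3 a4 a6\<close> is the curve
  \<open>y\<^sup>2 + a1 x y + a3 y = x\<^sup>3 + a2 x\<^sup>2 + a4 x + a6\<close> in the projective plane.\<close>

datatype 'a weierstrass = Weierstrass 'a 'a 'a 'a 'a

fun discriminant :: "'a::field weierstrass \<Rightarrow> 'a" where
  "discriminant (Weierstrass a1 a2 a3 a4 a6) =
     (let b2 = a1^2 + 4 * a2; b4 = 2 * a4 + a1 * a3; b6 = a3^2 + 4 * a6;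
          b8 = a1^2 * a6 + 4 * a2 * a6 - a1 * a3 * a4 + a2 * a3^2 - a4^2
      in - (b2^2) * b8 - 8 * b4^3 - 27 * b6^2 + 9 * b2 * b4 * b6)"

definition elliptic_curve :: "'a::field weierstrass \<Rightarrow> bool" where
  "elliptic_curve E \<longleftrightarrow> discriminant E \<noteq> 0"

text \<open>Isomorphisms of Weierstrass curves preserving the point at infinity are the substitutions
  \<open>x = u\<^sup>2 x' + r\<close>, \<open>y = u\<^sup>3 y' + u\<^sup>2 s x' + t\<close> with \<open>u \<noteq> 0\<close>, where \<open>(x, y)\<close> lies on the first
  curve and \<open>(x', y')\<close> on the second. Dividing the substituted equation by \<open>u\<^sup>6\<close> gives the
  coefficients below.\<close>

fun isomorphic_curves :: "'a::field weierstrass \<Rightarrow> 'a weierstrass \<Rightarrow> bool" where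
  "isomorphic_curves (Weierstrass a1 a2 a3 a4 a6) (Weierstrass a1' a2' a3' a4' a6') \<longleftrightarrow>
     (\<exists>u r s t. u \<noteq> 0 \<and>
        u * a1' = a1 + 2 * s \<and>
        u^2 * a2' = a2 - s * a1 + 3 * r - s^2 \<and>
        u^3 * a3' = a3 + r * a1 + 2 * t \<and>
        u^4 * a4' = a4 - s * a3 + 2 * r * a2 - (t + r * s) * a1 + 3 * r^2 - 2 * s * t \<and>
        u^6 * a6' = a6 + r * a4 + r^2 * a2 + r^3 - t * a3 - t^2 - r * t * a1)"

fun base_change :: "('k \<Rightarrow> 's) \<Rightarrow> 'k weierstrass \<Rightarrow> 's weierstrass" where
  "base_change \<iota> (Weierstrass a1 a2 a3 a4 a6) =
     Weierstrass (\<iota> a1) (\<iota> a2) (\<iota> a3) (\<iota> a4) (\<iota> a6)"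

datatype 'a point = Infinity | Affine 'a 'a

fun on_curve :: "'a::field weierstrass \<Rightarrow> 'a point \<Rightarrow> bool" where
  "on_curve _ Infinity \<longleftrightarrow> True"
| "on_curve (Weierstrass a1 a2 a3 a4 a6) (Affine x y) \<longleftrightarrow>
     y^2 + a1 * x * y + a3 * y = x^3 + a2 * x^2 + a4 * x + a6"

text \<open>The chord and tangent law. The negative of \<open>(x, y)\<close> is \<open>(x, - y - a1 x - a3)\<close>; \<open>l\<close> is the
  slope of the line through the two points, or of the tangent line if they coincide.\<close>

fun add_points :: "'a::field weierstrass \<Rightarrow> 'a point \<Rightarrow> 'a point \<Rightarrow> 'a point" where
  "add_points _ Infinity Q = Q"
| "add_points _ P Infinity = P"
| "add_points (Weierstrass a1 a2 a3 a4 a6) (Affine x1 y1) (Affine x2 y2) =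
     (if x1 = x2 \<and> y1 + y2 + a1 * x2 + a3 = 0 then Infinity
      else let l = (if x1 = x2
                    then (3 * x1^2 + 2 * a2 * x1 + a4 - a1 * y1) / (2 * y1 + a1 * x1 + a3)
                    else (y2 - y1) / (x2 - x1));
               x3 = l^2 + a1 * l - a2 - x1 - x2
           in Affine x3 (- (l * (x3 - x1) + y1) - a1 * x3 - a3))"

definition curve_group :: "'a::field weierstrass \<Rightarrow> 'a point monoid" where
  "curve_group E = \<lparr>carrier = Collect (on_curve E), monoid.mult = add_points E, one = Infinity\<rparr>"

text \<open>Here \<open>map_point s\<close> is coordinatewise application of \<open>s\<close>, the Galois action on points.\<close>

definition rational_subgroup ::
    "('k::field \<Rightarrow> 's::field) \<Rightarrow> 'k weierstrass \<Rightarrow> 's point set \<Rightarrow> bool" where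
  "rational_subgroup \<iota> E \<Psi> \<longleftrightarrow>
     subgroup \<Psi> (curve_group (base_change \<iota> E)) \<and>
     (\<forall>s \<in> carrier (absolute_galois_group \<iota>). \<forall>P\<in>\<Psi>. map_point s P \<in> \<Psi>)"

text \<open>The elements of \<open>F7_units\<close> are the integers from \<open>1\<close> to \<open>6\<close>; the power below is the
  multiple \<open>\<chi>(s) P\<close>, as the group of points is written multiplicatively in \<^const>\<open>curve_group\<close>.\<close>

definition galois_acts_via :: "('k::field \<Rightarrow> 's::field) \<Rightarrow> 'k weierstrass \<Rightarrow>
    (('s \<Rightarrow> 's) \<Rightarrow> int) \<Rightarrow> 's point set \<Rightarrow> bool" where
  "galois_acts_via \<iota> E \<chi> \<Psi> \<longleftrightarrow>
     (\<forall>s \<in> carrier (absolute_galois_group \<iota>). \<forall>P\<in>\<Psi>.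
        map_point s P = P [^]\<^bsub>curve_group (base_change \<iota> E)\<^esub> nat (\<chi> s))"


section \<open>The two families of curves\<close>

definition untwisted_curve :: "'k::field \<Rightarrow> 'k weierstrass" where
  "untwisted_curve v = Weierstrass (- (v^2) + v + 1) (- (v^3) + v^2) (- (v^3) + v^2) 0 0"

definition twisted_curve :: "'k::field \<Rightarrow> 'k \<Rightarrow> 'k weierstrass" where
  "twisted_curve t v =
     (let c = t^2 + 3 * t + 9;
          f = v^3 - (t + 3) * v^2 + t * v + 1
      in Weierstrass
        (c * (v^2 - v + 1))
        (c * f * t * (2 * v - 1))
        (c * f * ((t^3 - 1) * v^3 + (t^3 - 1) * v + t^2 - t + 1))
        (- (c^2) * f * ((- 3 * t^2 - 5 * t - 2) * v^5
          + (2 * t^3 + 8 * t^2 + 8 * t - 7) * v^4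
          - (3 * t^3 + 6 * t^2 + 5 * t - 20) * v^3
          + (2 * t^3 - t - 23) * v^2
          + 2 * (t^2 + 2 * t + 7) * v - t - 1))
        (c^2 * f^2 * ((2 * t^5 + 9 * t^4 + 23 * t^3 + 35 * t^2 + 24 * t + 11) * v^6
          + (- (t^6) - 6 * t^5 - 23 * t^4 - 38 * t^3 - 33 * t^2 + 36 * t) * v^5
          + (t^6 + 6 * t^5 + 18 * t^4 - 6 * t^3 - 60 * t^2 - 180 * t + 13) * v^4
          + (- (t^6) - 2 * t^5 + 46 * t^3 + 84 * t^2 + 142 * t - 139) * v^3
          + (- (t^5) - 5 * t^4 - 27 * t^3 - 15 * t^2 + 9 * t + 182) * v^2
          + (2 * t^4 + 3 * t^3 - 10 * t^2 - 32 * t - 67) * v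
          + 2 * t^3 + 5 * t^2 + 11 * t + 11)))"

text \<open>The parameter \<open>t\<close> is only used when \<open>\<chi>\<close> is nontrivial.\<close>

definition A_curve ::
    "('k::field \<Rightarrow> 's::field) \<Rightarrow> (('s \<Rightarrow> 's) \<Rightarrow> int) \<Rightarrow> 'k \<Rightarrow> 'k \<Rightarrow> 'k weierstrass" where
  "A_curve \<iota> \<chi> t v =
     (if trivial_character \<iota> \<chi> then untwisted_curve v else twisted_curve t v)"

end

theory Submission
  imports Defs
begin

text \<open>A curve \<open>E\<close> with a point \<open>P\<close> of order seven has a Tate normal form: a unique substitution carries
  \<open>(E, P)\<close> to an untwisted curve with parameter \<open>w\<close> and the point \<open>(0, 0)\<close>. Because of the
  uniqueness (\<open>iso_via_untwisted_unique\<close>), an automorphism \<open>s\<close> of the separable closure carries the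
  substitution and the parameter of \<open>(E, P)\<close> to those of \<open>(E, s P)\<close>. Replacing \<open>P\<close> by \<open>4 P\<close>
  changes \<open>w\<close> to \<open>1 / (1 - w)\<close> (\<open>quadruple_change\<close>).

  If the character is trivial, \<open>P\<close> is rational, so its normal form is invariant under Galois and
  hence defined over the base field. This gives the untwisted family.

  If the character is not trivial, an automorphism with character value four changes \<open>w\<close> to
  \<open>1 / (1 - w)\<close> and a root \<open>g\<close> of the adapted cubic to \<open>1 / (1 - g)\<close>. The kernel of the character
  fixes both, so \<open>v = (g - w) / (1 - w + w g)\<close> lies in the base field. Over the separable closure
  the twisted curve with parameter \<open>v\<close> is isomorphic to the untwisted curve with parameter
  \<open>w = (g - v) / (g v - v + 1)\<close>, by a substitution whose coefficients are rational functions of \<open>v\<close>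
  and \<open>g\<close> (\<open>twist_iso\<close>), and replacing \<open>g\<close> by \<open>1 / (1 - g)\<close> in it replaces the marked point by its
  quadruple (\<open>twist_quadruple\<close>). The isomorphism from \<open>E\<close> to the twisted curve that matches the
  marked points is thus Galois invariant (\<open>forward\<close>). Conversely the marked point of the twisted
  curve generates a subgroup with the required Galois action (\<open>backward\<close>).

  Two general facts enter. Descent needs that the fixed field of the absolute Galois group is the
  base field (\<open>fixed_by_galois_group\<close>); here automorphisms are extended by Zorn's lemma. The normal
  form needs \<open>4 P = - 3 P\<close> for the points of a subgroup of order seven. This is deduced without the
  associative law: three collinear points have sum zero in any order, so points form a commutative
  loop with the inverse property, and a counting argument shows that every nonzero element \<open>p\<close> of such
  a loop of order seven satisfies \<open>4 p = - 3 p\<close> (\<open>fourfold\<close>).\<close>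

section \<open>The chord and tangent law\<close>

fun neg_point :: "'a::field weierstrass \<Rightarrow> 'a point \<Rightarrow> 'a point" where
  "neg_point _ Infinity = Infinity"
| "neg_point (Weierstrass a1 a2 a3 a4 a6) (Affine x y) = Affine x (- y - a1 * x - a3)"

text \<open>Nonsingularity at the rational affine points is the only consequence of a nonzero discriminant
  that the chord and tangent law needs. It can be tested at one point at a time, so it passes easily
  through substitutions.\<close>
fun smooth :: "'a::field weierstrass \<Rightarrow> bool" where
  "smooth (Weierstrass a1 a2 a3 a4 a6) \<longleftrightarrow>
     (\<forall>x y. y^2 + a1 * x * y + a3 * y = x^3 + a2 * x^2 + a4 * x + a6 \<longrightarrow>
        \<not> (2 * y + a1 * x + a3 = 0 \<and> 3 * x^2 + 2 * a2 * x + a4 - a1 * y = 0))"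

text \<open>At a singular point the three coefficients \<open>a\<^sub>3, a\<^sub>4, a\<^sub>6\<close> are determined by the others and the
  coordinates, and with these values the discriminant vanishes identically.\<close>
lemma elliptic_curve_smooth:
  assumes "elliptic_curve E"
  shows "smooth E"
proof (cases E)
  case (Weierstrass a1 a2 a3 a4 a6)
  show ?thesis
    unfolding Weierstrass smooth.simps
  proof (intro allI impI notI, elim conjE)
    fix x y
    assume 1: "y^2 + a1 * x * y + a3 * y = x^3 + a2 * x^2 + a4 * x + a6"
      and 2: "2 * y + a1 * x + a3 = 0" and 3: "3 * x^2 + 2 * a2 * x + a4 - a1 * y = 0"
    have e3: "a3 = - 2 * y - a1 * x" using 2 by (simp add: algebra_simps eq_neg_iff_add_eq_0)
    have e4: "a4 = a1 * y - 3 * x^2 - 2 * a2 * x" using 3 by (simp add: algebra_simps)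
    have e6: "a6 = y^2 + a1 * x * y + a3 * y - x^3 - a2 * x^2 - a4 * x"
      using 1 by (simp add: algebra_simps)
    have "discriminant E = 0"
      unfolding Weierstrass discriminant.simps Let_def e6 unfolding e4 e3 by Groebner_Basis.algebra
    then show False using assms by (simp add: elliptic_curve_def)
  qed
qed

lemma neg_point_invol [simp]: "neg_point E (neg_point E P) = P"
  by (cases E; cases P) simp_all

lemma on_curve_neg_point: "on_curve E P \<Longrightarrow> on_curve E (neg_point E P)"
proof (cases E; cases P)
  fix a1 a2 a3 a4 a6 x y
  assume E: "E = Weierstrass a1 a2 a3 a4 a6" and P: "P = Affine x y" and "on_curve E P"
  have "(- y - a1 * x - a3)^2 + a1 * x * (- y - a1 * x - a3) + a3 * (- y - a1 * x - a3)
      = y^2 + a1 * x * y + a3 * y" by Groebner_Basis.algebra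
  with \<open>on_curve E P\<close> show ?thesis by (simp add: E P)
qed simp

lemma neg_point_eq_iff: "neg_point E P = neg_point E Q \<longleftrightarrow> P = Q"
  by (metis neg_point_invol)

lemma neg_point_eq_Infinity_iff [simp]: "neg_point E P = Infinity \<longleftrightarrow> P = Infinity"
  by (cases E; cases P) simp_all

lemma add_points_Infinity_right [simp]: "add_points E P Infinity = P"
  by (cases E; cases P) simp_all

lemma on_curve_same_x:
  fixes a1 :: "'a::field"
  assumes "y1^2 + a1 * x * y1 + a3 * y1 = z" "y2^2 + a1 * x * y2 + a3 * y2 = z"
    and "y1 + y2 + a1 * x + a3 \<noteq> 0"
  shows "y1 = y2"
proof -
  have "(y1 - y2) * (y1 + y2 + a1 * x + a3)
      = (y1^2 + a1 * x * y1 + a3 * y1) - (y2^2 + a1 * x * y2 + a3 * y2)" by Groebner_Basis.algebra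
  then have "(y1 - y2) * (y1 + y2 + a1 * x + a3) = 0" using assms(1,2) by simp
  then show ?thesis using assms(3) by simp
qed

lemma add_points_eq_Infinity_iff:
  assumes "on_curve E P" "on_curve E Q"
  shows "add_points E P Q = Infinity \<longleftrightarrow> Q = neg_point E P"
proof -
  obtain a1 a2 a3 a4 a6 where E: "E = Weierstrass a1 a2 a3 a4 a6" by (cases E)
  have aux: "y1 + y2 + a1 * x + a3 = 0 \<longleftrightarrow> y2 = - y1 - a1 * x - a3" for y1 y2 x
    by (smt (verit, ccfv_threshold) add.commute add.left_commute diff_add_cancel eq_neg_iff_add_eq_0 minus_diff_eq
        uminus_add_conv_diff)
  show ?thesis
    by (cases P; cases Q) (auto simp: E Let_def aux)
qed

text \<open>The coefficients of
  \<open>x\<^sup>3 + a\<^sub>2 x\<^sup>2 + a\<^sub>4 x + a\<^sub>6 - (l x + m)\<^sup>2 - a\<^sub>1 x (l x + m) - a\<^sub>3 (l x + m) = (x - x\<^sub>1) (x - x\<^sub>2) (x - x\<^sub>3)\<close>: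
  the line \<open>y = l x + m\<close> meets the curve at abscissae \<open>x\<^sub>1, x\<^sub>2, x\<^sub>3\<close>, with multiplicity.\<close>
fun line_through :: "'a::field weierstrass \<Rightarrow> 'a \<Rightarrow> 'a \<Rightarrow> 'a \<Rightarrow> 'a \<Rightarrow> 'a \<Rightarrow> bool" where
  "line_through (Weierstrass a1 a2 a3 a4 a6) l m x1 x2 x3 \<longleftrightarrow>
     x1 + x2 + x3 = l^2 + a1 * l - a2 \<and>
     x1 * x2 + x2 * x3 + x3 * x1 = a4 - 2 * l * m - a1 * m - a3 * l \<and>
     x1 * x2 * x3 = m^2 + a3 * m - a6"

text \<open>The right-hand side is symmetric in the three points, whereas the addition formulas are not. This
  is the source of the inverse property below, which replaces associativity throughout. For distinct
  abscissae the line is the chord, and the last two relations follow from two linear equations; for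
  a double point it is the tangent, and smoothness says that its slope is determined.\<close>
lemma add_points_eq_neg_iff_line:
  assumes "smooth E"
    and "on_curve E (Affine x1 y1)" "on_curve E (Affine x2 y2)" "on_curve E (Affine x3 y3)"
  shows "add_points E (Affine x1 y1) (Affine x2 y2) = neg_point E (Affine x3 y3) \<longleftrightarrow>
     (\<exists>l m. line_through E l m x1 x2 x3 \<and> y1 = l * x1 + m \<and> y2 = l * x2 + m \<and> y3 = l * x3 + m)"
proof -
  obtain a1 a2 a3 a4 a6 where E: "E = Weierstrass a1 a2 a3 a4 a6" by (cases E)
  have c1: "y1^2 + a1 * x1 * y1 + a3 * y1 = x1^3 + a2 * x1^2 + a4 * x1 + a6"
    and c2: "y2^2 + a1 * x2 * y2 + a3 * y2 = x2^3 + a2 * x2^2 + a4 * x2 + a6"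
    using assms by (auto simp: E)
  have sm: "\<not> (2 * y1 + a1 * x1 + a3 = 0 \<and> 3 * x1^2 + 2 * a2 * x1 + a4 - a1 * y1 = 0)"
    using assms(1) c1 by (auto simp: E)
  define l0 where "l0 = (if x1 = x2
                    then (3 * x1^2 + 2 * a2 * x1 + a4 - a1 * y1) / (2 * y1 + a1 * x1 + a3)
                    else (y2 - y1) / (x2 - x1))"
  define m0 where "m0 = y1 - l0 * x1"
  define B where "B l m = a4 - 2 * l * m - a1 * m - a3 * l" for l m
  define C where "C m = m^2 + a3 * m - a6" for m
  have cubic: "x^3 - (x1 + x2 + x3) * x^2 + B l m * x - C m = 0"
    if "y^2 + a1 * x * y + a3 * y = x^3 + a2 * x^2 + a4 * x + a6"
      and y: "y = l * x + m" and e1: "x1 + x2 + x3 = l^2 + a1 * l - a2" for x y l m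
  proof -
    have "x^3 - (x1 + x2 + x3) * x^2 + B l m * x - C m
        = (x^3 + a2 * x^2 + a4 * x + a6) - (y^2 + a1 * x * y + a3 * y)"
      unfolding B_def C_def y e1 by Groebner_Basis.algebra
    with that(1) show ?thesis by simp
  qed
  have tangent: "3 * x1^2 - 2 * (x1 + x2 + x3) * x1 + B l m
      = (3 * x1^2 + 2 * a2 * x1 + a4 - a1 * y1) - l * (2 * y1 + a1 * x1 + a3)"
    if y: "y1 = l * x1 + m" and e1: "x1 + x2 + x3 = l^2 + a1 * l - a2" for l m
    unfolding B_def y e1 by Groebner_Basis.algebra
  have add: "add_points E (Affine x1 y1) (Affine x2 y2) =
      (if x1 = x2 \<and> y1 + y2 + a1 * x2 + a3 = 0 then Infinity
       else Affine (l0^2 + a1 * l0 - a2 - x1 - x2)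
        (- (l0 * ((l0^2 + a1 * l0 - a2 - x1 - x2) - x1) + y1) - a1 * (l0^2 + a1 * l0 - a2 - x1 - x2) - a3))"
    by (simp add: E l0_def Let_def)
  show ?thesis
  proof
    assume h: "add_points E (Affine x1 y1) (Affine x2 y2) = neg_point E (Affine x3 y3)"
    then have ninf: "\<not> (x1 = x2 \<and> y1 + y2 + a1 * x2 + a3 = 0)"
      using add by (auto simp: E)
    then have "Affine x3 (- y3 - a1 * x3 - a3) = Affine (l0^2 + a1 * l0 - a2 - x1 - x2)
        (- (l0 * ((l0^2 + a1 * l0 - a2 - x1 - x2) - x1) + y1) - a1 * (l0^2 + a1 * l0 - a2 - x1 - x2) - a3)"
      using h add by (simp only: if_False) (simp add: E)
    then have x3: "x3 = l0^2 + a1 * l0 - a2 - x1 - x2"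
      and "- y3 - a1 * x3 - a3 = - (l0 * (x3 - x1) + y1) - a1 * x3 - a3" by auto
    then have y3: "y3 = l0 * x3 + m0" unfolding m0_def by (simp add: algebra_simps)
    have y1: "y1 = l0 * x1 + m0" by (simp add: m0_def)
    have e1: "x1 + x2 + x3 = l0^2 + a1 * l0 - a2" using x3 by simp
    show "\<exists>l m. line_through E l m x1 x2 x3 \<and> y1 = l * x1 + m \<and> y2 = l * x2 + m \<and> y3 = l * x3 + m"
    proof (cases "x1 = x2")
      case False
      have "l0 * (x2 - x1) = y2 - y1" using False by (simp add: l0_def)
      then have y2: "y2 = l0 * x2 + m0" unfolding m0_def by (simp add: algebra_simps)
      have k1: "x1^3 - (x1 + x2 + x3) * x1^2 + B l0 m0 * x1 - C m0 = 0"
        using cubic[OF c1 y1 e1] .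
      have k2: "x2^3 - (x1 + x2 + x3) * x2^2 + B l0 m0 * x2 - C m0 = 0"
        using cubic[OF c2 y2 e1] .
      have "(x2 - x1) * (B l0 m0 - (x1 * x2 + x2 * x3 + x3 * x1))
          = (x2^3 - (x1 + x2 + x3) * x2^2 + B l0 m0 * x2 - C m0)
            - (x1^3 - (x1 + x2 + x3) * x1^2 + B l0 m0 * x1 - C m0)" by Groebner_Basis.algebra
      then have e2: "B l0 m0 = x1 * x2 + x2 * x3 + x3 * x1" using False by (simp add: k1 k2)
      have "x1 * x2 * x3 = C m0"
        using k1 unfolding e2 by (simp add: algebra_simps power2_eq_square power3_eq_cube)
      with e1 e2 y1 y2 y3 show ?thesis unfolding E by (auto simp: B_def C_def)
    next
      case True
      with ninf c1 c2 have yy: "y1 = y2" using on_curve_same_x by blast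
      have yy2: "y1 + y2 + a1 * x2 + a3 = 2 * y1 + a1 * x1 + a3"
        unfolding yy True by (simp only: mult_2)
      then have "2 * y1 + a1 * x1 + a3 \<noteq> 0" using ninf True by metis
      then have "l0 * (2 * y1 + a1 * x1 + a3) = 3 * x1^2 + 2 * a2 * x1 + a4 - a1 * y1"
        unfolding l0_def if_P[OF True] by (rule nonzero_eq_divide_eq[THEN iffD1, OF _ refl])
      then have "3 * x1^2 - 2 * (x1 + x2 + x3) * x1 + B l0 m0 = 0"
        using tangent[OF y1 e1] by simp
      moreover have "3 * x1^2 - 2 * (x1 + x2 + x3) * x1 + B l0 m0
          = B l0 m0 - (x1 * x2 + x2 * x3 + x3 * x1)"
        unfolding True[symmetric] by Groebner_Basis.algebra
      ultimately have e2: "B l0 m0 = x1 * x2 + x2 * x3 + x3 * x1" by simp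
      have "x1 * x2 * x3 = C m0"
        using cubic[OF c1 y1 e1] unfolding e2
        by (simp add: algebra_simps power2_eq_square power3_eq_cube)
      moreover have "y2 = l0 * x2 + m0" using y1 yy True by metis
      ultimately show ?thesis
        using e1 e2 y1 y3 unfolding E line_through.simps B_def C_def by metis
    qed
  next
    assume "\<exists>l m. line_through E l m x1 x2 x3 \<and> y1 = l * x1 + m \<and> y2 = l * x2 + m \<and> y3 = l * x3 + m"
    then obtain l m where e1: "x1 + x2 + x3 = l^2 + a1 * l - a2"
      and e2: "x1 * x2 + x2 * x3 + x3 * x1 = a4 - 2 * l * m - a1 * m - a3 * l"
      and y: "y1 = l * x1 + m" "y2 = l * x2 + m" "y3 = l * x3 + m"
      unfolding E by auto
    have "l0 = l \<and> \<not> (x1 = x2 \<and> y1 + y2 + a1 * x2 + a3 = 0)"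
    proof (cases "x1 = x2")
      case False
      then show ?thesis unfolding l0_def using y by (simp add: divide_simps algebra_simps)
    next
      case True
      then have yy: "y1 = y2" using y by simp
      have "3 * x1^2 - 2 * (x1 + x2 + x3) * x1 + B l m = B l m - (x1 * x2 + x2 * x3 + x3 * x1)"
        unfolding True[symmetric] by Groebner_Basis.algebra
      also have "\<dots> = 0" using e2 by (simp add: B_def)
      finally have k: "l * (2 * y1 + a1 * x1 + a3) = 3 * x1^2 + 2 * a2 * x1 + a4 - a1 * y1"
        using tangent[OF y(1) e1] by simp
      with sm have "2 * y1 + a1 * x1 + a3 \<noteq> 0" by auto
      moreover have "y1 + y2 + a1 * x2 + a3 = 2 * y1 + a1 * x1 + a3"
        unfolding yy True by (simp only: mult_2)
      moreover have "l0 = l" if "2 * y1 + a1 * x1 + a3 \<noteq> 0"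
        unfolding l0_def if_P[OF True] k[symmetric] using that by simp
      ultimately show ?thesis by metis
    qed
    moreover have x3: "l^2 + a1 * l - a2 - x1 - x2 = x3" using e1 by (simp add: algebra_simps)
    ultimately have "add_points E (Affine x1 y1) (Affine x2 y2)
        = Affine x3 (- (l * (x3 - x1) + y1) - a1 * x3 - a3)"
      unfolding add by (simp only: if_False x3)
    moreover have "l * (x3 - x1) + y1 = y3" using y by (simp add: algebra_simps)
    ultimately show "add_points E (Affine x1 y1) (Affine x2 y2) = neg_point E (Affine x3 y3)"
      by (simp add: E)
  qed
qed

lemma line_through_swap: "line_through E l m x1 x2 x3 \<longleftrightarrow> line_through E l m x1 x3 x2"
  "line_through E l m x1 x2 x3 \<longleftrightarrow> line_through E l m x2 x1 x3"
  by (cases E; auto simp: algebra_simps)+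

lemma add_points_commute:
  assumes "on_curve E P" "on_curve E Q"
  shows "add_points E P Q = add_points E Q P"
proof -
  obtain a1 a2 a3 a4 a6 where E: "E = Weierstrass a1 a2 a3 a4 a6" by (cases E)
  show ?thesis
  proof (cases P)
    case P: (Affine x1 y1)
    show ?thesis
    proof (cases Q)
      case Q: (Affine x2 y2)
      show ?thesis
      proof (cases "x1 = x2")
        case True
        show ?thesis
        proof (cases "y1 + y2 + a1 * x2 + a3 = 0")
          case False
          then have "y1 = y2" using on_curve_same_x[of y1 a1 x2 a3 _ y2] assms True
            by (auto simp: E P Q)
          with True show ?thesis by (simp add: E P Q)
        qed (use True in \<open>simp add: E P Q add.commute\<close>)
      next
        case False
        have s: "(y2 - y1) / (x2 - x1) = (y1 - y2) / (x1 - x2)"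
          using False by (simp add: divide_simps) (simp add: algebra_simps)
        define l where "l = (y1 - y2) / (x1 - x2)"
        have "l * (x1 - x2) = y1 - y2" using False by (simp add: l_def)
        then have "l * (x - x1) + y1 = l * (x - x2) + y2" for x by (simp add: algebra_simps)
        with False show ?thesis unfolding E P Q
          by (simp add: Let_def s l_def[symmetric]) (simp add: algebra_simps)
      qed
    qed (simp add: E)
  qed (cases Q; simp add: E)
qed

text \<open>The relation \<open>P + Q + R = 0\<close> is symmetric, so that \<open>- P + (P + Q) = Q\<close>.\<close>
lemma add_points_swap:
  assumes "smooth E" "on_curve E P" "on_curve E Q" "on_curve E R"
  shows "add_points E P Q = neg_point E R \<longleftrightarrow> add_points E P R = neg_point E Q"
proof (cases P; cases Q; cases R)
  fix x1 y1 x2 y2 x3 y3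
  assume "P = Affine x1 y1" "Q = Affine x2 y2" "R = Affine x3 y3"
  then show ?thesis
    using assms add_points_eq_neg_iff_line[of E x1 y1 x2 y2 x3 y3]
      add_points_eq_neg_iff_line[of E x1 y1 x3 y3 x2 y2]
    by (simp add: line_through_swap(1)[of E _ _ x1 x2 x3]) blast
qed (use assms add_points_eq_Infinity_iff[of E P] add_points_commute[of E P] in
    \<open>auto simp: neg_point_eq_iff dest: sym[of Infinity]\<close>)

text \<open>Negation carries the line \<open>y = l x + m\<close> to the line \<open>y = - (l + a\<^sub>1) x - (m + a\<^sub>3)\<close> with the same abscissae.\<close>
lemma add_points_neg_points:
  assumes "smooth E" "on_curve E P" "on_curve E Q" "on_curve E R"
    and "add_points E P Q = neg_point E R"
  shows "add_points E (neg_point E P) (neg_point E Q) = R"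
proof (cases "P = Infinity \<or> Q = Infinity \<or> R = Infinity")
  case True
  then show ?thesis
    using assms add_points_eq_Infinity_iff[of E P Q]
      add_points_eq_Infinity_iff[of E "neg_point E P" "neg_point E Q"]
    by (auto simp: on_curve_neg_point)
next
  case False
  obtain a1 a2 a3 a4 a6 where E: "E = Weierstrass a1 a2 a3 a4 a6" by (cases E)
  from False obtain x1 y1 x2 y2 x3 y3
    where P: "P = Affine x1 y1" "Q = Affine x2 y2" "R = Affine x3 y3"
    by (metis point.exhaust)
  have on: "on_curve E (Affine x1 (- y1 - a1 * x1 - a3))" "on_curve E (Affine x2 (- y2 - a1 * x2 - a3))"
    "on_curve E (Affine x3 (- y3 - a1 * x3 - a3))"
    using assms(2-4)[THEN on_curve_neg_point] by (simp_all add: P E)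
  obtain l m where line: "line_through E l m x1 x2 x3"
    and y: "y1 = l * x1 + m" "y2 = l * x2 + m" "y3 = l * x3 + m"
    using assms unfolding P by (subst (asm) add_points_eq_neg_iff_line) auto
  have "(- l - a1)^2 + a1 * (- l - a1) = l^2 + a1 * l"
    "a4 - 2 * (- l - a1) * (- m - a3) - a1 * (- m - a3) - a3 * (- l - a1)
      = a4 - 2 * l * m - a1 * m - a3 * l"
    "(- m - a3)^2 + a3 * (- m - a3) = m^2 + a3 * m"
    by Groebner_Basis.algebra+
  then have "line_through E (- l - a1) (- m - a3) x1 x2 x3"
    using line unfolding E line_through.simps by (simp only:)
  moreover have "- y1 - a1 * x1 - a3 = (- l - a1) * x1 + (- m - a3)"
    "- y2 - a1 * x2 - a3 = (- l - a1) * x2 + (- m - a3)"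
    "- y3 - a1 * x3 - a3 = (- l - a1) * x3 + (- m - a3)"
    using y by (simp_all add: algebra_simps)
  ultimately have "add_points E (Affine x1 (- y1 - a1 * x1 - a3)) (Affine x2 (- y2 - a1 * x2 - a3))
      = neg_point E (Affine x3 (- y3 - a1 * x3 - a3))"
    using add_points_eq_neg_iff_line[OF assms(1) on] by blast
  then show ?thesis by (simp add: P E)
qed

section \<open>Substitutions between Weierstrass curves\<close>

type_synonym 'a coord_change = "'a \<times> 'a \<times> 'a \<times> 'a"

text \<open>The parameters of a substitution are kept as explicit data because descent consists in showing
  that each of them is Galois invariant.\<close>
fun iso_via :: "'a::field coord_change \<Rightarrow> 'a weierstrass \<Rightarrow> 'a weierstrass \<Rightarrow> bool" where
  "iso_via (u, r, s, t) (Weierstrass a1 a2 a3 a4 a6) (Weierstrass a1' a2' a3' a4' a6') \<longleftrightarrow>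
     u \<noteq> 0 \<and>
     u * a1' = a1 + 2 * s \<and>
     u^2 * a2' = a2 - s * a1 + 3 * r - s^2 \<and>
     u^3 * a3' = a3 + r * a1 + 2 * t \<and>
     u^4 * a4' = a4 - s * a3 + 2 * r * a2 - (t + r * s) * a1 + 3 * r^2 - 2 * s * t \<and>
     u^6 * a6' = a6 + r * a4 + r^2 * a2 + r^3 - t * a3 - t^2 - r * t * a1"

text \<open>Here \<open>move \<tau>\<close> sends points of the second curve to points of the first, so composition follows
  the order of the curves.\<close>
fun comp_change :: "'a::field coord_change \<Rightarrow> 'a coord_change \<Rightarrow> 'a coord_change" where
  "comp_change (u, r, s, t) (u', r', s', t') =
     (u * u', u^2 * r' + r, u * s' + s, u^3 * t' + u^2 * s * r' + t)"

fun inv_change :: "'a::field coord_change \<Rightarrow> 'a coord_change" where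
  "inv_change (u, r, s, t) = (1 / u, - r / u^2, - s / u, (r * s - t) / u^3)"

fun move :: "'a::field coord_change \<Rightarrow> 'a point \<Rightarrow> 'a point" where
  "move _ Infinity = Infinity"
| "move (u, r, s, t) (Affine x y) = Affine (u^2 * x + r) (u^3 * y + u^2 * s * x + t)"

lemma isomorphic_curves_iff: "isomorphic_curves E E' \<longleftrightarrow> (\<exists>\<tau>. iso_via \<tau> E E')"
  by (cases E; cases E') auto

lemma iso_via_coefficients:
  fixes a1 :: "'a::field"
  assumes "iso_via (u, r, s, t) (Weierstrass a1 a2 a3 a4 a6) (Weierstrass a1' a2' a3' a4' a6')"
  shows "a1 = u * a1' - 2 * s" "a2 = u^2 * a2' + s * a1 - 3 * r + s^2"
    "a3 = u^3 * a3' - r * a1 - 2 * t"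
    "a4 = u^4 * a4' + s * a3 - 2 * r * a2 + (t + r * s) * a1 - 3 * r^2 + 2 * s * t"
    "a6 = u^6 * a6' - r * a4 - r^2 * a2 - r^3 + t * a3 + t^2 + r * t * a1"
  using assms by simp_all

lemma on_curve_move:
  assumes "iso_via \<tau> E E'"
  shows "on_curve E (move \<tau> P) \<longleftrightarrow> on_curve E' P"
proof (cases P)
  case (Affine x y)
  obtain a1 a2 a3 a4 a6 a1' a2' a3' a4' a6' u r s t
    where E: "E = Weierstrass a1 a2 a3 a4 a6" "E' = Weierstrass a1' a2' a3' a4' a6'"
      and \<tau>: "\<tau> = (u, r, s, t)"
    by (cases E; cases E'; cases \<tau>) metis
  note co = iso_via_coefficients[OF assms[unfolded E \<tau>]]
  define X0 Y0 where "X0 = u^2 * x + r" and "Y0 = u^3 * y + u^2 * s * x + t"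
  have "Y0^2 + a1 * X0 * Y0 + a3 * Y0 - (X0^3 + a2 * X0^2 + a4 * X0 + a6) =
      u^6 * (y^2 + a1' * x * y + a3' * y - (x^3 + a2' * x^2 + a4' * x + a6'))"
    unfolding X0_def Y0_def co(5) co(4) co(3) co(2) co(1) by Groebner_Basis.algebra
  moreover have "u \<noteq> 0" using assms by (simp add: E \<tau>)
  ultimately have "Y0^2 + a1 * X0 * Y0 + a3 * Y0 = X0^3 + a2 * X0^2 + a4 * X0 + a6 \<longleftrightarrow>
      y^2 + a1' * x * y + a3' * y = x^3 + a2' * x^2 + a4' * x + a6'"
    by (metis eq_iff_diff_eq_0 mult_eq_0_iff power_not_zero)
  then show ?thesis by (simp add: E \<tau> Affine X0_def Y0_def)
qed simp

lemma neg_point_move: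
  assumes "iso_via \<tau> E E'"
  shows "neg_point E (move \<tau> P) = move \<tau> (neg_point E' P)"
proof (cases P)
  case (Affine x y)
  obtain a1 a2 a3 a4 a6 a1' a2' a3' a4' a6' u r s t
    where E: "E = Weierstrass a1 a2 a3 a4 a6" "E' = Weierstrass a1' a2' a3' a4' a6'"
      and \<tau>: "\<tau> = (u, r, s, t)"
    by (cases E; cases E'; cases \<tau>) metis
  note co = iso_via_coefficients[OF assms[unfolded E \<tau>]]
  have "- (u^3 * y + u^2 * s * x + t) - a1 * (u^2 * x + r) - a3
      = u^3 * (- y - a1' * x - a3') + u^2 * s * x + t"
    unfolding co(3) co(1) by Groebner_Basis.algebra
  then show ?thesis by (simp add: E \<tau> Affine)
qed simp

lemma smooth_iso_via:
  assumes "iso_via \<tau> E E'" "smooth E"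
  shows "smooth E'"
proof -
  obtain a1 a2 a3 a4 a6 a1' a2' a3' a4' a6' u r s t
    where E: "E = Weierstrass a1 a2 a3 a4 a6" "E' = Weierstrass a1' a2' a3' a4' a6'"
      and \<tau>: "\<tau> = (u, r, s, t)"
    by (cases E; cases E'; cases \<tau>) metis
  note co = iso_via_coefficients[OF assms(1)[unfolded E \<tau>]]
  show ?thesis unfolding E(2) smooth.simps
  proof (intro allI impI notI, elim conjE)
    fix x y
    assume on: "y^2 + a1' * x * y + a3' * y = x^3 + a2' * x^2 + a4' * x + a6'"
      and 1: "2 * y + a1' * x + a3' = 0" and 2: "3 * x^2 + 2 * a2' * x + a4' - a1' * y = 0"
    define X0 Y0 where "X0 = u^2 * x + r" and "Y0 = u^3 * y + u^2 * s * x + t"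
    have "2 * Y0 + a1 * X0 + a3 = u^3 * (2 * y + a1' * x + a3')"
      unfolding X0_def Y0_def co(3) co(1) by Groebner_Basis.algebra
    moreover have "3 * X0^2 + 2 * a2 * X0 + a4 - a1 * Y0
        = u^4 * (3 * x^2 + 2 * a2' * x + a4' - a1' * y) + s * u^3 * (2 * y + a1' * x + a3')"
      unfolding X0_def Y0_def co(4) co(3) co(2) co(1) by Groebner_Basis.algebra
    moreover have "on_curve E (Affine X0 Y0)"
      using on_curve_move[OF assms(1), of "Affine x y"] on by (simp add: E \<tau> X0_def Y0_def)
    ultimately show False using assms(2) by (simp add: E 1 2)
  qed
qed

text \<open>A substitution maps lines to lines: slopes transform by \<open>l \<mapsto> u l + s\<close>.\<close>
lemma add_points_move:
  assumes "iso_via \<tau> E E'" "on_curve E' P" "on_curve E' Q"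
  shows "add_points E (move \<tau> P) (move \<tau> Q) = move \<tau> (add_points E' P Q)"
proof (cases "P = Infinity \<or> Q = Infinity")
  case False
  then obtain x1 y1 x2 y2 where PQ: "P = Affine x1 y1" "Q = Affine x2 y2"
    by (metis point.exhaust)
  obtain a1 a2 a3 a4 a6 a1' a2' a3' a4' a6' u r s t
    where E: "E = Weierstrass a1 a2 a3 a4 a6" "E' = Weierstrass a1' a2' a3' a4' a6'"
      and \<tau>: "\<tau> = (u, r, s, t)"
    by (cases E; cases E'; cases \<tau>) metis
  note co = iso_via_coefficients[OF assms(1)[unfolded E \<tau>]]
  have u: "u \<noteq> 0" using assms(1) by (simp add: E \<tau>)
  define X1 Y1 X2 Y2 where "X1 = u^2 * x1 + r" and "Y1 = u^3 * y1 + u^2 * s * x1 + t"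
    and "X2 = u^2 * x2 + r" and "Y2 = u^3 * y2 + u^2 * s * x2 + t"
  note defs = X1_def Y1_def X2_def Y2_def
  have x_iff: "X1 = X2 \<longleftrightarrow> x1 = x2" using u by (simp add: X1_def X2_def)
  have opp: "Y1 + Y2 + a1 * X2 + a3 = u^3 * (y1 + y2 + a1' * x2 + a3')" if "x1 = x2"
    unfolding defs that co(3) co(1) by Groebner_Basis.algebra
  show ?thesis
  proof (cases "x1 = x2 \<and> y1 + y2 + a1' * x2 + a3' = 0")
    case True
    then show ?thesis using opp x_iff by (simp add: PQ E \<tau> defs)
  next
    case nopp: False
    define l where "l = (if x1 = x2
                    then (3 * x1^2 + 2 * a2' * x1 + a4' - a1' * y1) / (2 * y1 + a1' * x1 + a3')
                    else (y2 - y1) / (x2 - x1))"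
    define L where "L = (if X1 = X2
                    then (3 * X1^2 + 2 * a2 * X1 + a4 - a1 * Y1) / (2 * Y1 + a1 * X1 + a3)
                    else (Y2 - Y1) / (X2 - X1))"
    have L: "L = u * l + s"
    proof (cases "x1 = x2")
      case False
      have "Y2 - Y1 = u^3 * (y2 - y1) + s * (X2 - X1)"
        unfolding defs by Groebner_Basis.algebra
      also have "y2 - y1 = l * (x2 - x1)" using False by (simp add: l_def)
      also have "u^3 * (l * (x2 - x1)) + s * (X2 - X1) = (u * l + s) * (X2 - X1)"
        unfolding defs by Groebner_Basis.algebra
      finally have "Y2 - Y1 = (u * l + s) * (X2 - X1)" .
      moreover have "X2 - X1 \<noteq> 0" using False x_iff by simp
      ultimately show ?thesis using x_iff False by (simp add: L_def)
    next
      case True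
      have "y1 = y2"
        using on_curve_same_x[of y1 a1' x2 a3' _ y2] assms(2,3) True nopp by (auto simp: E PQ)
      have "2 * y1 + a1' * x1 + a3' = y1 + y2 + a1' * x2 + a3'"
        unfolding \<open>y1 = y2\<close> True by (simp only: mult_2)
      with nopp True have ne: "2 * y1 + a1' * x1 + a3' \<noteq> 0" by simp
      have den: "2 * Y1 + a1 * X1 + a3 = u^3 * (2 * y1 + a1' * x1 + a3')"
        unfolding defs co(3) co(1) by Groebner_Basis.algebra
      have "3 * X1^2 + 2 * a2 * X1 + a4 - a1 * Y1
          = u^4 * (3 * x1^2 + 2 * a2' * x1 + a4' - a1' * y1) + s * u^3 * (2 * y1 + a1' * x1 + a3')"
        unfolding defs co(4) co(3) co(2) co(1) by Groebner_Basis.algebra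
      also have "3 * x1^2 + 2 * a2' * x1 + a4' - a1' * y1 = l * (2 * y1 + a1' * x1 + a3')"
        unfolding l_def if_P[OF True] using ne by simp
      also have "u^4 * (l * (2 * y1 + a1' * x1 + a3')) + s * u^3 * (2 * y1 + a1' * x1 + a3')
          = (u * l + s) * (u^3 * (2 * y1 + a1' * x1 + a3'))"
        by Groebner_Basis.algebra
      finally have "3 * X1^2 + 2 * a2 * X1 + a4 - a1 * Y1 = (u * l + s) * (2 * Y1 + a1 * X1 + a3)"
        unfolding den .
      moreover have "2 * Y1 + a1 * X1 + a3 \<noteq> 0" unfolding den using ne u by simp
      ultimately show ?thesis unfolding L_def if_P[OF x_iff[THEN iffD2, OF True]] by simp
    qed
    define x3 where "x3 = l^2 + a1' * l - a2' - x1 - x2"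
    define X3 where "X3 = L^2 + a1 * L - a2 - X1 - X2"
    have X3: "X3 = u^2 * x3 + r"
      unfolding X3_def x3_def L defs co(2) co(1) by Groebner_Basis.algebra
    have Y3: "- (L * (X3 - X1) + Y1) - a1 * X3 - a3
        = u^3 * (- (l * (x3 - x1) + y1) - a1' * x3 - a3') + u^2 * s * x3 + t"
      unfolding X3 L defs co(3) co(1) by Groebner_Basis.algebra
    have "\<not> (X1 = X2 \<and> Y1 + Y2 + a1 * X2 + a3 = 0)"
      using nopp opp x_iff u by auto
    then have "add_points E (Affine X1 Y1) (Affine X2 Y2)
        = Affine X3 (- (L * (X3 - X1) + Y1) - a1 * X3 - a3)"
      unfolding E add_points.simps L_def[symmetric] Let_def X3_def by (simp only: if_False)
    moreover have "add_points E' P Q = Affine x3 (- (l * (x3 - x1) + y1) - a1' * x3 - a3')"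
      using nopp
      unfolding E PQ add_points.simps l_def[symmetric] Let_def x3_def by (simp only: if_False)
    ultimately show ?thesis using X3 Y3 by (simp add: PQ \<tau> defs)
  qed
qed (cases "P = Infinity"; cases \<tau>; cases E; cases E'; cases P; cases Q; simp)

lemma move_comp_change: "move (comp_change \<tau> \<tau>') P = move \<tau> (move \<tau>' P)"
proof (cases \<tau>; cases \<tau>'; cases P)
  fix u r s t u' r' s' t' x y
  assume *: "\<tau> = (u, r, s, t)" "\<tau>' = (u', r', s', t')" "P = Affine x y"
  have "(u * u')\<^sup>2 * x + (u\<^sup>2 * r' + r) = u\<^sup>2 * (u'\<^sup>2 * x + r') + r"
    "(u * u') ^ 3 * y + (u * u')\<^sup>2 * (u * s' + s) * x + (u ^ 3 * t' + u\<^sup>2 * s * r' + t) =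
      u ^ 3 * (u' ^ 3 * y + u'\<^sup>2 * s' * x + t') + u\<^sup>2 * s * (u'\<^sup>2 * x + r') + t"
    by Groebner_Basis.algebra+
  then show ?thesis by (simp add: *)
qed auto

lemma iso_via_comp:
  assumes "iso_via \<tau> E E'" "iso_via \<tau>' E' E''"
  shows "iso_via (comp_change \<tau> \<tau>') E E''"
proof -
  obtain a1 a2 a3 a4 a6 a1' a2' a3' a4' a6' b1 b2 b3 b4 b6 u r s t u' r' s' t'
    where E: "E = Weierstrass a1 a2 a3 a4 a6" "E' = Weierstrass a1' a2' a3' a4' a6'"
        "E'' = Weierstrass b1 b2 b3 b4 b6"
      and \<tau>: "\<tau> = (u, r, s, t)" "\<tau>' = (u', r', s', t')"
    by (cases E; cases E'; cases E''; cases \<tau>; cases \<tau>') metis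
  note co = iso_via_coefficients[OF assms(1)[unfolded E \<tau>]]
    and co' = iso_via_coefficients[OF assms(2)[unfolded E \<tau>]]
  note unf = co(5) co(4) co(3) co(2) co(1)
  note unf' = co'(5) co'(4) co'(3) co'(2) co'(1)
  show ?thesis
    unfolding E \<tau> comp_change.simps iso_via.simps
  proof (intro conjI)
    show "u * u' \<noteq> 0" using assms by (simp add: E \<tau>)
  qed (unfold unf, unfold unf', Groebner_Basis.algebra+)
qed

lemma iso_via_inv:
  assumes "iso_via \<tau> E E'"
  shows "iso_via (inv_change \<tau>) E' E"
proof -
  obtain a1 a2 a3 a4 a6 a1' a2' a3' a4' a6' u r s t
    where E: "E = Weierstrass a1 a2 a3 a4 a6" "E' = Weierstrass a1' a2' a3' a4' a6'"
      and \<tau>: "\<tau> = (u, r, s, t)"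
    by (cases E; cases E'; cases \<tau>) metis
  note co = iso_via_coefficients[OF assms[unfolded E \<tau>]]
  note unf = co(5) co(4) co(3) co(2) co(1)
  have u: "u \<noteq> 0" using assms by (simp add: E \<tau>)
  define i where "i = 1 / u"
  have ui: "u * i = 1" using u by (simp add: i_def)
  have inv: "inv_change \<tau> = (i, - r * i^2, - s * i, (r * s - t) * i^3)"
    using u by (simp add: \<tau> i_def power_divide)
  have p: "i^n * (u^n * z) = z" for n z
    by (metis ui mult.assoc mult.commute mult_1 power_mult_distrib power_one)
  have q: "i * (u * z) = z" for z using p[of 1 z] by simp
  show ?thesis
    unfolding inv E iso_via.simps
  proof (intro conjI)
    show "i \<noteq> 0" using u by (simp add: i_def)
    have a1': "a1' = i * (a1 + 2 * s)" and a2': "a2' = i^2 * (a2 - s * a1 + 3 * r - s^2)"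
      and a3': "a3' = i^3 * (a3 + r * a1 + 2 * t)"
      and a4': "a4' = i^4 * (a4 - s * a3 + 2 * r * a2 - (t + r * s) * a1 + 3 * r^2 - 2 * s * t)"
      and a6': "a6' = i^6 * (a6 + r * a4 + r^2 * a2 + r^3 - t * a3 - t^2 - r * t * a1)"
      using assms q[of a1'] p[of 2 a2'] p[of 3 a3'] p[of 4 a4'] p[of 6 a6']
      unfolding E \<tau> iso_via.simps by metis+
    show "i * a1 = a1' + 2 * (- s * i)" unfolding a1' by Groebner_Basis.algebra
    show "i^2 * a2 = a2' - - s * i * a1' + 3 * (- r * i^2) - (- s * i)^2"
      unfolding a1' a2' by Groebner_Basis.algebra
    show "i^3 * a3 = a3' + - r * i^2 * a1' + 2 * ((r * s - t) * i^3)"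
      unfolding a1' a3' by Groebner_Basis.algebra
    show "i^4 * a4 = a4' - - s * i * a3' + 2 * (- r * i^2) * a2' -
        ((r * s - t) * i^3 + - r * i^2 * (- s * i)) * a1' + 3 * (- r * i^2)^2 -
        2 * (- s * i) * ((r * s - t) * i^3)"
      unfolding a1' a2' a3' a4' by Groebner_Basis.algebra
    show "i^6 * a6 = a6' + - r * i^2 * a4' + (- r * i^2)^2 * a2' + (- r * i^2)^3 -
        (r * s - t) * i^3 * a3' - ((r * s - t) * i^3)^2 - - r * i^2 * ((r * s - t) * i^3) * a1'"
      unfolding a1' a2' a3' a4' a6' by Groebner_Basis.algebra
  qed
qed

lemma comp_change_inv:
  "fst \<tau> \<noteq> 0 \<Longrightarrow> comp_change \<tau> (comp_change (inv_change \<tau>) \<tau>') = \<tau>'"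
  "fst \<tau> \<noteq> 0 \<Longrightarrow> comp_change (inv_change \<tau>) (comp_change \<tau> \<tau>') = \<tau>'"
  by (cases \<tau>; cases \<tau>'; simp add: field_simps power2_eq_square power3_eq_cube)+

lemma move_inv_change [simp]:
  assumes "fst \<tau> \<noteq> 0"
  shows "move (inv_change \<tau>) (move \<tau> P) = P" "move \<tau> (move (inv_change \<tau>) P) = P"
  using assms
  by (cases \<tau>; cases P; simp add: field_simps power2_eq_square power3_eq_cube)+

lemma iso_via_nonzero: "iso_via \<tau> E E' \<Longrightarrow> fst \<tau> \<noteq> 0"
  by (cases \<tau>; cases E; cases E') simp

lemma move_inject: "fst \<tau> \<noteq> 0 \<Longrightarrow> move \<tau> P = move \<tau> Q \<longleftrightarrow> P = Q"
  by (metis move_inv_change(1))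

section \<open>The universal curve with a point of order seven\<close>

text \<open>The multiples of \<open>(0, 0)\<close> on the untwisted curve, in Tate's parameters \<open>b = w\<^sup>3 - w\<^sup>2\<close> and
  \<open>c = w\<^sup>2 - w\<close>.\<close>
fun tate_point :: "'a::field \<Rightarrow> nat \<Rightarrow> 'a point" where
  "tate_point w n =
     (let c = w^2 - w; b = w^3 - w^2 in
      [Infinity, Affine 0 0, Affine b (b * c), Affine c (b - c), Affine c (c^2),
       Affine b 0, Affine 0 b] ! (n mod 7))"

declare tate_point.simps [simp del]

lemma tate_points:
  "tate_point w 0 = Infinity"
  "tate_point w 1 = Affine 0 0"
  "tate_point w 2 = Affine (w^3 - w^2) ((w^3 - w^2) * (w^2 - w))"
  "tate_point w 3 = Affine (w^2 - w) ((w^3 - w^2) - (w^2 - w))"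
  "tate_point w 4 = Affine (w^2 - w) ((w^2 - w)^2)"
  "tate_point w 5 = Affine (w^3 - w^2) 0"
  "tate_point w 6 = Affine 0 (w^3 - w^2)"
  by (simp_all add: tate_point.simps Let_def)

lemma tate_point_mod [simp]: "tate_point w (n mod 7) = tate_point w n"
  by (simp add: tate_point.simps)

lemma mod_7_mem: "(n::nat) mod 7 \<in> {0,1,2,3,4,5,6}"
proof -
  have "n mod 7 < 7" by simp
  then show ?thesis by (simp only: insert_iff empty_iff simp_thms) linarith
qed

lemma on_curve_tate_point: "on_curve (untwisted_curve w) (tate_point w n)"
proof -
  have "on_curve (untwisted_curve w) (tate_point w 0)"
    "on_curve (untwisted_curve w) (tate_point w 1)"
    unfolding tate_points untwisted_curve_def by simp_all
  moreover have "on_curve (untwisted_curve w) (tate_point w 2)"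
    "on_curve (untwisted_curve w) (tate_point w 3)"
    "on_curve (untwisted_curve w) (tate_point w 4)"
    "on_curve (untwisted_curve w) (tate_point w 5)"
    "on_curve (untwisted_curve w) (tate_point w 6)"
    unfolding tate_points untwisted_curve_def on_curve.simps
      power_zero_numeral mult_zero_left mult_zero_right add_0_left add_0_right
    by Groebner_Basis.algebra+
  ultimately have "\<forall>n\<in>{0,1,2,3,4,5,6}. on_curve (untwisted_curve w) (tate_point w n)"
    by blast
  then have "on_curve (untwisted_curve w) (tate_point w (n mod 7))"
    using mod_7_mem by blast
  then show ?thesis by simp
qed

text \<open>At the cusps \<open>w = 0\<close> and \<open>w = 1\<close> of the modular curve the origin is a singular point.\<close>
lemma smooth_untwisted_curve:
  assumes "smooth (untwisted_curve w)"
  shows "w \<noteq> 0" "w \<noteq> 1"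
  using assms by (auto simp: untwisted_curve_def dest!: spec[of _ 0])

lemma neg_tate_point:
  "neg_point (untwisted_curve w) (tate_point w 0) = tate_point w 0"
  "neg_point (untwisted_curve w) (tate_point w 1) = tate_point w 6"
  "neg_point (untwisted_curve w) (tate_point w 2) = tate_point w 5"
  "neg_point (untwisted_curve w) (tate_point w 3) = tate_point w 4"
  "neg_point (untwisted_curve w) (tate_point w 4) = tate_point w 3"
  "neg_point (untwisted_curve w) (tate_point w 5) = tate_point w 2"
  "neg_point (untwisted_curve w) (tate_point w 6) = tate_point w 1"
  unfolding tate_points untwisted_curve_def neg_point.simps
  by (simp_all only: point.inject) (intro conjI refl; Groebner_Basis.algebra)+

text \<open>The seven points form \<open>\<int>/7\<close>. Up to negation and permutation four lines generate the addition
  table, namely those through the multiples \<open>1, 2, 4\<close>, then \<open>1, 1, 5\<close>, then \<open>1, 3, 3\<close>, then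
  \<open>2, 2, 3\<close>; their slopes are polynomials in \<open>w\<close>.\<close>
lemma add_tate_points:
  assumes "smooth (untwisted_curve w)"
  shows "add_points (untwisted_curve w) (tate_point w i) (tate_point w j) = tate_point w (i + j)"
proof -
  let ?E = "untwisted_curve w" and ?T = "tate_point w"
  define Z where "Z i j k \<longleftrightarrow> add_points ?E (?T i) (?T j) = neg_point ?E (?T k)" for i j k
  have swap: "Z i k j" if "Z i j k" for i j k
    using that add_points_swap[OF assms on_curve_tate_point on_curve_tate_point on_curve_tate_point]
    by (simp add: Z_def)
  have comm: "Z j i k" if "Z i j k" for i j k
    using that add_points_commute[OF on_curve_tate_point[of w i] on_curve_tate_point[of w j]]
    unfolding Z_def by metis
  have line: "add_points ?E (Affine x1 y1) (Affine x2 y2) = neg_point ?E (Affine x3 y3)"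
    if "line_through ?E l m x1 x2 x3" "y1 = l * x1 + m" "y2 = l * x2 + m" "y3 = l * x3 + m"
      "on_curve ?E (Affine x1 y1)" "on_curve ?E (Affine x2 y2)" "on_curve ?E (Affine x3 y3)"
    for l m x1 y1 x2 y2 x3 y3
    using add_points_eq_neg_iff_line[OF assms that(5-7)] that(1-4) by blast
  note on = on_curve_tate_point[of w]
  note on = on[of 1] on[of 2] on[of 3] on[of 4] on[of 5]
  note on = on[unfolded tate_points]
  have "line_through ?E (w^2 - w) 0 0 (w^3 - w^2) (w^2 - w)"
    unfolding line_through.simps untwisted_curve_def
    power_zero_numeral mult_zero_left mult_zero_right add_0_left add_0_right diff_0_right
    by (intro conjI; (rule refl | Groebner_Basis.algebra))
  then have 124: "Z 1 2 4" unfolding Z_def tate_points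
    by (rule line) (rule on | simp add: power2_eq_square[of "w^2 - w"])+
  have "line_through ?E 0 0 0 0 (w^3 - w^2)"
    unfolding line_through.simps untwisted_curve_def by simp
  then have 115: "Z 1 1 5" unfolding Z_def tate_points
    by (rule line) (rule on | simp)+
  have "line_through ?E (w - 1) 0 0 (w^2 - w) (w^2 - w)"
    unfolding line_through.simps untwisted_curve_def
    power_zero_numeral mult_zero_left mult_zero_right add_0_left add_0_right diff_0_right
    by (intro conjI; (rule refl | Groebner_Basis.algebra))
  then have 133: "Z 1 3 3" unfolding Z_def tate_points
    by (rule line) (rule on | (simp; fail) | Groebner_Basis.algebra)+
  have "line_through ?E (w^2 - 1) ((w^3 - w^2) * (1 - w)) (w^3 - w^2) (w^3 - w^2) (w^2 - w)"
    unfolding line_through.simps untwisted_curve_def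
    by (intro conjI; Groebner_Basis.algebra)
  then have 223: "Z 2 2 3" unfolding Z_def tate_points
    by (rule line) (rule on | Groebner_Basis.algebra)+
  note Z' = Z_def neg_tate_point
  note neg = add_points_neg_points[OF assms on_curve_tate_point on_curve_tate_point on_curve_tate_point]
  have 653: "Z 6 5 3"
    using neg[OF 124[unfolded Z_def], unfolded neg_tate_point] unfolding Z' .
  have 662: "Z 6 6 2"
    using neg[OF 115[unfolded Z_def], unfolded neg_tate_point] unfolding Z' .
  have 644: "Z 6 4 4"
    using neg[OF 133[unfolded Z_def], unfolded neg_tate_point] unfolding Z' .
  have 554: "Z 5 5 4"
    using neg[OF 223[unfolded Z_def], unfolded neg_tate_point] unfolding Z' .
  note zs = 124 115 133 223 653 662 644 554
  note zs' = zs zs[THEN comm]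
  note zs'' = zs' zs'[THEN swap]
  note all = zs'' zs''[THEN comm]
  note sums = all[unfolded Z']
  have inf: "add_points ?E (?T i) (?T j) = Infinity" if "?T j = neg_point ?E (?T i)" for i j
    using add_points_eq_Infinity_iff[OF on_curve_tate_point on_curve_tate_point] that by blast
  have opp: "add_points ?E (?T 1) (?T 6) = ?T 0" "add_points ?E (?T 2) (?T 5) = ?T 0"
    "add_points ?E (?T 3) (?T 4) = ?T 0" "add_points ?E (?T 4) (?T 3) = ?T 0"
    "add_points ?E (?T 5) (?T 2) = ?T 0" "add_points ?E (?T 6) (?T 1) = ?T 0"
    unfolding tate_points(1) by (rule inf, simp only: neg_tate_point)+
  have "\<forall>i\<in>{0,1,2,3,4,5,6}. \<forall>j\<in>{0,1,2,3,4,5,6}. add_points ?E (?T i) (?T j) = ?T ((i + j) mod 7)"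
    by (simp only: ball_simps simp_thms sums opp tate_points(1) add_points.simps(1)
          add_points_Infinity_right)
       (simp add: tate_points(1) numeral_2_eq_2)
  then have "add_points ?E (?T (i mod 7)) (?T (j mod 7)) = ?T ((i mod 7 + j mod 7) mod 7)"
    using mod_7_mem by blast
  then show ?thesis by (simp add: mod_add_eq)
qed

lemma inj_on_tate_point:
  assumes "smooth (untwisted_curve w)"
  shows "inj_on (tate_point w) {..<7}"
proof -
  let ?E = "untwisted_curve w" and ?T = "tate_point w"
  have nz: "?T n \<noteq> Infinity" if "n mod 7 \<noteq> 0" for n
  proof -
    have "?T (n mod 7) \<noteq> Infinity" using that mod_7_mem[of n]
      by (auto simp: tate_point.simps Let_def)
    then show ?thesis by simp
  qed
  show ?thesis
  proof (rule inj_onI, rule ccontr)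
    fix i j :: nat assume ij: "i \<in> {..<7}" "j \<in> {..<7}" "?T i = ?T j" "i \<noteq> j"
    have "?T (i + (7 - j)) = ?T (j + (7 - j))"
      using add_tate_points[OF assms] ij(3) by metis
    moreover have "?T (j + (7 - j)) = Infinity" using ij(2) by (simp add: tate_point.simps)
    moreover have "(i + (7 - j)) mod 7 \<noteq> 0" using ij by (cases "i < j") (auto simp: le_mod_geq)
    ultimately show False using nz by metis
  qed
qed

text \<open>The tangent at the origin is horizontal on both curves, which forces \<open>s = 0\<close>, and
  \<open>a\<^sub>2 = a\<^sub>3 \<noteq> 0\<close> on both, which forces \<open>u = 1\<close>.\<close>
lemma iso_via_same_origin:
  assumes "iso_via (u, 0, s, 0) (untwisted_curve w) (untwisted_curve w')" "w \<noteq> 0" "w \<noteq> 1"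
  shows "u = 1" "s = 0" "w' = w"
proof -
  define b where "b = - (w^3) + w^2"
  have "b = w^2 * (1 - w)" unfolding b_def by Groebner_Basis.algebra
  then have b: "b \<noteq> 0" using assms by simp
  have u: "u \<noteq> 0" and e1: "u * (- (w'^2) + w' + 1) = - (w^2) + w + 1 + 2 * s"
    and e2: "u^2 * (- (w'^3) + w'^2) = b - s * (- (w^2) + w + 1) - s^2"
    and e3: "u^3 * (- (w'^3) + w'^2) = b" and e4: "s * b = 0"
    using assms(1) by (simp_all add: untwisted_curve_def b_def)
  show s: "s = 0" using e4 b by simp
  have e2': "u^2 * (- (w'^3) + w'^2) = b" using e2 s by simp
  have "u^3 * (- (w'^3) + w'^2) = u * (u^2 * (- (w'^3) + w'^2))" by Groebner_Basis.algebra
  then have "b = u * b" by (simp only: e2' e3)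
  with b show u1: "u = 1" by simp
  have "w'^2 - w' = w^2 - w" using e1 s u1 by (simp add: algebra_simps)
  moreover have "w' * (w'^2 - w') = w * (w^2 - w)"
    using e2' u1 unfolding b_def by (simp add: algebra_simps power2_eq_square power3_eq_cube)
  ultimately have "w' * (w^2 - w) = w * (w^2 - w)" by simp
  moreover have "(w' - w) * (w * (w - 1)) = w' * (w^2 - w) - w * (w^2 - w)"
    by Groebner_Basis.algebra
  ultimately have "(w' - w) * (w * (w - 1)) = 0" by simp
  then show "w' = w" using assms by simp
qed

text \<open>Tate's normal form of a curve with a marked point is unique, together with the substitution
  leading to it. All Galois descent below rests on this.\<close>
lemma iso_via_untwisted_unique:
  assumes "smooth E"
    and "iso_via \<tau> E (untwisted_curve w)" "iso_via \<tau>' E (untwisted_curve w')"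
    and "move \<tau> (Affine 0 0) = move \<tau>' (Affine 0 0)"
  shows "\<tau> = \<tau>'" "w = w'"
proof -
  note nz = iso_via_nonzero[OF assms(2)]
  have iso: "iso_via (comp_change (inv_change \<tau>) \<tau>') (untwisted_curve w) (untwisted_curve w')"
    using iso_via_comp[OF iso_via_inv[OF assms(2)] assms(3)] .
  have w: "w \<noteq> 0" "w \<noteq> 1"
    using smooth_untwisted_curve[OF smooth_iso_via[OF assms(2,1)]] by auto
  have "move (comp_change (inv_change \<tau>) \<tau>') (Affine 0 0) = Affine 0 0"
    unfolding move_comp_change assms(4)[symmetric] using nz by simp
  then obtain u s where us: "comp_change (inv_change \<tau>) \<tau>' = (u, 0, s, 0)"
    by (cases "comp_change (inv_change \<tau>) \<tau>'") simp
  note eqs = iso_via_same_origin[OF iso[unfolded us] w]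
  show "w = w'" using eqs by simp
  have "\<tau>' = comp_change \<tau> (comp_change (inv_change \<tau>) \<tau>')"
    using comp_change_inv(1)[OF nz] by simp
  also have "\<dots> = \<tau>" unfolding us eqs by (cases \<tau>) simp
  finally show "\<tau> = \<tau>'" by simp
qed

text \<open>The substitution that brings the marked point \<open>4 (0, 0)\<close> of the untwisted curve to the origin.
  It changes the parameter by the map \<open>w \<mapsto> 1 / (1 - w)\<close> of order three, the same map by which
  \<open>\<sigma>\<close> permutes the roots of an adapted cubic.\<close>
definition quadruple_change :: "'a::field \<Rightarrow> 'a coord_change" where
  "quadruple_change w = ((1 - w)^2, w^2 - w, w * (w - 2), (w^2 - w)^2)"

lemma quadruple_change:
  fixes w :: "'a::field"
  assumes "w \<noteq> 1"
  shows "iso_via (quadruple_change w) (untwisted_curve w) (untwisted_curve (1 / (1 - w)))"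
    and "move (quadruple_change w) (Affine 0 0) = tate_point w 4"
proof -
  define i where "i = 1 / (1 - w)"
  have i: "(1 - w) * i = 1" using assms by (simp add: i_def)
  have w: "w * i = i - 1" using i by (simp add: algebra_simps)
  have 1: "(1 - w)^2 * (- (i^2) + i + 1) = (1 - w)^2 - 1 + (1 - w)"
  proof -
    have "(1 - w)^2 * (- (i^2) + i + 1) = (1 - w)^2 - ((1 - w) * i)^2 + (1 - w) * ((1 - w) * i)"
      by Groebner_Basis.algebra
    then show ?thesis by (simp only: i power_one mult_1_right)
  qed
  have 2: "((1 - w)^2)^2 * (- (i^3) + i^2) = (1 - w)^2 - (1 - w)"
  proof -
    have "((1 - w)^2)^2 * (- (i^3) + i^2)
        = (1 - w)^2 * ((1 - w) * i)^2 - (1 - w) * ((1 - w) * i)^3"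
      by Groebner_Basis.algebra
    then show ?thesis by (simp only: i power_one mult_1_right)
  qed
  have 3: "((1 - w)^2)^3 * (- (i^3) + i^2) = (1 - w)^2 * (((1 - w)^2)^2 * (- (i^3) + i^2))"
    by Groebner_Basis.algebra
  show "iso_via (quadruple_change w) (untwisted_curve w) (untwisted_curve (1 / (1 - w)))"
    unfolding quadruple_change_def untwisted_curve_def iso_via.simps i_def[symmetric] 1 3 2
  proof (intro conjI)
    show "(1 - w)^2 \<noteq> 0" using assms by simp
  qed (Groebner_Basis.algebra+)
  show "move (quadruple_change w) (Affine 0 0) = tate_point w 4"
    by (simp add: quadruple_change_def tate_points)
qed

section \<open>Commutative inverse property loops of order seven\<close>

lemma involution_fixed_point:
  assumes "finite A" "odd (card A)" "\<And>x. x \<in> A \<Longrightarrow> i x \<in> A" "\<And>x. x \<in> A \<Longrightarrow> i (i x) = x"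
  shows "\<exists>x\<in>A. i x = x"
  using assms
proof (induction "card A" arbitrary: A rule: less_induct)
  case less
  show ?case
  proof (rule ccontr)
    assume no: "\<not> (\<exists>x\<in>A. i x = x)"
    from less.prems(2) have "A \<noteq> {}" by auto
    then obtain a where a: "a \<in> A" by blast
    have ia: "i a \<in> A" "i a \<noteq> a" using less.prems(3) a no by auto
    define B where "B = A - {a, i a}"
    have "card B = card A - 2"
      unfolding B_def using less.prems(1) a ia by (subst card_Diff_subset) auto
    moreover have "card {a, i a} \<le> card A"
      using less.prems(1) a ia by (intro card_mono) auto
    then have "card A \<ge> 2" using ia by simp
    ultimately have "card B < card A" "odd (card B)" using less.prems(2) by auto
    moreover have "i x \<in> B" if "x \<in> B" for x
      using that less.prems(3)[of x] less.prems(4)[of x] less.prems(4)[OF a] unfolding B_def by auto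
    ultimately have "\<exists>x\<in>B. i x = x"
      using less.hyps[of B] less.prems(1,4) unfolding B_def by auto
    then show False using no unfolding B_def by auto
  qed
qed

text \<open>Without associativity a subgroup of points is only known to be a commutative loop with the inverse
  property. At order seven this already implies that \<open>- p\<close> is none of \<open>p\<close>, \<open>2 p\<close>, \<open>3 p\<close> and that
  \<open>4 p = - 3 p\<close> for \<open>p \<noteq> 0\<close>, and Tate's normal form uses no more.\<close>
locale commutative_ip_loop =
  fixes S :: "'b set" and add :: "'b \<Rightarrow> 'b \<Rightarrow> 'b" and neg :: "'b \<Rightarrow> 'b" and zero :: 'b
  assumes card_7: "card S = 7"
    and zero_in: "zero \<in> S" and add_in: "x \<in> S \<Longrightarrow> y \<in> S \<Longrightarrow> add x y \<in> S"
    and neg_in: "x \<in> S \<Longrightarrow> neg x \<in> S"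
    and add_zero: "x \<in> S \<Longrightarrow> add x zero = x"
    and commute: "x \<in> S \<Longrightarrow> y \<in> S \<Longrightarrow> add x y = add y x"
    and add_eq_zero: "x \<in> S \<Longrightarrow> y \<in> S \<Longrightarrow> add x y = zero \<longleftrightarrow> y = neg x"
    and neg_neg: "x \<in> S \<Longrightarrow> neg (neg x) = x"
    and inverse_property: "x \<in> S \<Longrightarrow> y \<in> S \<Longrightarrow> z \<in> S \<Longrightarrow> add x y = z \<Longrightarrow> add (neg x) z = y"
begin

lemma finite_S: "finite S"
  using card_7 by (metis card.infinite zero_neq_numeral)

text \<open>The reflection \<open>x \<mapsto> p - x\<close>.\<close>

definition reflect :: "'b \<Rightarrow> 'b \<Rightarrow> 'b" where "reflect p x = add p (neg x)"

lemma reflect_in: "p \<in> S \<Longrightarrow> x \<in> S \<Longrightarrow> reflect p x \<in> S"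
  by (simp add: reflect_def add_in neg_in)

lemma reflect_eq_iff:
  assumes "p \<in> S" "x \<in> S" "y \<in> S"
  shows "reflect p x = y \<longleftrightarrow> add x y = p"
proof
  assume "reflect p x = y"
  then have "add (neg x) p = y" using assms by (simp add: reflect_def commute neg_in)
  then show "add x y = p" using inverse_property[of "neg x" p y] assms by (simp add: neg_in neg_neg)
next
  assume "add x y = p"
  then have "add (neg x) p = y" using inverse_property assms by simp
  then show "reflect p x = y" using assms by (simp add: reflect_def commute neg_in)
qed

lemma reflect_refl: "p \<in> S \<Longrightarrow> x \<in> S \<Longrightarrow> reflect p (reflect p x) = x"
  by (metis reflect_eq_iff reflect_in commute)

text \<open>The reflection in \<open>p\<close> is an involution of a set of odd size, so it has a fixed point.\<close>
lemma halving: "p \<in> S \<Longrightarrow> \<exists>x\<in>S. add x x = p"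
  using involution_fixed_point[of S "reflect p"] finite_S card_7 reflect_in reflect_refl reflect_eq_iff
  by auto

lemma doubling_inj: "inj_on (\<lambda>x. add x x) S"
proof -
  have "(\<lambda>x. add x x) ` S = S" using halving add_in by blast
  then show ?thesis using finite_S by (simp add: eq_card_imp_inj_on)
qed

lemma double_eq: "x \<in> S \<Longrightarrow> y \<in> S \<Longrightarrow> add x x = add y y \<Longrightarrow> x = y"
  using doubling_inj by (auto simp: inj_on_def)

lemma neg_zero: "neg zero = zero"
  using add_eq_zero[of zero zero] add_zero zero_in by simp

lemma no_2_torsion: "x \<in> S \<Longrightarrow> neg x = x \<Longrightarrow> x = zero"
  using double_eq[of x zero] add_eq_zero[of x x] add_zero zero_in by simp

text \<open>The set is exhausted by adjoining pairs \<open>{x, - x}\<close> to \<open>{0}\<close>, since there are no elements of order two.\<close>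
definition symmetric_subset :: "'b set \<Rightarrow> bool" where
  "symmetric_subset T \<longleftrightarrow> T \<subseteq> S \<and> zero \<in> T \<and> (\<forall>y\<in>T. neg y \<in> T)"

lemma symmetric_subset_zero: "symmetric_subset {zero}"
  using zero_in neg_zero by (simp add: symmetric_subset_def)

lemma symmetric_subset_extend:
  assumes "symmetric_subset T" "x \<in> S" "x \<notin> T"
  shows "neg x \<in> S" "neg x \<notin> T" "neg x \<noteq> x"
    and "symmetric_subset (T \<union> {x, neg x})" "card (T \<union> {x, neg x}) = card T + 2"
proof -
  show 1: "neg x \<in> S" "neg x \<notin> T" "neg x \<noteq> x"
    using assms neg_in neg_neg no_2_torsion unfolding symmetric_subset_def by metis+
  show "symmetric_subset (T \<union> {x, neg x})"
    using assms 1(1) neg_neg unfolding symmetric_subset_def by auto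
  have "finite T"
    using assms(1) finite_S finite_subset unfolding symmetric_subset_def by blast
  then show "card (T \<union> {x, neg x}) = card T + 2" using assms(3) 1 by simp
qed

lemma symmetric_subset_eq:
  assumes "symmetric_subset T" "card T = 7"
  shows "T = S"
  using assms finite_S card_7 card_subset_eq unfolding symmetric_subset_def by metis

lemma symmetric_subset_proper:
  assumes "symmetric_subset T" "card T < 7"
  obtains x where "x \<in> S" "x \<notin> T"
  using assms card_7 unfolding symmetric_subset_def by (metis less_irrefl subset_antisym subsetI)

lemma add_neg_neg: "x \<in> S \<Longrightarrow> y \<in> S \<Longrightarrow> add (neg x) (neg y) = neg (add x y)"
proof -
  assume xy: "x \<in> S" "y \<in> S"
  then have "add (neg x) (add x y) = y" using inverse_property add_in by simp
  then have "add (add x y) (neg x) = y" using xy by (simp add: add_in commute neg_in)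
  then have "add (neg (add x y)) y = neg x"
    using inverse_property[of "add x y" "neg x" y] xy by (simp add: add_in neg_in)
  then have "add y (neg (add x y)) = neg x" using xy by (simp add: add_in commute neg_in)
  then have "add (neg y) (neg x) = neg (add x y)"
    using inverse_property[of y "neg (add x y)" "neg x"] xy by (simp add: add_in neg_in)
  then show ?thesis using xy by (simp add: commute neg_in)
qed

context
  fixes p assumes p: "p \<in> S" "p \<noteq> zero"
begin

text \<open>Only the half of \<open>p\<close> is fixed by the reflection.\<close>
lemma reflect_avoids:
  assumes "h \<in> S" "add h h = p" "x \<in> S" "x \<noteq> h"
  shows "reflect p x \<noteq> x" "reflect p x \<noteq> neg x"
  using reflect_eq_iff[of p x x] reflect_eq_iff[of p x "neg x"] double_eq[of x h]
    add_eq_zero[of x "neg x"] neg_in[of x] assms p by metis+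

lemma reflect_notin:
  assumes "\<forall>y\<in>T. reflect p y \<in> T" "x \<in> S" "x \<notin> T"
  shows "reflect p x \<notin> T"
  using assms reflect_refl p by metis

lemma reflect_zero: "reflect p zero = p" and reflect_self: "reflect p p = zero"
  and reflect_neg: "x \<in> S \<Longrightarrow> reflect p (neg x) = add p x"
  using neg_zero add_zero p add_eq_zero[of p "neg p"] neg_in[of p] neg_neg by (auto simp: reflect_def)

text \<open>If \<open>2 p = - p\<close>, the reflection in \<open>p\<close> preserves \<open>{0, p, - p}\<close> and fixes \<open>- p\<close>. On the
  remaining pairs \<open>{\<plusminus> b}, {\<plusminus> c}\<close> it then has to act by \<open>b \<mapsto> c\<close> and \<open>- b \<mapsto> - c\<close>, up to the
  sign of \<open>c\<close>, which gives \<open>b + c = p\<close> and \<open>- b - c = p\<close>.\<close>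
lemma double_not_neg: "add p p \<noteq> neg p"
proof
  assume 2: "add p p = neg p"
  let ?T = "{zero} \<union> {p, neg p}"
  have T: "symmetric_subset ?T" "card ?T = 3"
    using symmetric_subset_extend(4,5)[OF symmetric_subset_zero p(1)] p(2) by simp_all
  obtain b where b: "b \<in> S" "b \<notin> ?T"
    using symmetric_subset_proper[OF T(1)] T(2) by auto
  note nb = symmetric_subset_extend(1-3)[OF T(1) b]
  let ?T' = "?T \<union> {b, neg b}"
  have T': "symmetric_subset ?T'" "card ?T' = 5"
    using symmetric_subset_extend(4,5)[OF T(1) b] T(2) by simp_all
  have half: "neg p \<in> S" "add (neg p) (neg p) = p"
    using add_neg_neg[of p p] 2 neg_neg p neg_in by simp_all
  have reflect_T: "\<forall>y\<in>?T. reflect p y \<in> ?T"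
    using reflect_zero reflect_self reflect_neg[OF p(1)] 2 by simp
  define c where "c = reflect p b"
  define d where "d = reflect p (neg b)"
  have cS: "c \<in> S" and dS: "d \<in> S" using reflect_in p b nb by (simp_all add: c_def d_def)
  have "c \<notin> ?T" unfolding c_def by (rule reflect_notin[OF reflect_T b])
  moreover have "c \<noteq> b" "c \<noteq> neg b" unfolding c_def using reflect_avoids[OF half b(1)] b by auto
  ultimately have "c \<notin> ?T'" by simp
  then have "symmetric_subset (?T' \<union> {c, neg c})" "card (?T' \<union> {c, neg c}) = 7"
    using symmetric_subset_extend(4,5)[OF T'(1) cS] T'(2) by simp_all
  then have S: "?T' \<union> {c, neg c} = S" by (rule symmetric_subset_eq)
  have "d \<notin> ?T" unfolding d_def by (rule reflect_notin[OF reflect_T nb(1,2)])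
  moreover have "d \<noteq> neg b" "d \<noteq> b"
    unfolding d_def using reflect_avoids[OF half nb(1)] nb neg_neg[OF b(1)] by auto
  moreover have "d \<noteq> c" unfolding c_def d_def using reflect_refl b nb p by metis
  ultimately have "d = neg c" using dS S by blast
  then have "add (neg b) (neg c) = p" using reflect_eq_iff[of p "neg b" d] p nb dS d_def by metis
  moreover have "add b c = p" using reflect_eq_iff[of p b c] p b cS c_def by metis
  ultimately have "neg p = p" using add_neg_neg[of b c] b cS by simp
  then show False using p no_2_torsion by auto
qed

text \<open>With \<open>d = 2 p\<close> and \<open>e = 3 p\<close>, the reflection in \<open>p\<close> exchanges \<open>0\<close> with \<open>p\<close>, \<open>d\<close> with
  \<open>- p\<close> and \<open>e\<close> with \<open>- d\<close>. Once \<open>e \<noteq> - d\<close> is known, \<open>- e\<close> is the only element left and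
  has to be fixed. If \<open>e = - d\<close>, the fixed point is \<open>- d\<close>, and the last pair
  \<open>{c, - c}\<close> can be neither fixed nor exchanged.\<close>
lemma fourfold: "add (add (add p p) p) p = neg (add (add p p) p)" and threefold_not_neg: "add (add p p) p \<noteq> neg p"
proof -
  define d where "d = add p p"
  define e where "e = add d p"
  have dS: "d \<in> S" and eS: "e \<in> S" using p add_in by (auto simp: d_def e_def)
  have np: "neg p \<noteq> zero" "neg p \<noteq> p" "neg p \<in> S" using p no_2_torsion neg_neg neg_zero neg_in by metis+
  have zero_add: "add zero x = x" if "x \<in> S" for x using that add_zero commute zero_in by metis
  have d_zero: "d \<noteq> zero" using p np add_eq_zero[of p p] by (auto simp: d_def)
  have d_p: "d \<noteq> p" using inverse_property[of p p p] p add_eq_zero[of "neg p" p] neg_neg np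
    by (auto simp: d_def)
  have d_np: "d \<noteq> neg p" using double_not_neg by (simp add: d_def)
  have nd: "neg d \<noteq> zero" "neg d \<noteq> d" "neg d \<in> S" "neg d \<noteq> p" "neg d \<noteq> neg p"
    using dS d_zero no_2_torsion neg_neg neg_zero neg_in d_np d_p p by metis+
  have e: "add p d = e" "add d p = e" using commute dS p by (auto simp: e_def)
  have e_zero: "e \<noteq> zero" using e add_eq_zero[of d p] p dS nd by metis
  have ip: "add (neg p) e = d" "add (neg d) e = p"
    using inverse_property[OF _ _ _ e(1)] inverse_property[OF _ _ _ e(2)] p dS eS by auto
  have e_p: "e \<noteq> p" using ip add_eq_zero[of "neg p" p] p np neg_neg d_zero by auto
  have e_d: "e \<noteq> d" using ip add_eq_zero[of "neg d" d] p nd dS neg_neg by auto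
  show e_np: "add (add p p) p \<noteq> neg p"
  proof
    assume "add (add p p) p = neg p"
    then have "e = neg p" by (simp add: e_def d_def)
    have "d = add (neg p) (neg p)" using ip \<open>e = neg p\<close> by simp
    then have "d = neg d" using add_neg_neg[of p p] p by (simp add: d_def)
    then show False using nd by simp
  qed
  then have e_np: "e \<noteq> neg p" by (simp add: e_def d_def)
  have ne: "neg e \<in> S" "neg e \<noteq> zero" "neg e \<noteq> e" "neg e \<noteq> p" "neg e \<noteq> neg p"
    using eS e_zero e_np e_p no_2_torsion neg_neg neg_zero neg_in p by metis+
  have refls: "reflect p zero = p" "reflect p p = zero" "reflect p d = neg p" "reflect p (neg p) = d"
    "reflect p (neg d) = e"
    using reflect_zero reflect_self reflect_neg p dS e reflect_refl[of p "neg p"] np by (simp_all add: d_def)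
  let ?T = "{zero} \<union> {p, neg p} \<union> {d, neg d}"
  have T: "symmetric_subset ({zero} \<union> {p, neg p})" "card ({zero} \<union> {p, neg p}) = 3"
    using symmetric_subset_extend(4,5)[OF symmetric_subset_zero p(1)] p(2) by simp_all
  have T': "symmetric_subset ?T" "card ?T = 5"
    using symmetric_subset_extend(4,5)[OF T(1) dS] d_zero d_p d_np T(2) by simp_all
  have e_nd: "e \<noteq> neg d"
  proof
    assume e_eq: "e = neg d"
    obtain c where c: "c \<in> S" "c \<notin> ?T"
      using symmetric_subset_proper[OF T'(1)] T'(2) by auto
    have S: "?T \<union> {c, neg c} = S"
      using symmetric_subset_extend(4,5)[OF T'(1) c] T'(2) by (intro symmetric_subset_eq) simp_all
    have "add (neg d) (neg d) = p"
      using reflect_eq_iff[of p "neg d" "neg d"] refls(5) e_eq p nd by metis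
    then have "reflect p c \<noteq> c" "reflect p c \<noteq> neg c"
      using reflect_avoids[OF nd(3) _ c(1)] c by auto
    moreover have "reflect p c \<notin> ?T"
      using c by (intro reflect_notin) (simp_all add: refls e_eq)
    ultimately show False using reflect_in[OF p(1) c(1)] S by blast
  qed
  have "neg e \<noteq> d" "neg e \<noteq> neg d" using e_d e_nd neg_neg eS dS by metis+
  have "e \<notin> ?T" using e_zero e_p e_np e_d e_nd by simp
  then have S: "?T \<union> {e, neg e} = S"
    using symmetric_subset_extend(4,5)[OF T'(1) eS] T'(2) by (intro symmetric_subset_eq) simp_all
  define x where "x = add p e"
  have xS: "x \<in> S" using p eS add_in by (simp add: x_def)
  have x: "reflect p x = neg e"
    using reflect_refl[of p "neg e"] p ne eS neg_neg by (simp add: x_def reflect_def)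
  have "x \<noteq> e"
  proof
    assume "x = e"
    then have "add (neg p) e = e" using inverse_property[of p e e] p eS by (simp add: x_def)
    then show False using ip e_d by simp
  qed
  moreover have "x \<noteq> y" if "y \<in> ?T" for y
    using that x refls ne \<open>neg e \<noteq> d\<close> by auto
  ultimately have "x = neg e" using xS S by auto
  then show "add (add (add p p) p) p = neg (add (add p p) p)"
    using commute[of p e] p eS by (simp add: x_def e_def d_def)
qed

end

end

section \<open>The fixed field of the absolute Galois group\<close>

locale field_embedding =
  fixes h :: "'a::field \<Rightarrow> 'b::field"
  assumes add [simp]: "h (x + y) = h x + h y"
    and mult [simp]: "h (x * y) = h x * h y"
    and one [simp]: "h 1 = 1"
begin

lemma zero [simp]: "h 0 = 0"
proof -
  have "h 0 = h 0 + h 0" using add[of 0 0] by (simp only: add_0_right)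
  then show ?thesis by (simp only: add_cancel_right_right)
qed

lemma minus [simp]: "h (- x) = - h x"
  using add[of x "- x"] by (simp add: eq_neg_iff_add_eq_0 add.commute)

lemma diff [simp]: "h (x - y) = h x - h y"
  using add[of x "- y"] by simp

lemma power [simp]: "h (x ^ n) = h x ^ n"
  by (induction n) simp_all

lemma of_nat [simp]: "h (of_nat n) = of_nat n"
  by (induction n) simp_all

lemma numeral [simp]: "h (numeral n) = numeral n"
  using of_nat[of "numeral n"] by simp

lemma eq_zero_iff [simp]: "h x = 0 \<longleftrightarrow> x = 0"
proof
  assume "h x = 0"
  then have "h (x * inverse x) = 0" by (simp only: mult) simp
  then show "x = 0" by (cases "x = 0") simp_all
qed simp

lemma eq_iff [simp]: "h x = h y \<longleftrightarrow> x = y"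
  using eq_zero_iff[of "x - y"] by simp

lemma divide [simp]: "h (x / y) = h x / h y"
proof (cases "y = 0")
  case False
  then have "h (x / y) * h y = h x" by (simp flip: mult)
  with False show ?thesis by (simp add: nonzero_eq_divide_eq)
qed simp

lemma sum [simp]: "h (sum f A) = (\<Sum>x\<in>A. h (f x))"
  by (induction A rule: infinite_finite_induct) simp_all

lemma map_poly_mult: "map_poly h (p * q) = map_poly h p * map_poly h q"
  by (rule poly_eqI) (simp add: coeff_map_poly coeff_mult)

lemma map_poly_add: "map_poly h (p + q) = map_poly h p + map_poly h q"
  by (rule poly_eqI) (simp add: coeff_map_poly)

lemma map_poly_pderiv: "map_poly h (pderiv p) = pderiv (map_poly h p)"
  by (rule poly_eqI) (simp add: coeff_map_poly coeff_pderiv)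

lemma map_poly_eq_0_iff [simp]: "map_poly h p = 0 \<longleftrightarrow> p = 0"
  by (simp add: poly_eq_iff coeff_map_poly)

lemma map_poly_pCons: "map_poly h (pCons a p) = pCons (h a) (map_poly h p)"
  by (cases "pCons a p = 0") (auto simp: map_poly_pCons)

end

text \<open>An element of least degree in the ideal generated by \<open>p\<close> and \<open>q\<close> divides both. The relation is
  needed because coprimality itself does not visibly pass to an extension field, while an identity
  does.\<close>
lemma coprime_poly_bezout:
  fixes p q :: "'a::field poly"
  assumes "coprime p q"
  obtains a b where "a * p + b * q = 1"
proof -
  define I where "I = {a * p + b * q | a b. True}"
  have diff: "x - c * y \<in> I" if "x \<in> I" "y \<in> I" for x y c
  proof -
    from that obtain a b a' b' where "x = a * p + b * q" "y = a' * p + b' * q"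
      unfolding I_def by blast
    then have "x - c * y = (a - c * a') * p + (b - c * b') * q" by (simp add: algebra_simps)
    then show ?thesis unfolding I_def by blast
  qed
  have "p = 1 * p + 0 * q" "q = 0 * p + 1 * q" by simp_all
  then have p: "p \<in> I" and q: "q \<in> I" unfolding I_def by blast+
  have "p \<noteq> 0 \<or> q \<noteq> 0" using assms by auto
  then have "\<exists>g. g \<in> I \<and> g \<noteq> 0" using p q by blast
  then obtain g where g: "g \<in> I" "g \<noteq> 0" and min: "\<And>f. f \<in> I \<and> f \<noteq> 0 \<Longrightarrow> degree g \<le> degree f"
    using ex_has_least_nat[of "\<lambda>g. g \<in> I \<and> g \<noteq> 0" _ degree] by blast
  have "g dvd f" if "f \<in> I" for f
  proof -
    have "f mod g = f - (f div g) * g" by (simp add: minus_div_mult_eq_mod)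
    then have "f mod g \<in> I" using diff[OF that g(1)] by simp
    then have "f mod g = 0" using min[of "f mod g"] degree_mod_less[OF g(2), of f] by fastforce
    then show ?thesis by (simp add: mod_eq_0_iff_dvd)
  qed
  then have "is_unit g" using p q assms by (meson coprime_def)
  then obtain c where c: "c * g = 1" by (metis dvdE mult.commute)
  obtain a b where "g = a * p + b * q" using g(1) unfolding I_def by blast
  then have "(c * a) * p + (c * b) * q = 1" using c by (simp add: algebra_simps)
  then show thesis by (rule that)
qed

lemma separable_poly_nonzero: "separable_poly p \<Longrightarrow> p \<noteq> 0"
  by (auto simp: separable_poly_def)

lemma separable_poly_dvd:
  fixes p q :: "'a::field poly"
  assumes "separable_poly p" "q dvd p"
  shows "separable_poly q"
  unfolding separable_poly_def
proof (rule coprimeI)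
  fix c assume c: "c dvd q" "c dvd pderiv q"
  obtain r where p: "p = q * r" using assms(2) by blast
  have "c dvd p" using c p by simp
  moreover have "c dvd pderiv p" using c unfolding p pderiv_mult by simp
  ultimately show "is_unit c" using assms(1) unfolding separable_poly_def by (meson coprime_def)
qed

lemma separable_poly_simple_root:
  fixes p q :: "'a::field poly"
  assumes "separable_poly p" "p = [:- x, 1:] * q"
  shows "poly q x \<noteq> 0"
proof
  assume "poly q x = 0"
  then have "[:- x, 1:] dvd q" by (simp add: poly_eq_0_iff_dvd)
  then have "[:- x, 1:] dvd pderiv p"
    unfolding assms(2) pderiv_mult by (intro dvd_add dvd_triv_left dvd_mult2)
  moreover have "[:- x, 1:] dvd p" unfolding assms(2) by (rule dvd_triv_left)
  ultimately have "is_unit [:- x, 1:]"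
    using assms(1) unfolding separable_poly_def by (meson coprime_def)
  then show False by (simp add: is_unit_iff_degree)
qed

lemma (in field_embedding) separable_map_poly:
  assumes "separable_poly p"
  shows "separable_poly (map_poly h p)"
proof -
  obtain a b where "a * p + b * pderiv p = 1"
    using assms coprime_poly_bezout unfolding separable_poly_def by blast
  then have "map_poly h (a * p + b * pderiv p) = 1" by (simp add: map_poly_1)
  then have 1: "map_poly h a * map_poly h p + map_poly h b * pderiv (map_poly h p) = 1"
    by (simp add: map_poly_add map_poly_mult map_poly_pderiv)
  show ?thesis unfolding separable_poly_def
  proof (rule coprimeI)
    fix c assume "c dvd map_poly h p" "c dvd pderiv (map_poly h p)"
    then have "c dvd map_poly h a * map_poly h p + map_poly h b * pderiv (map_poly h p)" by simp
    then show "is_unit c" unfolding 1 .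
  qed
qed

lemma poly_root_dvd: "poly p x = 0 \<Longrightarrow> p dvd q \<Longrightarrow> poly q x = 0"
  by (auto elim!: dvdE)

text \<open>A partial automorphism is represented by its graph, a subring of \<open>'s \<times> 's\<close>, so that unions of
  chains need no gluing of functions.\<close>
definition partial_hom :: "('k::field \<Rightarrow> 's::field) \<Rightarrow> ('s \<times> 's) set \<Rightarrow> bool" where
  "partial_hom \<iota> G \<longleftrightarrow> (\<forall>a. (\<iota> a, \<iota> a) \<in> G) \<and>
     (\<forall>x x' y y'. (x, x') \<in> G \<longrightarrow> (y, y') \<in> G \<longrightarrow> (x + y, x' + y') \<in> G \<and> (x * y, x' * y') \<in> G) \<and>
     (\<forall>b. (0, b) \<in> G \<longrightarrow> b = 0)"

lemma separable_closure_embedding: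
  assumes "separable_closure \<iota>"
  shows "field_embedding \<iota>"
proof -
  have "\<iota> \<in> ring_hom ring_of_type_algebra ring_of_type_algebra"
    using assms unfolding separable_closure_def by blast
  then show ?thesis
    unfolding ring_hom_def ring_of_type_algebra_def by unfold_locales simp_all
qed

locale partial_hom_loc =
  fixes \<iota> :: "'k::field \<Rightarrow> 's::field" and G :: "('s \<times> 's) set"
  assumes closure: "separable_closure \<iota>" and partial: "partial_hom \<iota> G"
begin

sublocale field_embedding \<iota> by (rule separable_closure_embedding[OF closure])

lemma base: "(\<iota> a, \<iota> a) \<in> G" and plus: "(x, x') \<in> G \<Longrightarrow> (y, y') \<in> G \<Longrightarrow> (x + y, x' + y') \<in> G"
  and times: "(x, x') \<in> G \<Longrightarrow> (y, y') \<in> G \<Longrightarrow> (x * y, x' * y') \<in> G"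
  and null: "(0, b) \<in> G \<Longrightarrow> b = 0"
  using partial unfolding partial_hom_def by blast+

lemma zero_mem: "(0, 0) \<in> G" and one_mem: "(1, 1) \<in> G"
  using base[of 0] base[of 1] by simp_all

lemma uminus_mem: "(x, x') \<in> G \<Longrightarrow> (- x, - x') \<in> G"
  using times[of x x' "\<iota> (- 1)" "\<iota> (- 1)"] base[of "- 1"] by simp

lemma sum_mem: "(\<And>i. i \<in> A \<Longrightarrow> (f i, g i) \<in> G) \<Longrightarrow> (sum f A, sum g A) \<in> G"
  by (induction A rule: infinite_finite_induct) (simp_all add: zero_mem plus)

lemma functional: "(x, y) \<in> G \<Longrightarrow> (x, z) \<in> G \<Longrightarrow> y = z"
  using plus[of x y "- x" "- z"] uminus_mem[of x z] null[of "y - z"] by simp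

text \<open>A pair consisting of a polynomial over the domain and its image under the partial automorphism.\<close>
definition graph_poly :: "'s poly \<Rightarrow> 's poly \<Rightarrow> bool" where
  "graph_poly P Q \<longleftrightarrow> (\<forall>i. (coeff P i, coeff Q i) \<in> G)"

lemma graph_poly_coeff: "graph_poly P Q \<Longrightarrow> (coeff P i, coeff Q i) \<in> G"
  by (simp add: graph_poly_def)

lemma graph_poly_add: "graph_poly P Q \<Longrightarrow> graph_poly P' Q' \<Longrightarrow> graph_poly (P + P') (Q + Q')"
  by (simp add: graph_poly_def plus)

lemma graph_poly_uminus: "graph_poly P Q \<Longrightarrow> graph_poly (- P) (- Q)"
  by (simp add: graph_poly_def uminus_mem)

lemma graph_poly_diff: "graph_poly P Q \<Longrightarrow> graph_poly P' Q' \<Longrightarrow> graph_poly (P - P') (Q - Q')"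
  using graph_poly_add[OF _ graph_poly_uminus] by (metis diff_conv_add_uminus)

lemma graph_poly_mult: "graph_poly P Q \<Longrightarrow> graph_poly P' Q' \<Longrightarrow> graph_poly (P * P') (Q * Q')"
  by (simp add: graph_poly_def coeff_mult sum_mem times)

lemma graph_poly_smult: "(c, d) \<in> G \<Longrightarrow> graph_poly P Q \<Longrightarrow> graph_poly (smult c P) (smult d Q)"
  by (simp add: graph_poly_def times)

lemma graph_poly_monom: "(c, d) \<in> G \<Longrightarrow> graph_poly (monom c n) (monom d n)"
  by (simp add: graph_poly_def zero_mem)

lemma graph_poly_0: "graph_poly 0 0"
  by (simp add: graph_poly_def zero_mem)

lemma graph_poly_const: "(c, d) \<in> G \<Longrightarrow> graph_poly [:c:] [:d:]"
  using graph_poly_monom[of c d 0] by (simp add: monom_0)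

lemma graph_poly_map: "graph_poly (map_poly \<iota> p) (map_poly \<iota> p)"
  by (simp add: graph_poly_def coeff_map_poly base)

lemma graph_poly_zero: "graph_poly 0 Q \<Longrightarrow> Q = 0"
  by (simp add: graph_poly_def poly_eq_iff null)

lemma graph_poly_eval: "graph_poly P Q \<Longrightarrow> (y, y') \<in> G \<Longrightarrow> (poly P y, poly Q y') \<in> G"
proof (induction P arbitrary: Q)
  case 0
  then show ?case using graph_poly_zero[of Q] zero_mem by simp
next
  case (pCons a P)
  obtain b Q' where Q: "Q = pCons b Q'" by (cases Q)
  have "(a, b) \<in> G" using graph_poly_coeff[OF pCons.prems(1), of 0] by (simp add: Q)
  moreover have "graph_poly P Q'"
    unfolding graph_poly_def
  proof
    fix i show "(coeff P i, coeff Q' i) \<in> G"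
      using graph_poly_coeff[OF pCons.prems(1), of "Suc i"] by (simp add: Q)
  qed
  ultimately show ?case using pCons by (simp add: Q plus times)
qed

text \<open>The base field is in the graph, so \<open>b\<close> is a root of each polynomial over the base field that has
  the root \<open>a\<close>, and one of these has nonzero constant term.\<close>
lemma nonzero:
  assumes "(a, b) \<in> G" "a \<noteq> 0"
  shows "b \<noteq> 0"
proof -
  obtain p where p: "separable_poly p" "poly (map_poly \<iota> p) a = 0"
    using closure unfolding separable_closure_def by blast
  have "p \<noteq> 0 \<Longrightarrow> poly (map_poly \<iota> p) a = 0 \<Longrightarrow> b \<noteq> 0"
  proof (induction p)
    case (pCons c p)
    show ?case
    proof (cases "c = 0")
      case True
      then show ?thesis using pCons assms(2) by (auto simp: map_poly_pCons)
    next
      case False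
      have "(0, poly (map_poly \<iota> (pCons c p)) b) \<in> G"
        using graph_poly_eval[OF graph_poly_map assms(1), of "pCons c p"] pCons.prems by simp
      then have "poly (map_poly \<iota> (pCons c p)) b = 0" by (rule null)
      with False show ?thesis by (auto simp: map_poly_pCons)
    qed
  qed simp
  then show ?thesis using p separable_poly_nonzero by blast
qed

lemma graph_poly_degree:
  assumes "graph_poly P Q"
  shows "degree Q = degree P"
proof (rule antisym)
  show "degree Q \<le> degree P"
    by (intro degree_le allI impI null) (metis assms coeff_eq_0 graph_poly_coeff)
  show "degree P \<le> degree Q"
  proof (cases "P = 0")
    case False
    then show ?thesis using nonzero[OF graph_poly_coeff[OF assms, of "degree P"]]
      by (simp add: le_degree)
  qed simp
qed

text \<open>Division by a leading coefficient is avoided, as the domain of the graph is only treated as a ring.\<close>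
lemma pseudo_division:
  assumes M: "graph_poly M N" "degree M > 0" and "graph_poly P Q"
  shows "\<exists>c d W W' R R'. (c, d) \<in> G \<and> c \<noteq> 0 \<and> graph_poly W W' \<and> graph_poly R R' \<and>
     smult c P = M * W + R \<and> smult d Q = N * W' + R' \<and> degree R < degree M"
  using assms(3)
proof (induction "degree P" arbitrary: P Q rule: less_induct)
  case less
  show ?case
  proof (cases "degree P < degree M")
    case True
    have "(1, 1) \<in> G \<and> (1::'s) \<noteq> 0 \<and> graph_poly 0 0 \<and> graph_poly P Q \<and>
       smult 1 P = M * 0 + P \<and> smult 1 Q = N * 0 + Q \<and> degree P < degree M"
      using True less.prems one_mem graph_poly_0 by simp
    then show ?thesis by blast
  next
    case False
    define m n p q e where "m = coeff M (degree M)" and "n = coeff N (degree M)"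
      and "p = coeff P (degree P)" and "q = coeff Q (degree P)" and "e = degree P - degree M"
    have mn: "(m, n) \<in> G" "m \<noteq> 0" and pq: "(p, q) \<in> G"
      using graph_poly_coeff[OF M(1)] graph_poly_coeff[OF less.prems] M(2)
      by (auto simp: m_def n_def p_def q_def)
    define P1 Q1 where "P1 = smult m P - monom p e * M" and "Q1 = smult n Q - monom q e * N"
    have G1: "graph_poly P1 Q1" unfolding P1_def Q1_def
      by (intro graph_poly_diff graph_poly_smult graph_poly_mult graph_poly_monom mn pq M less.prems)
    have dP: "degree P > 0" using False M(2) by simp
    have e: "degree P = e + degree M" using False by (simp add: e_def)
    have "degree P1 \<le> degree P"
      unfolding P1_def
    proof (rule degree_diff_le)
      show "degree (smult m P) \<le> degree P" by simp
      have "degree (monom p e * M) \<le> degree (monom p e) + degree M" by (rule degree_mult_le)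
      also have "\<dots> \<le> degree P" using degree_monom_le[of p e] e by simp
      finally show "degree (monom p e * M) \<le> degree P" .
    qed
    moreover have "coeff P1 (degree P) = 0"
      unfolding P1_def by (simp add: coeff_monom_mult e m_def p_def)
    ultimately have deg: "degree P1 < degree P"
      using dP by (metis degree_0 le_neq_implies_less leading_coeff_0_iff)
    obtain c d W W' R R' where IH: "(c, d) \<in> G" "c \<noteq> 0" "graph_poly W W'" "graph_poly R R'"
       "smult c P1 = M * W + R" "smult d Q1 = N * W' + R'" "degree R < degree M"
      using less.hyps[OF deg G1] by blast
    have "smult (c * m) P = M * (W + smult c (monom p e)) + R"
      using IH(5) unfolding P1_def by (simp add: algebra_simps smult_diff_right)
    moreover have "smult (d * n) Q = N * (W' + smult d (monom q e)) + R'"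
      using IH(6) unfolding Q1_def by (simp add: algebra_simps smult_diff_right)
    moreover have "graph_poly (W + smult c (monom p e)) (W' + smult d (monom q e))"
      by (intro graph_poly_add graph_poly_smult graph_poly_monom IH pq)
    moreover have "(c * m, d * n) \<in> G" "c * m \<noteq> 0" using times IH mn by auto
    ultimately show ?thesis using IH(4,7) by blast
  qed
qed

text \<open>The polynomial \<open>N\<close> is the image of a minimal polynomial of \<open>y\<close> over the domain. It divides a
  separable polynomial over the base field, hence is separable and has roots.\<close>
lemma minimal_pair:
  obtains M N where "graph_poly M N" "poly M y = 0" "separable_poly N" "degree N > 0"
    "\<And>P Q. graph_poly P Q \<Longrightarrow> poly P y = 0 \<Longrightarrow> N dvd Q"
proof -
  obtain p where p: "separable_poly p" "poly (map_poly \<iota> p) y = 0"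
    using closure unfolding separable_closure_def by blast
  let ?A = "\<lambda>(M, N). graph_poly M N \<and> M \<noteq> 0 \<and> poly M y = 0"
  have "?A (map_poly \<iota> p, map_poly \<iota> p)"
    using p separable_poly_nonzero graph_poly_map by auto
  then obtain MN where MN: "?A MN" and min: "\<And>z. ?A z \<Longrightarrow> degree (fst MN) \<le> degree (fst z)"
    using ex_has_least_nat[of ?A _ "\<lambda>z. degree (fst z)"] by blast
  obtain M N where "MN = (M, N)" by (cases MN)
  with MN have M: "graph_poly M N" "M \<noteq> 0" "poly M y = 0" by auto
  have min: "degree M \<le> degree P" if "graph_poly P Q" "P \<noteq> 0" "poly P y = 0" for P Q
    using min[of "(P, Q)"] that \<open>MN = (M, N)\<close> by simp
  have dM: "degree M > 0"
  proof (rule ccontr)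
    assume "\<not> degree M > 0"
    then obtain c where "M = [:c:]" using degree_eq_zeroE by blast
    then show False using M(2,3) by simp
  qed
  have dvd: "N dvd Q" if PQ: "graph_poly P Q" "poly P y = 0" for P Q
  proof -
    obtain c d W W' R R' where D: "(c, d) \<in> G" "c \<noteq> 0" "graph_poly W W'" "graph_poly R R'"
       "smult c P = M * W + R" "smult d Q = N * W' + R'" "degree R < degree M"
      using pseudo_division[OF M(1) dM PQ(1)] by blast
    have "poly (smult c P) y = poly (M * W + R) y" using D(5) by simp
    then have "poly R y = 0" using PQ(2) M(3) by simp
    then have "R = 0" using min[OF D(4)] D(7) by fastforce
    then have "R' = 0" using D(4) graph_poly_zero by simp
    then have "N dvd smult d Q" using D(6) by simp
    then show ?thesis using nonzero[OF D(1,2)] by (simp add: dvd_smult_iff)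
  qed
  have "separable_poly N"
    using separable_poly_dvd[OF separable_map_poly[OF p(1)] dvd[OF graph_poly_map p(2)]] .
  then show thesis using that[OF M(1,3) _ _ dvd] dM graph_poly_degree[OF M(1)] by simp
qed

text \<open>Evaluating pairs of polynomials at \<open>(y, y')\<close> gives the subring generated by the graph and this pair;
  the hypothesis makes it the graph of a function.\<close>
lemma partial_hom_adjoin:
  assumes "\<And>P Q. graph_poly P Q \<Longrightarrow> poly P y = 0 \<Longrightarrow> poly Q y' = 0"
  shows "\<exists>G'. partial_hom \<iota> G' \<and> G \<subseteq> G' \<and> (y, y') \<in> G'"
proof -
  define G' where "G' = {(poly P y, poly Q y') | P Q. graph_poly P Q}"
  have sub: "(a, b) \<in> G'" if "(a, b) \<in> G" for a b
  proof -
    have "(poly [:a:] y, poly [:b:] y') \<in> G'" using graph_poly_const[OF that] unfolding G'_def by blast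
    then show ?thesis by simp
  qed
  have "partial_hom \<iota> G'"
    unfolding partial_hom_def
  proof (intro conjI allI impI)
    show "(\<iota> a, \<iota> a) \<in> G'" for a by (rule sub[OF base])
    fix x x' z z' assume "(x, x') \<in> G'" "(z, z') \<in> G'"
    then obtain P Q P' Q' where *: "graph_poly P Q" "graph_poly P' Q'"
      "x = poly P y" "x' = poly Q y'" "z = poly P' y" "z' = poly Q' y'"
      unfolding G'_def by blast
    show "(x + z, x' + z') \<in> G'"
      using graph_poly_add[OF *(1,2)] unfolding G'_def * by (metis (mono_tags, lifting) mem_Collect_eq poly_add)
    show "(x * z, x' * z') \<in> G'"
      using graph_poly_mult[OF *(1,2)] unfolding G'_def * by (metis (mono_tags, lifting) mem_Collect_eq poly_mult)
  next
    fix b assume "(0, b) \<in> G'"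
    then show "b = 0" using assms unfolding G'_def by force
  qed
  moreover have "(poly (monom 1 1) y, poly (monom 1 1) y') \<in> G'"
    using graph_poly_monom[OF one_mem, of 1] unfolding G'_def by blast
  then have "(y, y') \<in> G'" by (simp add: poly_monom)
  ultimately show ?thesis using sub by auto
qed

end

text \<open>A maximal graph is defined everywhere, since any root of \<open>N\<close> can be taken as the image of
  a further element. The resulting endomorphism is onto because it permutes the finitely many roots
  of each polynomial over the base field.\<close>
lemma automorphism_extending:
  assumes closure: "separable_closure \<iota>" and G0: "partial_hom \<iota> G0"
  obtains s where "s \<in> carrier (absolute_galois_group \<iota>)" "\<And>x y. (x, y) \<in> G0 \<Longrightarrow> s x = y"
proof -
  let ?A = "{G. partial_hom \<iota> G \<and> G0 \<subseteq> G}"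
  have "\<exists>G\<in>?A. \<forall>H\<in>?A. G \<subseteq> H \<longrightarrow> H = G"
  proof (rule subset_Zorn_nonempty)
    show "?A \<noteq> {}" using G0 by blast
  next
    fix C assume C: "C \<noteq> {}" "subset.chain ?A C"
    have mem: "partial_hom \<iota> H" "G0 \<subseteq> H" if "H \<in> C" for H
      using C(2) that unfolding subset.chain_def by auto
    have "partial_hom \<iota> (\<Union>C)"
      unfolding partial_hom_def
    proof (intro conjI allI impI)
      show "(\<iota> a, \<iota> a) \<in> \<Union>C" for a using C(1) mem(1) unfolding partial_hom_def by blast
      fix x x' y y' assume "(x, x') \<in> \<Union>C" "(y, y') \<in> \<Union>C"
      then obtain H where "H \<in> C" "(x, x') \<in> H" "(y, y') \<in> H"
        using C(2) unfolding subset_chain_def by blast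
      then show "(x + y, x' + y') \<in> \<Union>C" "(x * y, x' * y') \<in> \<Union>C"
        using mem(1)[of H] unfolding partial_hom_def by blast+
    next
      fix b assume "(0, b) \<in> \<Union>C"
      then show "b = 0" using mem(1) unfolding partial_hom_def by blast
    qed
    then show "\<Union>C \<in> ?A" using C(1) mem(2) by blast
  qed
  then obtain G where G: "partial_hom \<iota> G" "G0 \<subseteq> G"
    and max: "\<And>H. partial_hom \<iota> H \<Longrightarrow> G \<subseteq> H \<Longrightarrow> H = G" by (auto; blast)
  interpret partial_hom_loc \<iota> G using closure G(1) by unfold_locales
  have total: "\<exists>y'. (y, y') \<in> G" for y
  proof -
    obtain M N where MN: "graph_poly M N" "separable_poly N" "degree N > 0"
      "\<And>P Q. graph_poly P Q \<Longrightarrow> poly P y = 0 \<Longrightarrow> N dvd Q"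
      using minimal_pair[of y] by metis
    obtain y' where y': "poly N y' = 0"
      using closure MN(2,3) unfolding separable_closure_def by blast
    have "\<exists>G'. partial_hom \<iota> G' \<and> G \<subseteq> G' \<and> (y, y') \<in> G'"
      by (rule partial_hom_adjoin) (rule poly_root_dvd[OF y' MN(4)])
    then show ?thesis using max by blast
  qed
  define s where "s y = (THE y'. (y, y') \<in> G)" for y
  have graph: "(y, s y) \<in> G" for y
    unfolding s_def using total functional by (metis theI)
  have s_eq: "s x = y" if "(x, y) \<in> G" for x y using functional graph that by blast
  have hom: "s (x + y) = s x + s y" "s (x * y) = s x * s y" for x y
    using s_eq plus times graph by blast+
  have s_base: "s (\<iota> a) = \<iota> a" for a using s_eq base by blast
  interpret s: field_embedding s
    using hom s_base[of 1] by unfold_locales simp_all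
  have inj: "inj s" by (simp add: inj_def)
  have "surj s"
  proof -
    have "z \<in> range s" for z
    proof -
      obtain p where p: "separable_poly p" "poly (map_poly \<iota> p) z = 0"
        using closure unfolding separable_closure_def by blast
      let ?Z = "{x. poly (map_poly \<iota> p) x = 0}"
      have "finite ?Z" using p(1) separable_poly_nonzero by (intro poly_roots_finite) simp
      moreover have "s ` ?Z \<subseteq> ?Z"
      proof safe
        fix x assume "poly (map_poly \<iota> p) x = 0"
        then show "poly (map_poly \<iota> p) (s x) = 0"
          using graph_poly_eval[OF graph_poly_map graph, of p x] null by simp
      qed
      ultimately have "s ` ?Z = ?Z" using inj by (meson endo_inj_surj inj_on_subset subset_UNIV)
      then show ?thesis using p(2) by blast
    qed
    then show ?thesis by blast
  qed
  then have "s \<in> carrier (absolute_galois_group \<iota>)"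
    using inj hom s_base by (simp add: galois_group_def Bij_def bij_def)
  moreover have "s x = y" if "(x, y) \<in> G0" for x y using that G(2) s_eq by blast
  ultimately show thesis by (rule that)
qed

text \<open>If \<open>x\<close> is not in the base field, its minimal polynomial has a second root, as it is separable of
  degree at least two, and some automorphism moves \<open>x\<close> to this root.\<close>
lemma fixed_by_galois_group:
  assumes closure: "separable_closure \<iota>"
    and fixed: "\<And>s. s \<in> carrier (absolute_galois_group \<iota>) \<Longrightarrow> s x = x"
  shows "x \<in> range \<iota>"
proof -
  define D where "D = {(\<iota> a, \<iota> a) | a. True}"
  interpret i: field_embedding \<iota> by (rule separable_closure_embedding[OF closure])
  have "partial_hom \<iota> D"
    unfolding partial_hom_def D_def
  proof (intro conjI allI impI)
    fix x x' y y' assume "(x, x') \<in> {(\<iota> a, \<iota> a) | a. True}" "(y, y') \<in> {(\<iota> a, \<iota> a) | a. True}"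
    then obtain a b where *: "x = \<iota> a" "x' = \<iota> a" "y = \<iota> b" "y' = \<iota> b" by blast
    have "(\<iota> (a + b), \<iota> (a + b)) \<in> {(\<iota> a, \<iota> a) | a. True}" "(\<iota> (a * b), \<iota> (a * b)) \<in> {(\<iota> a, \<iota> a) | a. True}" by blast+
    then show "(x + y, x' + y') \<in> {(\<iota> a, \<iota> a) | a. True}" "(x * y, x' * y') \<in> {(\<iota> a, \<iota> a) | a. True}"
      unfolding * by (simp_all only: i.add i.mult)
  qed auto
  then interpret partial_hom_loc \<iota> D using closure by unfold_locales
  obtain M N where MN: "graph_poly M N" "poly M x = 0" "separable_poly N" "degree N > 0"
      "\<And>P Q. graph_poly P Q \<Longrightarrow> poly P x = 0 \<Longrightarrow> N dvd Q"
    using minimal_pair[of x] by metis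
  have diag: "P = Q" if "graph_poly P Q" for P Q
  proof (rule poly_eqI)
    show "coeff P i = coeff Q i" for i
      using graph_poly_coeff[OF that, of i] unfolding D_def by auto
  qed
  have "poly N x = 0" using MN(1,2) diag by blast
  then obtain N' where N': "N = [:- x, 1:] * N'" by (auto simp: poly_eq_0_iff_dvd elim!: dvdE)
  have "N' \<noteq> 0" using N' MN(4) by auto
  show ?thesis
  proof (cases "degree N' = 0")
    case True
    then obtain c where "N' = [:c:]" using degree_eq_zeroE by blast
    then have N: "N = [:- x * c, c:]" and "c \<noteq> 0" using N' \<open>N' \<noteq> 0\<close> by auto
    have "(coeff M 0, - x * c) \<in> D" "(coeff M 1, c) \<in> D"
      using graph_poly_coeff[OF MN(1), of 0] graph_poly_coeff[OF MN(1), of 1] unfolding N by simp_all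
    then obtain a b where "- x * c = \<iota> a" "c = \<iota> b" unfolding D_def by blast
    then have "x * \<iota> b = - \<iota> a" by (metis minus_minus mult_minus_left)
    moreover have "\<iota> b \<noteq> 0" using \<open>c \<noteq> 0\<close> \<open>c = \<iota> b\<close> by metis
    ultimately have "x = - \<iota> a / \<iota> b" using nonzero_eq_divide_eq[of "\<iota> b" x "- \<iota> a"] by blast
    then have "x = \<iota> (- a / b)" by simp
    then show ?thesis by blast
  next
    case False
    have "N' dvd N" unfolding N' by (rule dvd_triv_right)
    then have "separable_poly N'" by (rule separable_poly_dvd[OF MN(3)])
    then obtain x' where x': "poly N' x' = 0"
      using closure False unfolding separable_closure_def by blast
    have "x' \<noteq> x" using separable_poly_simple_root[OF MN(3) N'] x' by blast
    have "\<exists>G'. partial_hom \<iota> G' \<and> D \<subseteq> G' \<and> (x, x') \<in> G'"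
    proof (rule partial_hom_adjoin)
      have "poly N x' = 0" unfolding N' poly_mult using x' by simp
      then show "poly Q x' = 0" if "graph_poly P Q" "poly P x = 0" for P Q
        using poly_root_dvd MN(5)[OF that] by blast
    qed
    then obtain G' where G': "partial_hom \<iota> G'" "(x, x') \<in> G'" by blast
    obtain s where "s \<in> carrier (absolute_galois_group \<iota>)" "s x = x'"
      using automorphism_extending[OF closure G'(1)] G'(2) by metis
    then show ?thesis using fixed \<open>x' \<noteq> x\<close> by blast
  qed
qed

section \<open>Tate normal form of a point of order seven\<close>

lemma change_exists:
  assumes "fst \<tau> \<noteq> (0::'a::field)"
  shows "\<exists>E'. iso_via \<tau> E E'"
proof -
  obtain a1 a2 a3 a4 a6 u r s t where E: "E = Weierstrass a1 a2 a3 a4 a6" and \<tau>: "\<tau> = (u, r, s, t)"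
    by (cases E; cases \<tau>) metis
  have "iso_via \<tau> E (Weierstrass ((a1 + 2 * s) / u) ((a2 - s * a1 + 3 * r - s^2) / u^2)
      ((a3 + r * a1 + 2 * t) / u^3)
      ((a4 - s * a3 + 2 * r * a2 - (t + r * s) * a1 + 3 * r^2 - 2 * s * t) / u^4)
      ((a6 + r * a4 + r^2 * a2 + r^3 - t * a3 - t^2 - r * t * a1) / u^6))"
    using assms by (simp add: E \<tau>)
  then show ?thesis by blast
qed

text \<open>The closure conditions are included because \<open>add_points_move\<close>, which transports the other conditions along
  substitutions, applies to points on the curve.\<close>
definition seven_point :: "'a::field weierstrass \<Rightarrow> 'a point \<Rightarrow> bool" where
  "seven_point E P \<longleftrightarrow>
     (let P2 = add_points E P P; P3 = add_points E P2 P in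
      on_curve E P \<and> on_curve E P2 \<and> on_curve E P3 \<and>
      P \<noteq> neg_point E P \<and> P2 \<noteq> neg_point E P \<and> P3 \<noteq> neg_point E P \<and>
      add_points E P3 P = neg_point E P3)"

lemma seven_point_move:
  assumes "iso_via \<tau> E E'" "seven_point E (move \<tau> P)"
  shows "seven_point E' P"
proof -
  note nz = iso_via_nonzero[OF assms(1)]
  note on = on_curve_move[OF assms(1)]
  note add = add_points_move[OF assms(1)]
  note 0 = assms(2)[unfolded seven_point_def Let_def]
  have 1: "on_curve E' P" using 0 on by blast
  have 2: "on_curve E' (add_points E' P P)" using 0 on add[OF 1 1] by metis
  have 3: "on_curve E' (add_points E' (add_points E' P P) P)"
    using 0 on add[OF 1 1] add[OF 2 1] by metis
  show ?thesis
    using 0 1 2 3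
    unfolding seven_point_def Let_def add[OF 1 1] add[OF 2 1] add[OF 3 1] neg_point_move[OF assms(1)]
      move_inject[OF nz] by blast
qed

text \<open>Here \<open>2 P = (b, b c)\<close> and \<open>3 P = (c, b - c)\<close>. With \<open>d = b / c\<close> the abscissa of \<open>4 P\<close> is
  \<open>d\<^sup>2 - d\<close>, so that \<open>4 P = - 3 P\<close> forces \<open>c = d\<^sup>2 - d\<close> and \<open>b = d\<^sup>3 - d\<^sup>2\<close>.\<close>
lemma seven_point_Tate:
  fixes a1 :: "'a::field"
  assumes P: "seven_point (Weierstrass a1 (- b) (- b) 0 0) (Affine 0 0)" and b: "b \<noteq> 0"
  shows "\<exists>w. Weierstrass a1 (- b) (- b) 0 0 = untwisted_curve w"
proof -
  let ?E = "Weierstrass a1 (- b) (- b) 0 0" and ?O = "Affine 0 0 :: 'a point"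
  define c where "c = 1 - a1"
  have a1: "a1 = 1 - c" by (simp add: c_def)
  have 2: "add_points ?E ?O ?O = Affine b (b * c)"
    using b by (simp add: Let_def c_def algebra_simps)
  have 3: "add_points ?E (Affine b (b * c)) ?O = Affine c (b - c)"
    using b by (simp add: Let_def a1 algebra_simps power2_eq_square)
  have c: "c \<noteq> 0"
    using P unfolding seven_point_def Let_def 2 3 by auto
  have 4: "add_points ?E (Affine c (b - c)) ?O = neg_point ?E (Affine c (b - c))"
    using P unfolding seven_point_def Let_def 2 3 by blast
  define d where "d = b / c"
  have bcd: "b = c * d" using c by (simp add: d_def)
  have "(0 - (b - c)) / (0 - c) = d - 1" using c by (simp add: bcd field_simps)
  then have "(d - 1)^2 + a1 * (d - 1) - - b - c - 0 = c"
    using 4 c by (simp add: Let_def)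
  moreover have "(d - 1)^2 + a1 * (d - 1) - - b - c - 0 = d^2 - d"
    unfolding a1 bcd by Groebner_Basis.algebra
  ultimately have cd: "c = d^2 - d" by (rule trans[OF sym])
  have "- b = - (d^3) + d^2" unfolding bcd cd by Groebner_Basis.algebra
  moreover have "a1 = - (d^2) + d + 1" unfolding a1 cd by simp
  ultimately have "?E = untwisted_curve d" by (simp add: untwisted_curve_def)
  then show ?thesis by blast
qed

text \<open>Move the point to the origin, make its tangent horizontal, which is possible as \<open>2 P \<noteq> 0\<close>, and
  scale so that \<open>a\<^sub>2 = a\<^sub>3\<close>, which is possible as \<open>3 P \<noteq> 0\<close>.\<close>
lemma tate_normal_form:
  fixes E :: "'a::field weierstrass"
  assumes "seven_point E P"
  obtains \<tau> w where "iso_via \<tau> E (untwisted_curve w)" "move \<tau> (Affine 0 0) = P"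
proof -
  have "P \<noteq> Infinity" using assms by (auto simp: seven_point_def Let_def)
  then obtain x0 y0 where P: "P = Affine x0 y0" by (cases P) auto
  let ?O = "Affine 0 0"
  define \<tau>1 where "\<tau>1 = (1 :: 'a, x0, 0 :: 'a, y0)"
  obtain E1 where iso1: "iso_via \<tau>1 E E1" using change_exists[of \<tau>1 E] by (auto simp: \<tau>1_def)
  have P1: "move \<tau>1 ?O = P" by (simp add: \<tau>1_def P)
  have s1: "seven_point E1 ?O" using seven_point_move[OF iso1] assms P1 by simp
  obtain a1 a2 a3 a4 a6 where E1: "E1 = Weierstrass a1 a2 a3 a4 a6" by (cases E1)
  have a6: "a6 = 0" and a3: "a3 \<noteq> 0" using s1 by (auto simp: seven_point_def E1 Let_def)
  define \<tau>2 where "\<tau>2 = (1 :: 'a, 0 :: 'a, a4 / a3, 0 :: 'a)"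
  obtain E2 where iso2: "iso_via \<tau>2 E1 E2" using change_exists[of \<tau>2 E1] by (auto simp: \<tau>2_def)
  have P2: "move \<tau>2 ?O = ?O" by (simp add: \<tau>2_def)
  have s2: "seven_point E2 ?O" using seven_point_move[OF iso2] s1 P2 by simp
  obtain b1 b2 b3 b4 b6 where E2: "E2 = Weierstrass b1 b2 b3 b4 b6" by (cases E2)
  have b: "b3 = a3" "b4 = 0" "b6 = 0" using iso2 a3 a6 by (simp_all add: E1 E2 \<tau>2_def)
  have b2: "b2 \<noteq> 0"
    using s2 a3 by (auto simp: seven_point_def E2 Let_def b)
  define \<tau>3 where "\<tau>3 = (b3 / b2, 0 :: 'a, 0 :: 'a, 0 :: 'a)"
  have u: "b3 / b2 \<noteq> 0" using b2 a3 b by simp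
  obtain E3 where iso3: "iso_via \<tau>3 E2 E3" using change_exists[of \<tau>3 E2] u by (auto simp: \<tau>3_def)
  have P3: "move \<tau>3 ?O = ?O" by (simp add: \<tau>3_def)
  have s3: "seven_point E3 ?O" using seven_point_move[OF iso3] s2 P3 by simp
  obtain c1 c2 c3 c4 c6 where E3: "E3 = Weierstrass c1 c2 c3 c4 c6" by (cases E3)
  have c: "c4 = 0" "c6 = 0" "(b3 / b2)^2 * c2 = b2" "(b3 / b2)^3 * c3 = b3"
    using iso3 b b2 a3 by (auto simp: E2 E3 \<tau>3_def)
  have "(b3 / b2)^3 * c3 = (b3 / b2)^3 * c2"
  proof -
    have "(b3 / b2)^3 * c2 = b3 / b2 * ((b3 / b2)^2 * c2)"
      by (simp only: power3_eq_cube power2_eq_square mult.assoc)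
    also have "\<dots> = b3" unfolding c(3) using b2 by simp
    finally show ?thesis using c(4) by simp
  qed
  then have c23: "c2 = c3" and c3: "c3 \<noteq> 0" using u c(4) a3 b by auto
  obtain w where w: "E3 = untwisted_curve w"
    using seven_point_Tate[of c1 "- c3"] s3 c3 by (auto simp: E3 c c23)
  have "iso_via (comp_change \<tau>1 (comp_change \<tau>2 \<tau>3)) E (untwisted_curve w)"
    using iso_via_comp[OF iso1 iso_via_comp[OF iso2 iso3]] w by simp
  moreover have "move (comp_change \<tau>1 (comp_change \<tau>2 \<tau>3)) ?O = P"
    by (simp add: move_comp_change P1 P2 P3)
  ultimately show thesis by (rule that)
qed

lemma curve_group_simps [simp]:
  "carrier (curve_group E) = Collect (on_curve E)"
  "x \<otimes>\<^bsub>curve_group E\<^esub> y = add_points E x y" "\<one>\<^bsub>curve_group E\<^esub> = Infinity"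
  by (simp_all add: curve_group_def)

lemma inv_curve_group:
  assumes "on_curve E P"
  shows "inv\<^bsub>curve_group E\<^esub> P = neg_point E P"
  unfolding m_inv_def
proof (rule the_equality)
  show "neg_point E P \<in> carrier (curve_group E) \<and>
    P \<otimes>\<^bsub>curve_group E\<^esub> neg_point E P = \<one>\<^bsub>curve_group E\<^esub> \<and>
    neg_point E P \<otimes>\<^bsub>curve_group E\<^esub> P = \<one>\<^bsub>curve_group E\<^esub>"
    using assms on_curve_neg_point[OF assms]
      add_points_eq_Infinity_iff[OF assms on_curve_neg_point[OF assms]]
      add_points_eq_Infinity_iff[OF on_curve_neg_point[OF assms] assms]
    by simp
next
  fix Q
  assume "Q \<in> carrier (curve_group E) \<and> P \<otimes>\<^bsub>curve_group E\<^esub> Q = \<one>\<^bsub>curve_group E\<^esub> \<and>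
    Q \<otimes>\<^bsub>curve_group E\<^esub> P = \<one>\<^bsub>curve_group E\<^esub>"
  then show "Q = neg_point E P" using assms add_points_eq_Infinity_iff by auto
qed

lemma subgroup_ip_loop:
  assumes E: "smooth E" and sub: "subgroup \<Psi> (curve_group E)" and "card \<Psi> = 7"
  shows "commutative_ip_loop \<Psi> (add_points E) (neg_point E) Infinity"
proof -
  have on: "on_curve E P" if "P \<in> \<Psi>" for P
    using subgroup.subset[OF sub] that by auto
  show ?thesis
  proof
    show "card \<Psi> = 7" "Infinity \<in> \<Psi>"
      using assms(3) subgroup.one_closed[OF sub] by simp_all
    fix x y z assume x: "x \<in> \<Psi>"
    show neg: "neg_point E x \<in> \<Psi>"
      using subgroup.m_inv_closed[OF sub x] inv_curve_group[OF on[OF x]] by simp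
    show "add_points E x Infinity = x" "neg_point E (neg_point E x) = x" by simp_all
    assume y: "y \<in> \<Psi>"
    show "add_points E x y \<in> \<Psi>" using subgroup.m_closed[OF sub x y] by simp
    show "add_points E x y = add_points E y x" using add_points_commute on x y by blast
    show "add_points E x y = Infinity \<longleftrightarrow> y = neg_point E x"
      using add_points_eq_Infinity_iff on x y by blast
    assume z: "z \<in> \<Psi>" and "add_points E x y = z"
    then have "add_points E x y = neg_point E (neg_point E z)" by simp
    then have "add_points E x (neg_point E z) = neg_point E y"
      using add_points_swap[OF E on[OF x] on[OF y] on_curve_neg_point[OF on[OF z]]] by blast
    then show "add_points E (neg_point E x) z = y"
      using add_points_neg_points[OF E on[OF x] on_curve_neg_point[OF on[OF z]] on[OF y]] by simp
  qed
qed

lemma subgroup_seven_point: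
  assumes "smooth E" "subgroup \<Psi> (curve_group E)" "card \<Psi> = 7" "P \<in> \<Psi>" "P \<noteq> Infinity"
  shows "seven_point E P"
proof -
  interpret commutative_ip_loop \<Psi> "add_points E" "neg_point E" Infinity
    by (rule subgroup_ip_loop[OF assms(1-3)])
  have on: "on_curve E Q" if "Q \<in> \<Psi>" for Q
    using subgroup.subset[OF assms(2)] that by auto
  have "P \<noteq> neg_point E P" using no_2_torsion[OF assms(4)] assms(5) by metis
  then show ?thesis
    unfolding seven_point_def Let_def
    using on assms(4) add_in double_not_neg[OF assms(4,5)] threefold_not_neg[OF assms(4,5)]
      fourfold[OF assms(4,5)] by blast
qed

definition seven_points :: "'a::field coord_change \<Rightarrow> 'a \<Rightarrow> nat \<Rightarrow> 'a point" where
  "seven_points \<tau> w n = move \<tau> (tate_point w n)"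

lemma seven_points_mod [simp]: "seven_points \<tau> w (n mod 7) = seven_points \<tau> w n"
  by (simp add: seven_points_def)

lemma seven_points_0: "seven_points \<tau> w 0 = Infinity"
  and seven_points_1: "seven_points \<tau> w (Suc 0) = move \<tau> (Affine 0 0)"
  using tate_points(1,2)[of w] by (simp_all add: seven_points_def)

locale tate_isomorphism =
  fixes E :: "'a::field weierstrass" and \<tau> :: "'a coord_change" and w :: 'a
  assumes smooth_E: "smooth E" and iso: "iso_via \<tau> E (untwisted_curve w)"
begin

abbreviation "Q \<equiv> seven_points \<tau> w"

lemma smooth_untwisted: "smooth (untwisted_curve w)"
  using smooth_iso_via[OF iso smooth_E] .

lemma on_curve_Q: "on_curve E (Q n)"
  using on_curve_move[OF iso] on_curve_tate_point by (simp add: seven_points_def)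

lemma add_Q: "add_points E (Q i) (Q j) = Q (i + j)"
  using add_points_move[OF iso on_curve_tate_point on_curve_tate_point]
  by (simp add: seven_points_def add_tate_points[OF smooth_untwisted])

lemma inj_Q: "inj_on Q {..<7}"
  using inj_on_tate_point[OF smooth_untwisted] move_inject[OF iso_via_nonzero[OF iso]]
  by (simp add: inj_on_def seven_points_def)

lemma Q_in: "Q n \<in> Q ` {..<7}"
proof -
  have "Q (n mod 7) \<in> Q ` {..<7}" by (rule imageI) simp
  then show ?thesis by simp
qed

lemma subgroup_Q: "subgroup (Q ` {..<7}) (curve_group E)"
proof
  show "Q ` {..<7} \<subseteq> carrier (curve_group E)" using on_curve_Q by auto
  show "\<one>\<^bsub>curve_group E\<^esub> \<in> Q ` {..<7}" using Q_in[of 0] by (simp add: seven_points_0)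
  fix x y assume "x \<in> Q ` {..<7}" "y \<in> Q ` {..<7}"
  then show "x \<otimes>\<^bsub>curve_group E\<^esub> y \<in> Q ` {..<7}" using Q_in by (auto simp: add_Q)
next
  fix x assume "x \<in> Q ` {..<7}"
  then obtain n where n: "x = Q n" "n < 7" by auto
  have "Q (n + (7 - n)) = Q ((n + (7 - n)) mod 7)" by simp
  also have "(n + (7 - n)) mod 7 = 0" using n by simp
  finally have "Q (7 - n) = neg_point E x"
    using add_points_eq_Infinity_iff[OF on_curve_Q on_curve_Q] add_Q[of n "7 - n"]
    by (simp add: n seven_points_0)
  then show "inv\<^bsub>curve_group E\<^esub> x \<in> Q ` {..<7}"
    using inv_curve_group on_curve_Q Q_in n by metis
qed

lemma card_Q: "card (Q ` {..<7}) = 7"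
  using inj_Q by (simp add: card_image)

lemma pow_Q: "Q i [^]\<^bsub>curve_group E\<^esub> (n::nat) = Q (n * i)"
proof (induction n)
  case 0
  then show ?case by (simp add: seven_points_0 nat_pow_def)
next
  case (Suc n)
  have "Q i [^]\<^bsub>curve_group E\<^esub> Suc n = add_points E (Q i [^]\<^bsub>curve_group E\<^esub> n) (Q i)"
    by (simp add: nat_pow_def)
  then show ?case by (simp add: Suc add_Q add.commute)
qed

end

section \<open>The twisted family over the splitting field\<close>

text \<open>The coefficients \<open>u, r, s, t\<close> of a substitution from the twisted curve to an untwisted one. They
  depend on a root \<open>g\<close> of the adapted cubic. Both \<open>u\<close> and \<open>s\<close> are the slope; \<open>r\<close> and \<open>t\<close> are
  the coordinates of a point of order seven.\<close>
definition twist_slope :: "'a::field \<Rightarrow> 'a \<Rightarrow> 'a" where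
  "twist_slope v g = - (((g^2 - g + 1) / (g^2 - g))^2 * (g * v - v + 1)^2)"

definition twist_x :: "'a::field \<Rightarrow> 'a \<Rightarrow> 'a \<Rightarrow> 'a" where
  "twist_x t v g = (t^2 + 3 * t + 9) * (v^3 - (t + 3) * v^2 + t * v + 1)
     * (- g * (g + v * (g^2 - 3 * g + 1)) / (g^2 - g))"

text \<open>The multiples \<open>P, 2 P, 4 P\<close> of this point have sum zero, and they are permuted by the substitution
  \<open>g \<mapsto> 1 / (1 - g)\<close>. So they lie on a line defined over the base field: its slope is \<open>- a\<^sub>1\<close> and
  its intercept is \<open>c f(v)\<close> times this polynomial.\<close>
definition twist_intercept :: "'a::field \<Rightarrow> 'a \<Rightarrow> 'a" where
  "twist_intercept t v = (14 - t^3) * v + (t^3 + 3 * t^2 + 9 * t) * v^2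
     - (t^3 + 2 * t^2 + 6 * t + 4) * v^3 - (t^2 + t + 5)"

definition twist_y :: "'a::field \<Rightarrow> 'a \<Rightarrow> 'a \<Rightarrow> 'a" where
  "twist_y t v g = (t^2 + 3 * t + 9) * (v^3 - (t + 3) * v^2 + t * v + 1) * twist_intercept t v
     - (t^2 + 3 * t + 9) * (v^2 - v + 1) * twist_x t v g"

definition twist_change :: "'a::field \<Rightarrow> 'a \<Rightarrow> 'a \<Rightarrow> 'a coord_change" where
  "twist_change t v g = (twist_slope v g, twist_x t v g, twist_slope v g, twist_y t v g)"

text \<open>A Moebius transformation carrying the roots \<open>g, 1 - 1 / g, 1 / (1 - g)\<close> of the cubic to the cusps
  \<open>0, 1, \<infinity>\<close>. It is an involution in \<open>v\<close>.\<close>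
definition twist_param :: "'a::field \<Rightarrow> 'a \<Rightarrow> 'a" where
  "twist_param v g = (g - v) / (g * v - v + 1)"

text \<open>The root satisfies \<open>t (g\<^sup>2 - g) = g\<^sup>3 - 3 g\<^sup>2 + 1\<close>. Multiplying by powers of \<open>p = g\<^sup>2 - g\<close> therefore
  turns each identity below into one between polynomials in \<open>v\<close> and \<open>g\<close>.\<close>
locale twist_root =
  fixes t v g :: "'a::field"
  assumes g: "g \<noteq> 0" "g \<noteq> 1" and root: "g^3 - (t + 3) * g^2 + t * g + 1 = 0"
begin

text \<open>In these terms \<open>w = e / D\<close> and \<open>u = - \<rho>\<^sup>2 D\<^sup>2\<close>, while \<open>c\<close>, \<open>f\<close> and \<open>m\<close> are factors of the
  coefficients of the twisted curve and \<open>c f R\<close> is the abscissa of the marked point.\<close>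
definition "p = g^2 - g"
definition "q = g^2 - g + 1"
definition "D = g * v - v + 1"
definition "e = g - v"
definition "\<rho> = q / p"
definition "c = t^2 + 3 * t + 9"
definition "f = v^3 - (t + 3) * v^2 + t * v + 1"
definition "m = v^2 - v + 1"
definition "R = - g * (g + v * (g^2 - 3 * g + 1)) / p"

lemma p_nz: "p \<noteq> 0"
proof -
  have "p = g * (g - 1)" unfolding p_def by Groebner_Basis.algebra
  then show ?thesis using g by simp
qed

lemma tp: "t * p = g^3 - 3 * g^2 + 1"
proof -
  have "t * p - (g^3 - 3 * g^2 + 1) = - (g^3 - (t + 3) * g^2 + t * g + 1)"
    unfolding p_def by Groebner_Basis.algebra
  then show ?thesis using root by simp
qed

lemma \<rho>p: "\<rho> * p = q" and Rp: "R * p = - g * (g + v * (g^2 - 3 * g + 1))"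
  using p_nz by (simp_all add: \<rho>_def R_def)

lemma c_eq: "c = \<rho>^2 * q"
proof -
  have "p^2 * c = (t * p)^2 + 3 * (t * p) * p + 9 * p^2" unfolding c_def by Groebner_Basis.algebra
  also have "\<dots> = q^3" unfolding tp unfolding p_def q_def by Groebner_Basis.algebra
  also have "\<dots> = (\<rho> * p)^2 * q" unfolding \<rho>p by Groebner_Basis.algebra
  also have "\<dots> = p^2 * (\<rho>^2 * q)" by Groebner_Basis.algebra
  finally show ?thesis using p_nz by simp
qed

lemma c_eq': "c = \<rho>^3 * p"
  unfolding c_eq \<rho>p[symmetric] by Groebner_Basis.algebra

lemma fp: "f * p = - e * D * (D - e)"
proof -
  have "f * p = v^3 * p - (t * p + 3 * p) * v^2 + (t * p) * v + p"
    unfolding f_def by Groebner_Basis.algebra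
  also have "\<dots> = - e * D * (D - e)"
    unfolding tp unfolding p_def e_def D_def by Groebner_Basis.algebra
  finally show ?thesis .
qed

lemma qm: "q * m = D^2 - e * D + e^2"
  unfolding q_def m_def D_def e_def by Groebner_Basis.algebra

lemma slope_eq: "twist_slope v g = - (\<rho>^2 * D^2)"
  by (simp add: twist_slope_def \<rho>_def p_def q_def D_def)

lemma x_eq: "twist_x t v g = c * f * R"
  by (simp add: twist_x_def c_def f_def R_def p_def)

lemma y_eq: "twist_y t v g = c * f * twist_intercept t v - c * m * (c * f * R)"
  by (simp only: twist_y_def x_eq) (simp only: c_def f_def m_def)

lemma param_eq: "twist_param v g = e / D"
  by (simp add: twist_param_def e_def D_def)

lemma R_linear: "- \<rho> * e = t * (2 * v - 1) + \<rho> * D + 3 * R"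
proof -
  have "p * (- \<rho> * e - (t * (2 * v - 1) + \<rho> * D + 3 * R))
      = - (\<rho> * p) * e - (t * p * (2 * v - 1) + (\<rho> * p) * D + 3 * (R * p))"
    by Groebner_Basis.algebra
  also have "\<dots> = 0" unfolding \<rho>p tp Rp unfolding q_def e_def D_def by Groebner_Basis.algebra
  finally show ?thesis using p_nz by simp
qed

lemma a3_relation:
  "\<rho>^3 * D^2 * e = ((t^3 - 1) * v^3 + (t^3 - 1) * v + t^2 - t + 1) + 2 * twist_intercept t v - c * m * R"
    (is "?L = ?A + 2 * twist_intercept t v - c * m * R")
proof -
  have "p^3 * (?L - (?A + 2 * twist_intercept t v - c * m * R))
     = (\<rho> * p)^3 * D^2 * e - (((t * p)^3 - p^3) * v^3 + ((t * p)^3 - p^3) * v + (t * p)^2 * p - (t * p) * p^2 + p^3)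
       - 2 * ((14 * p^3 - (t * p)^3) * v + ((t * p)^3 + 3 * (t * p)^2 * p + 9 * (t * p) * p^2) * v^2
     - ((t * p)^3 + 2 * (t * p)^2 * p + 6 * (t * p) * p^2 + 4 * p^3) * v^3 - ((t * p)^2 * p + (t * p) * p^2 + 5 * p^3))
      + ((t * p)^2 + 3 * (t * p) * p + 9 * p^2) * m * (R * p)"
    unfolding twist_intercept_def c_def by Groebner_Basis.algebra
  also have "\<dots> = 0"
    unfolding \<rho>p tp Rp unfolding q_def e_def D_def m_def p_def by Groebner_Basis.algebra
  finally show ?thesis using p_nz by simp
qed

text \<open>The derivative at \<open>R\<close> of the cubic in the next lemma, as the product of the differences
  \<open>\<rho> D\<close> and \<open>\<rho> e\<close> of \<open>R\<close> and its conjugates.\<close>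
lemma R_quadratic:
  "3 * R^2 + 2 * t * (2 * v - 1) * R + (- (t + 3) + (3 + t - t^2) * v + (t^2 - t - 3) * v^2)
    = \<rho>^2 * D * e" (is "?L = ?R")
proof -
  have "p^2 * (?L - ?R) = 3 * (R * p)^2 + 2 * (t * p) * (2 * v - 1) * (R * p)
      + (- (t * p + 3 * p) * p + (3 * p^2 + (t * p) * p - (t * p)^2) * v
        + ((t * p)^2 - (t * p) * p - 3 * p^2) * v^2)
      - (\<rho> * p)^2 * D * e"
    by Groebner_Basis.algebra
  also have "\<dots> = 0"
    unfolding \<rho>p tp Rp unfolding q_def e_def D_def p_def by Groebner_Basis.algebra
  finally show ?thesis using p_nz by simp
qed

text \<open>The three conjugates of \<open>R\<close>, multiplied by \<open>c f\<close>, are the abscissae of \<open>P, 2 P, 4 P\<close>. The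
  coefficients are polynomials in \<open>t\<close> and \<open>v\<close> since the line through these points is rational.\<close>
lemma R_cubic:
  "R^3 + t * (2 * v - 1) * R^2 + (- (t + 3) + (3 + t - t^2) * v + (t^2 - t - 3) * v^2) * R
    - (1 - 6 * v + (3 - 3 * t - t^2) * v^2 + (1 + 3 * t + t^2) * v^3) = 0" (is "?L = 0")
proof -
  have "p^3 * ?L = (R * p)^3 + (t * p) * (2 * v - 1) * (R * p)^2
      + (- (t * p + 3 * p) * p + (3 * p^2 + (t * p) * p - (t * p)^2) * v
        + ((t * p)^2 - (t * p) * p - 3 * p^2) * v^2) * (R * p)
      - (p^2 - 6 * p^2 * v + (3 * p^2 - 3 * (t * p) * p - (t * p)^2) * v^2
        + (p^2 + 3 * (t * p) * p + (t * p)^2) * v^3) * p"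
    by Groebner_Basis.algebra
  also have "\<dots> = 0" unfolding tp Rp unfolding p_def by Groebner_Basis.algebra
  finally show ?thesis using p_nz by simp
qed

end

locale twist = twist_root +
  assumes D_nz: "g * v - v + 1 \<noteq> 0" and q_nz: "g^2 - g + 1 \<noteq> 0"
begin

lemma slope_nz: "twist_slope v g \<noteq> 0"
  using p_nz D_nz q_nz unfolding slope_eq by (simp add: \<rho>_def q_def D_def)

lemma D_param: "D * twist_param v g = e"
  using D_nz by (simp add: param_eq D_def)

text \<open>On the rational line through \<open>P, 2 P, 4 P\<close> the equation of the curve becomes the cubic with the
  conjugates of \<open>R\<close> as roots. This accounts for \<open>a\<^sub>6 = 0\<close>, and its derivative for \<open>a\<^sub>4 = 0\<close>;
  the other coefficients come from the linear relations for \<open>R\<close>.\<close>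
lemma twist_iso: "iso_via (twist_change t v g) (twisted_curve t v) (untwisted_curve (twist_param v g))"
proof -
  let ?u = "- (\<rho>^2 * D^2)" and ?S = "twist_intercept t v" and ?w = "twist_param v g"
  define A2 A3 X4 X6 where "A2 = t * (2 * v - 1)"
    and "A3 = (t^3 - 1) * v^3 + (t^3 - 1) * v + t^2 - t + 1"
    and "X4 = (- 3 * t^2 - 5 * t - 2) * v^5 + (2 * t^3 + 8 * t^2 + 8 * t - 7) * v^4
          - (3 * t^3 + 6 * t^2 + 5 * t - 20) * v^3 + (2 * t^3 - t - 23) * v^2
          + 2 * (t^2 + 2 * t + 7) * v - t - 1"
    and "X6 = (2 * t^5 + 9 * t^4 + 23 * t^3 + 35 * t^2 + 24 * t + 11) * v^6
          + (- (t^6) - 6 * t^5 - 23 * t^4 - 38 * t^3 - 33 * t^2 + 36 * t) * v^5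
          + (t^6 + 6 * t^5 + 18 * t^4 - 6 * t^3 - 60 * t^2 - 180 * t + 13) * v^4
          + (- (t^6) - 2 * t^5 + 46 * t^3 + 84 * t^2 + 142 * t - 139) * v^3
          + (- (t^5) - 5 * t^4 - 27 * t^3 - 15 * t^2 + 9 * t + 182) * v^2
          + (2 * t^4 + 3 * t^3 - 10 * t^2 - 32 * t - 67) * v
          + 2 * t^3 + 5 * t^2 + 11 * t + 11"
  have curve: "twisted_curve t v
      = Weierstrass (c * m) (c * f * A2) (c * f * A3) (- (c^2) * f * X4) (c^2 * f^2 * X6)"
    unfolding twisted_curve_def Let_def c_def f_def m_def A2_def A3_def X4_def X6_def
    by (simp only: mult.assoc)
  define e2 e3 where "e2 = - (t + 3) + (3 + t - t^2) * v + (t^2 - t - 3) * v^2"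
    and "e3 = 1 - 6 * v + (3 - 3 * t - t^2) * v^2 + (1 + 3 * t + t^2) * v^3"
  have I4: "- X4 + m * (?S + A3) = f * e2"
    unfolding X4_def m_def A3_def twist_intercept_def f_def e2_def by Groebner_Basis.algebra
  have I6: "X6 - ?S * (?S + A3) = - c * f * e3"
    unfolding X6_def A3_def twist_intercept_def f_def e3_def c_def by Groebner_Basis.algebra
  have b: "?u^2 * (- (?w^3) + ?w^2) = - c * f * \<rho> * e"
  proof -
    have "?u^2 * (- (?w^3) + ?w^2) = \<rho>^4 * (D * (D * ?w)^2 * (D - D * ?w))"
      by Groebner_Basis.algebra
    also have "\<dots> = \<rho>^4 * e * (e * D * (D - e))"
      unfolding D_param by Groebner_Basis.algebra
    also have "e * D * (D - e) = - (f * p)" unfolding fp by Groebner_Basis.algebra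
    also have "\<rho>^4 * e * - (f * p) = - (\<rho>^3 * p) * f * \<rho> * e" by Groebner_Basis.algebra
    finally show ?thesis unfolding c_eq' .
  qed
  have b3: "?u^3 * (- (?w^3) + ?w^2) = c * f * \<rho>^3 * D^2 * e"
  proof -
    have "?u^3 * (- (?w^3) + ?w^2) = ?u * (?u^2 * (- (?w^3) + ?w^2))"
      by Groebner_Basis.algebra
    also have "\<dots> = c * f * \<rho>^3 * D^2 * e" unfolding b by Groebner_Basis.algebra
    finally show ?thesis .
  qed
  have cm: "c * m = \<rho>^2 * (D^2 - e * D + e^2)" unfolding c_eq qm[symmetric] by Groebner_Basis.algebra
  have slope: "(c * m - \<rho>^2 * D^2) * D = \<rho>^2 * f * p"
  proof -
    have "(c * m - \<rho>^2 * D^2) * D = \<rho>^2 * (- e * D * (D - e))"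
      unfolding cm by Groebner_Basis.algebra
    also have "\<dots> = \<rho>^2 * f * p" unfolding fp[symmetric] by Groebner_Basis.algebra
    finally show ?thesis .
  qed
  show ?thesis
    unfolding twist_change_def slope_eq x_eq y_eq curve untwisted_curve_def iso_via.simps
  proof (intro conjI)
    show "?u \<noteq> 0" using slope_nz by (simp add: slope_eq)
    have "?u * (- (?w^2) + ?w + 1) = - (\<rho>^2) * (D^2 + D * (D * ?w) - (D * ?w)^2)"
      by Groebner_Basis.algebra
    also have "\<dots> = c * m + 2 * ?u" unfolding D_param cm by Groebner_Basis.algebra
    finally show "?u * (- (?w^2) + ?w + 1) = c * m + 2 * ?u" .
    have "c * f * A2 - ?u * (c * m) + 3 * (c * f * R) - ?u^2
        = c * f * (A2 + 3 * R) + \<rho>^2 * D * ((c * m - \<rho>^2 * D^2) * D)"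
      by Groebner_Basis.algebra
    also have "\<dots> = c * f * (A2 + 3 * R) + (\<rho>^3 * p) * (\<rho> * D * f)"
      unfolding slope by Groebner_Basis.algebra
    also have "\<dots> = c * f * (t * (2 * v - 1) + \<rho> * D + 3 * R)"
      unfolding c_eq'[symmetric] A2_def by Groebner_Basis.algebra
    also have "\<dots> = ?u^2 * (- (?w^3) + ?w^2)"
      unfolding b R_linear[symmetric] by Groebner_Basis.algebra
    finally show "?u^2 * (- (?w^3) + ?w^2) = c * f * A2 - ?u * (c * m) + 3 * (c * f * R) - ?u^2"
      by (rule sym)
    have tangent: "c * f * A3 + (c * f * R) * (c * m) + 2 * (c * f * ?S - c * m * (c * f * R))
        = c * f * (\<rho>^3 * D^2 * e)"
      unfolding a3_relation A3_def by Groebner_Basis.algebra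
    then show "?u^3 * (- (?w^3) + ?w^2)
        = c * f * A3 + (c * f * R) * (c * m) + 2 * (c * f * ?S - c * m * (c * f * R))"
      unfolding b3 by (simp only: mult.assoc)
    have "- (c^2) * f * X4 - ?u * (c * f * A3) + 2 * (c * f * R) * (c * f * A2)
        - ((c * f * ?S - c * m * (c * f * R)) + (c * f * R) * ?u) * (c * m) + 3 * (c * f * R)^2
        - 2 * ?u * (c * f * ?S - c * m * (c * f * R))
      = c^2 * f * (- X4 + m * (?S + A3)) + c^2 * f^2 * (3 * R^2 + 2 * A2 * R)
        - (c * m - \<rho>^2 * D^2)
          * (c * f * A3 + (c * f * R) * (c * m) + 2 * (c * f * ?S - c * m * (c * f * R)))"
      by Groebner_Basis.algebra
    also have "\<dots> = c^2 * f^2 * (3 * R^2 + 2 * A2 * R + e2)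
        - (c * m - \<rho>^2 * D^2) * D * (c * f * \<rho>^3 * D * e)"
      unfolding I4 tangent by Groebner_Basis.algebra
    also have "\<dots> = c^2 * f^2 * (3 * R^2 + 2 * t * (2 * v - 1) * R + e2)
        - (\<rho>^3 * p) * c * f^2 * (\<rho>^2 * D * e)"
      unfolding slope A2_def by Groebner_Basis.algebra
    also have "\<dots> = 0"
      unfolding c_eq'[symmetric] R_quadratic e2_def by Groebner_Basis.algebra
    finally show "?u^4 * 0 = - (c^2) * f * X4 - ?u * (c * f * A3) + 2 * (c * f * R) * (c * f * A2)
        - ((c * f * ?S - c * m * (c * f * R)) + (c * f * R) * ?u) * (c * m) + 3 * (c * f * R)^2
        - 2 * ?u * (c * f * ?S - c * m * (c * f * R))" by simp
    have "c^2 * f^2 * X6 + (c * f * R) * (- (c^2) * f * X4) + (c * f * R)^2 * (c * f * A2)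
        + (c * f * R)^3 - (c * f * ?S - c * m * (c * f * R)) * (c * f * A3)
        - (c * f * ?S - c * m * (c * f * R))^2
        - (c * f * R) * (c * f * ?S - c * m * (c * f * R)) * (c * m)
      = c^2 * f^2 * (X6 - ?S * (?S + A3)) + c^3 * f^2 * R * (- X4 + m * (?S + A3))
        + c^3 * f^3 * (R^3 + A2 * R^2)"
      by Groebner_Basis.algebra
    also have "\<dots> = c^3 * f^3 * (R^3 + t * (2 * v - 1) * R^2 + e2 * R - e3)"
      unfolding I4 I6 A2_def by Groebner_Basis.algebra
    also have "\<dots> = 0" unfolding e2_def e3_def R_cubic by simp
    finally show "?u^6 * 0 = c^2 * f^2 * X6 + (c * f * R) * (- (c^2) * f * X4)
        + (c * f * R)^2 * (c * f * A2)
        + (c * f * R)^3 - (c * f * ?S - c * m * (c * f * R)) * (c * f * A3)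
        - (c * f * ?S - c * m * (c * f * R))^2
        - (c * f * R) * (c * f * ?S - c * m * (c * f * R)) * (c * m)" by simp
  qed
qed

text \<open>Replacing the root \<open>g\<close> by \<open>1 / (1 - g)\<close>, as \<open>\<sigma>\<close> does, replaces the marked point by its quadruple.
  The abscissae differ by \<open>c f \<rho> D\<close>, and both points lie on the same line of slope \<open>- a\<^sub>1\<close>.\<close>
lemma twist_quadruple:
  "move (twist_change t v g) (tate_point (twist_param v g) 4)
    = move (twist_change t v (1 / (1 - g))) (Affine 0 0)"
proof -
  let ?u = "- (\<rho>^2 * D^2)" and ?S = "twist_intercept t v" and ?w = "twist_param v g"
  define i where "i = 1 / (1 - g)"
  define R' where "R' = - i * (i + v * (i^2 - 3 * i + 1)) / (i^2 - i)"
  have 1: "1 - g \<noteq> 0" using g by simp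
  have i: "(1 - g) * i = 1" using 1 by (simp add: i_def)
  have "i^2 - i = i * (i - 1)" by Groebner_Basis.algebra
  moreover have i0: "i \<noteq> 0" using i by auto
  moreover have "i - 1 = g * i" using i by (simp add: algebra_simps)
  ultimately have den: "i^2 - i = g * i^2" "g * i^2 \<noteq> 0" using g by (simp_all add: power2_eq_square)
  have "R' * (g * i^2) = - i * (i + v * (i^2 - 3 * i + 1))"
    unfolding R'_def den(1) using den(2) by simp
  then have "(1 - g)^3 * (R' * (g * i^2)) = (1 - g)^3 * (- i * (i + v * (i^2 - 3 * i + 1)))"
    by simp
  moreover have "(1 - g)^3 * (R' * (g * i^2)) = R' * g * (1 - g) * ((1 - g) * i)^2"
    "(1 - g)^3 * (- i * (i + v * (i^2 - 3 * i + 1)))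
      = - ((1 - g) * i) * ((1 - g) * ((1 - g) * i)
        + v * (((1 - g) * i)^2 - 3 * (1 - g) * ((1 - g) * i) + (1 - g)^2))"
    by Groebner_Basis.algebra+
  ultimately have "R' * g * (1 - g) = - ((1 - g) + v * (1 - 3 * (1 - g) + (1 - g)^2))"
    by (simp only: i power_one mult_1_right mult_minus_left mult_1_left)
  then have "R' * p = (1 - g) + v * (1 - 3 * (1 - g) + (1 - g)^2)"
  proof -
    assume *: "R' * g * (1 - g) = - ((1 - g) + v * (1 - 3 * (1 - g) + (1 - g)^2))"
    have "R' * p = - (R' * g * (1 - g))" unfolding p_def by Groebner_Basis.algebra
    then show ?thesis unfolding * by simp
  qed
  also have "\<dots> = R * p + \<rho> * p * D" unfolding Rp \<rho>p unfolding q_def D_def by Groebner_Basis.algebra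
  also have "\<dots> = (R + \<rho> * D) * p" by Groebner_Basis.algebra
  finally have R': "R' = R + \<rho> * D" using p_nz by simp
  have x': "twist_x t v i = c * f * R'"
    by (simp add: twist_x_def c_def f_def R'_def)
  have xx: "?u^2 * (?w^2 - ?w) = c * f * \<rho> * D"
  proof -
    have "?u^2 * (?w^2 - ?w) = \<rho>^4 * D * ((D * ?w) * D * (D * ?w - D))" by Groebner_Basis.algebra
    also have "\<dots> = \<rho>^4 * D * (- e * D * (D - e))" unfolding D_param by Groebner_Basis.algebra
    also have "\<dots> = (\<rho>^3 * p) * f * \<rho> * D" unfolding fp[symmetric] by Groebner_Basis.algebra
    finally show ?thesis unfolding c_eq' .
  qed
  have "?u * (?w^2 - ?w + 1) = - (\<rho>^2) * ((D * ?w)^2 - D * (D * ?w) + D^2)"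
    by Groebner_Basis.algebra
  also have "\<dots> = - (c * m)"
    unfolding D_param c_eq using qm[symmetric] by (simp add: algebra_simps)
  finally have um: "?u * (?w^2 - ?w + 1) = - (c * m)" .
  have "?u^3 * (?w^2 - ?w)^2 + ?u^2 * ?u * (?w^2 - ?w) = ?u^2 * (?w^2 - ?w) * (?u * (?w^2 - ?w + 1))"
    by Groebner_Basis.algebra
  also have "\<dots> = - (c * m) * (c * f * \<rho> * D)" unfolding xx um by (simp only: mult.commute)
  finally have yy: "?u^3 * (?w^2 - ?w)^2 + ?u^2 * ?u * (?w^2 - ?w) = - (c * m) * (c * f * \<rho> * D)" .
  have "move (twist_change t v g) (tate_point ?w 4)
    = Affine (?u^2 * (?w^2 - ?w) + c * f * R)
       (?u^3 * (?w^2 - ?w)^2 + ?u^2 * ?u * (?w^2 - ?w) + (c * f * ?S - c * m * (c * f * R)))"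
    by (simp only: tate_points twist_change_def move.simps slope_eq x_eq y_eq)
  also have "\<dots> = Affine (c * f * R') (c * f * ?S - c * m * (c * f * R'))"
    unfolding xx yy R' by (simp add: algebra_simps)
  also have "\<dots> = move (twist_change t v i) (Affine 0 0)"
    by (simp only: twist_change_def move.simps x' twist_y_def) (simp add: c_def f_def m_def)
  finally show ?thesis unfolding i_def .
qed

end

section \<open>Galois action on Tate normal forms\<close>

fun map_change :: "('a \<Rightarrow> 'b) \<Rightarrow> 'a \<times> 'a \<times> 'a \<times> 'a \<Rightarrow> 'b \<times> 'b \<times> 'b \<times> 'b" where
  "map_change h (u, r, s, t) = (h u, h r, h s, h t)"

context field_embedding
begin

lemma map_point_move: "map_point h (move \<tau> P) = move (map_change h \<tau>) (map_point h P)"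
  by (cases \<tau>; cases P) simp_all

lemma map_change_comp: "map_change h (comp_change \<tau> \<tau>') = comp_change (map_change h \<tau>) (map_change h \<tau>')"
  by (cases \<tau>; cases \<tau>') simp

lemma map_change_inv: "map_change h (inv_change \<tau>) = inv_change (map_change h \<tau>)"
  by (cases \<tau>) simp

lemma iso_via_base_change: "iso_via (map_change h \<tau>) (base_change h E) (base_change h E') \<longleftrightarrow> iso_via \<tau> E E'"
proof -
  obtain a1 a2 a3 a4 a6 a1' a2' a3' a4' a6' u r s t
    where E: "E = Weierstrass a1 a2 a3 a4 a6" "E' = Weierstrass a1' a2' a3' a4' a6'"
      and \<tau>: "\<tau> = (u, r, s, t)"
    by (cases E; cases E'; cases \<tau>) metis
  have "h (u * a1') = h (a1 + 2 * s) \<longleftrightarrow> u * a1' = a1 + 2 * s"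
    "h (u^2 * a2') = h (a2 - s * a1 + 3 * r - s^2) \<longleftrightarrow> u^2 * a2' = a2 - s * a1 + 3 * r - s^2"
    "h (u^3 * a3') = h (a3 + r * a1 + 2 * t) \<longleftrightarrow> u^3 * a3' = a3 + r * a1 + 2 * t"
    "h (u^4 * a4') = h (a4 - s * a3 + 2 * r * a2 - (t + r * s) * a1 + 3 * r^2 - 2 * s * t) \<longleftrightarrow>
     u^4 * a4' = a4 - s * a3 + 2 * r * a2 - (t + r * s) * a1 + 3 * r^2 - 2 * s * t"
    "h (u^6 * a6') = h (a6 + r * a4 + r^2 * a2 + r^3 - t * a3 - t^2 - r * t * a1) \<longleftrightarrow>
     u^6 * a6' = a6 + r * a4 + r^2 * a2 + r^3 - t * a3 - t^2 - r * t * a1"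
    by (rule eq_iff)+
  then show ?thesis
    unfolding E \<tau> base_change.simps map_change.simps iso_via.simps eq_zero_iff
      add mult diff power numeral by blast
qed

lemma base_change_untwisted: "base_change h (untwisted_curve v) = untwisted_curve (h v)"
  by (simp add: untwisted_curve_def)

lemma base_change_twisted: "base_change h (twisted_curve t v) = twisted_curve (h t) (h v)"
  by (simp add: twisted_curve_def Let_def)

lemma discriminant_base_change: "discriminant (base_change h E) = h (discriminant E)"
  by (cases E) (simp add: Let_def)

lemma smooth_base_change: "elliptic_curve E \<Longrightarrow> smooth (base_change h E)"
  by (rule elliptic_curve_smooth) (simp add: elliptic_curve_def discriminant_base_change)

lemma map_point_add:
  "map_point h (add_points E P Q) = add_points (base_change h E) (map_point h P) (map_point h Q)"
proof (cases "P = Infinity \<or> Q = Infinity")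
  case True
  then show ?thesis by (cases "P = Infinity"; cases E; cases P; cases Q) simp_all
next
  case False
  then obtain x1 y1 x2 y2 where PQ: "P = Affine x1 y1" "Q = Affine x2 y2"
    by (metis point.exhaust)
  obtain a1 a2 a3 a4 a6 where E: "E = Weierstrass a1 a2 a3 a4 a6" by (cases E)
  have "h y1 + h y2 + h a1 * h x2 + h a3 = 0 \<longleftrightarrow> y1 + y2 + a1 * x2 + a3 = 0"
    using eq_zero_iff[of "y1 + y2 + a1 * x2 + a3"] by simp
  then show ?thesis by (simp add: PQ E Let_def)
qed

lemma map_change_twist: "map_change h (twist_change t v g) = twist_change (h t) (h v) (h g)"
  by (simp add: twist_change_def twist_slope_def twist_x_def twist_y_def twist_intercept_def)

end

lemma iso_descent:
  assumes "field_embedding \<iota>" "iso_via \<tau> (base_change \<iota> E) (base_change \<iota> E')"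
    and "fst \<tau> \<in> range \<iota>" "fst (snd \<tau>) \<in> range \<iota>" "fst (snd (snd \<tau>)) \<in> range \<iota>"
      "snd (snd (snd \<tau>)) \<in> range \<iota>"
  shows "isomorphic_curves E E'"
proof -
  interpret field_embedding \<iota> by (rule assms(1))
  obtain u r s t where "fst \<tau> = \<iota> u" "fst (snd \<tau>) = \<iota> r" "fst (snd (snd \<tau>)) = \<iota> s"
    "snd (snd (snd \<tau>)) = \<iota> t" using assms(3-6) by blast
  then have "\<tau> = map_change \<iota> (u, r, s, t)" by (cases \<tau>) simp
  then show ?thesis using assms(2) iso_via_base_change isomorphic_curves_iff by metis
qed

lemma galois_group_embedding:
  assumes "separable_closure \<iota>" "s \<in> carrier (absolute_galois_group \<iota>)"
  shows "field_embedding s" "s (\<iota> a) = \<iota> a" "base_change s (base_change \<iota> E) = base_change \<iota> E"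
proof -
  interpret \<iota>: field_embedding \<iota> by (rule separable_closure_embedding[OF assms(1)])
  have *: "s (x + y) = s x + s y" "s (x * y) = s x * s y" "s (\<iota> a) = \<iota> a" for x y a
    using assms(2) by (auto simp: galois_group_def)
  show "field_embedding s" using *(1,2) *(3)[of 1] by unfold_locales simp_all
  show "s (\<iota> a) = \<iota> a" by (rule *(3))
  show "base_change s (base_change \<iota> E) = base_change \<iota> E" by (cases E) (simp add: *(3))
qed

lemma F7_units_cube:
  assumes "a \<in> carrier F7_units" "a [^]\<^bsub>F7_units\<^esub> (3::nat) = \<one>\<^bsub>F7_units\<^esub>"
  shows "a \<in> {1, 2, 4}"
proof -
  have "a \<in> {0..6}"
    using assms(1) by (auto simp: F7_units_def units_of_def Units_def residue_ring_def)
  then have "a \<in> {0, 1, 2, 3, 4, 5, 6}" by auto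
  moreover have "((a mod 7) * a mod 7) * a mod 7 = 1"
    using assms(2)
    by (simp add: F7_units_def units_of_def residue_ring_def numeral_3_eq_3 nat_pow_def)
  ultimately show ?thesis by auto
qed

locale cubic_character =
  fixes \<iota> :: "'k::field \<Rightarrow> 's::field" and \<chi> :: "('s \<Rightarrow> 's) \<Rightarrow> int"
  assumes closure: "separable_closure \<iota>"
    and char_hom: "\<chi> \<in> hom (absolute_galois_group \<iota>) F7_units"
    and cube: "\<And>s. s \<in> carrier (absolute_galois_group \<iota>) \<Longrightarrow> \<chi> s [^]\<^bsub>F7_units\<^esub> (3::nat) = \<one>\<^bsub>F7_units\<^esub>"
begin

sublocale \<iota>: field_embedding \<iota> by (rule separable_closure_embedding[OF closure])

abbreviation "G \<equiv> carrier (absolute_galois_group \<iota>)"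

lemma embedding: "s \<in> G \<Longrightarrow> field_embedding s"
  and fixes_base: "s \<in> G \<Longrightarrow> s (\<iota> a) = \<iota> a"
  and fixes_curve: "s \<in> G \<Longrightarrow> base_change s (base_change \<iota> E) = base_change \<iota> E"
  using galois_group_embedding[OF closure] by blast+

lemma chi_values: "s \<in> G \<Longrightarrow> \<chi> s \<in> {1, 2, 4}"
  using F7_units_cube cube char_hom by (auto simp: hom_def)

lemma comp_mult: "s \<in> G \<Longrightarrow> s' \<in> G \<Longrightarrow> s \<otimes>\<^bsub>absolute_galois_group \<iota>\<^esub> s' = s \<circ> s'"
  by (auto simp: galois_group_def BijGroup_def compose_def)

lemma comp_mem: "s \<in> G \<Longrightarrow> s' \<in> G \<Longrightarrow> s \<circ> s' \<in> G"
  by (auto simp: galois_group_def Bij_def intro: bij_comp)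

lemma chi_comp:
  assumes "s \<in> G" "s' \<in> G"
  shows "\<chi> (s \<circ> s') = \<chi> s * \<chi> s' mod 7"
proof -
  have "\<chi> (s \<otimes>\<^bsub>absolute_galois_group \<iota>\<^esub> s') = \<chi> s \<otimes>\<^bsub>F7_units\<^esub> \<chi> s'"
    using hom_mult[OF char_hom assms] .
  then show ?thesis
    unfolding comp_mult[OF assms] by (simp add: F7_units_def units_of_def residue_ring_def)
qed

lemma kernel_eq: "kernel (absolute_galois_group \<iota>) F7_units \<chi> = {s \<in> G. \<chi> s = 1}"
  by (simp add: kernel_def F7_units_def units_of_def residue_ring_def)

lemma trivial_iff: "trivial_character \<iota> \<chi> \<longleftrightarrow> (\<forall>s\<in>G. \<chi> s = 1)"
  by (simp add: trivial_character_def F7_units_def units_of_def residue_ring_def)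

text \<open>A character with cube one that takes the value four at \<open>s0\<close> has the cosets of the kernel
  represented by the powers of \<open>s0\<close>.\<close>
lemma generated_by_coset:
  assumes s0: "s0 \<in> G" "\<chi> s0 = 4" and ker: "\<And>s. s \<in> G \<Longrightarrow> \<chi> s = 1 \<Longrightarrow> s z = z" and "s0 z = z"
    and s: "s \<in> G"
  shows "s z = z"
proof -
  note m = comp_mem[OF s s0(1)] comp_mem[OF comp_mem[OF s s0(1)] s0(1)]
  consider "\<chi> s = 1" | "\<chi> s = 2" | "\<chi> s = 4" using chi_values[OF s] by blast
  then show ?thesis
  proof cases
    case 1
    then show ?thesis using ker s by blast
  next
    case 2
    then have "\<chi> (s \<circ> s0) = 1" using chi_comp[OF s s0(1)] s0(2) by simp
    then show ?thesis using ker[OF m(1)] assms(4) by simp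
  next
    case 3
    then have "\<chi> ((s \<circ> s0) \<circ> s0) = 1"
      using chi_comp[OF m(1) s0(1)] chi_comp[OF s s0(1)] s0(2) by simp
    then show ?thesis using ker[OF m(2)] assms(4) by simp
  qed
qed

lemma invariant_in_range: "(\<And>s. s \<in> G \<Longrightarrow> s z = z) \<Longrightarrow> z \<in> range \<iota>"
  using fixed_by_galois_group[OF closure] by blast

lemma invariant_iso_descends:
  assumes "iso_via \<tau> (base_change \<iota> E) (base_change \<iota> E')" "\<And>s. s \<in> G \<Longrightarrow> map_change s \<tau> = \<tau>"
  shows "isomorphic_curves E E'"
proof (rule iso_descent[OF \<iota>.field_embedding_axioms assms(1)])
  obtain u r a t where \<tau>: "\<tau> = (u, r, a, t)" by (cases \<tau>)
  have "s u = u \<and> s r = r \<and> s a = a \<and> s t = t" if "s \<in> G" for s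
    using assms(2)[OF that] by (simp add: \<tau>)
  then show "fst \<tau> \<in> range \<iota>" "fst (snd \<tau>) \<in> range \<iota>" "fst (snd (snd \<tau>)) \<in> range \<iota>"
      "snd (snd (snd \<tau>)) \<in> range \<iota>"
    using invariant_in_range by (simp_all add: \<tau>)
qed

text \<open>Conjugating a normal form of \<open>(E, P)\<close> gives one of \<open>(E, s P)\<close>.\<close>
lemma galois_conjugate_iso:
  assumes "s \<in> G" "iso_via \<tau> (base_change \<iota> E) (untwisted_curve w)"
  shows "iso_via (map_change s \<tau>) (base_change \<iota> E) (untwisted_curve (s w))"
    and "map_point s (move \<tau> (Affine 0 0)) = move (map_change s \<tau>) (Affine 0 0)"
proof -
  interpret s: field_embedding s by (rule embedding[OF assms(1)])
  show "iso_via (map_change s \<tau>) (base_change \<iota> E) (untwisted_curve (s w))"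
    using assms s.iso_via_base_change[of \<tau> "base_change \<iota> E" "untwisted_curve w"]
    by (simp add: fixes_curve s.base_change_untwisted)
  show "map_point s (move \<tau> (Affine 0 0)) = move (map_change s \<tau>) (Affine 0 0)"
    by (simp add: s.map_point_move)
qed

text \<open>By uniqueness of the normal form, an automorphism fixing the point fixes the substitution.\<close>
lemma fixed_point_fixes_iso:
  assumes "s \<in> G" "smooth (base_change \<iota> E)" "iso_via \<tau> (base_change \<iota> E) (untwisted_curve w)"
    and "map_point s (move \<tau> (Affine 0 0)) = move \<tau> (Affine 0 0)"
  shows "map_change s \<tau> = \<tau>" "s w = w"
proof -
  have "move \<tau> (Affine 0 0) = move (map_change s \<tau>) (Affine 0 0)"
    using galois_conjugate_iso(2)[OF assms(1,3)] assms(4) by metis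
  note eqs = iso_via_untwisted_unique[OF assms(2,3) galois_conjugate_iso(1)[OF assms(1,3)] this]
  show "map_change s \<tau> = \<tau>" "s w = w" by (rule eqs[symmetric])+
qed

text \<open>Two normal forms of \<open>(E, 4 P)\<close> are at hand, the conjugate of that of \<open>(E, P)\<close> and the composite
  with the quadruple change. They coincide by uniqueness.\<close>
lemma quadrupled_point_iso:
  assumes "s \<in> G" "smooth (base_change \<iota> E)" "iso_via \<tau> (base_change \<iota> E) (untwisted_curve w)"
    and "map_point s (move \<tau> (Affine 0 0)) = seven_points \<tau> w 4"
  shows "map_change s \<tau> = comp_change \<tau> (quadruple_change w)" "s w = 1 / (1 - w)"
proof -
  have "w \<noteq> 1" using smooth_untwisted_curve[OF smooth_iso_via[OF assms(3,2)]] by blast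
  then have iso: "iso_via (comp_change \<tau> (quadruple_change w)) (base_change \<iota> E) (untwisted_curve (1 / (1 - w)))"
    using iso_via_comp[OF assms(3)] quadruple_change(1) by blast
  have "move (comp_change \<tau> (quadruple_change w)) (Affine 0 0) = seven_points \<tau> w 4"
    using quadruple_change(2)[OF \<open>w \<noteq> 1\<close>] by (simp add: move_comp_change seven_points_def)
  then have "move (map_change s \<tau>) (Affine 0 0) = move (comp_change \<tau> (quadruple_change w)) (Affine 0 0)"
    using galois_conjugate_iso(2)[OF assms(1,3)] assms(4) by simp
  then show "map_change s \<tau> = comp_change \<tau> (quadruple_change w)" "s w = 1 / (1 - w)"
    using iso_via_untwisted_unique[OF assms(2) galois_conjugate_iso(1)[OF assms(1,3)] iso] by simp_all
qed

lemma subgroup_tate_isomorphism: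
  assumes E: "smooth (base_change \<iota> E)" and \<Psi>: "rational_subgroup \<iota> E \<Psi>" "card \<Psi> = 7"
    and P: "P \<in> \<Psi>" "P \<noteq> Infinity"
  obtains \<tau> w where "iso_via \<tau> (base_change \<iota> E) (untwisted_curve w)" "move \<tau> (Affine 0 0) = P"
proof -
  have "subgroup \<Psi> (curve_group (base_change \<iota> E))"
    using \<Psi>(1) unfolding rational_subgroup_def by blast
  then show thesis
    using tate_normal_form[OF subgroup_seven_point[OF E _ \<Psi>(2) P]] that by blast
qed

lemma nonzero_point:
  assumes "card \<Psi> = 7"
  obtains P where "P \<in> \<Psi>" "P \<noteq> Infinity"
proof -
  have "\<not> \<Psi> \<subseteq> {Infinity}" using assms card_mono[of "{Infinity}" \<Psi>] by auto
  then show thesis using that by blast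
qed

text \<open>The points of the subgroup are fixed by Galois, so their normal form is rational.\<close>
lemma trivial_forward:
  assumes E: "smooth (base_change \<iota> E)" and triv: "\<And>s. s \<in> G \<Longrightarrow> \<chi> s = 1"
    and \<Psi>: "rational_subgroup \<iota> E \<Psi>" "card \<Psi> = 7" "galois_acts_via \<iota> E \<chi> \<Psi>"
  shows "\<exists>v. isomorphic_curves E (untwisted_curve v)"
proof -
  obtain P where P: "P \<in> \<Psi>" "P \<noteq> Infinity" using nonzero_point[OF \<Psi>(2)] .
  obtain \<tau> w where tau: "iso_via \<tau> (base_change \<iota> E) (untwisted_curve w)" "move \<tau> (Affine 0 0) = P"
    using subgroup_tate_isomorphism[OF E \<Psi>(1,2) P] .
  interpret tate_isomorphism "base_change \<iota> E" \<tau> w using E tau(1) by unfold_locales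
  have "Q 1 = P" using tau(2) by (simp add: seven_points_1)
  have "map_point s P = P" if "s \<in> G" for s
    using \<Psi>(3) that P triv[OF that] pow_Q[of 1 1] \<open>Q 1 = P\<close> unfolding galois_acts_via_def by simp
  then have fixed: "map_change s \<tau> = \<tau>" "s w = w" if "s \<in> G" for s
    using fixed_point_fixes_iso[OF that E tau(1)] tau(2) that by simp_all
  obtain v where v: "w = \<iota> v" using invariant_in_range fixed(2) by blast
  have "isomorphic_curves E (untwisted_curve v)"
    by (rule invariant_iso_descends[OF _ fixed(1)]) (use tau(1) in \<open>simp_all add: v \<iota>.base_change_untwisted\<close>)
  then show ?thesis by blast
qed

lemma trivial_backward:
  assumes E: "smooth (base_change \<iota> E)" and triv: "\<And>s. s \<in> G \<Longrightarrow> \<chi> s = 1"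
    and iso: "isomorphic_curves E (untwisted_curve v)"
  shows "\<exists>\<Psi>. rational_subgroup \<iota> E \<Psi> \<and> card \<Psi> = 7 \<and> galois_acts_via \<iota> E \<chi> \<Psi>"
proof -
  obtain \<tau>0 where "iso_via \<tau>0 E (untwisted_curve v)" using iso isomorphic_curves_iff by blast
  define \<tau> where "\<tau> = map_change \<iota> \<tau>0"
  have "iso_via \<tau> (base_change \<iota> E) (untwisted_curve (\<iota> v))"
    using \<open>iso_via \<tau>0 E _\<close> \<iota>.iso_via_base_change[of \<tau>0 E "untwisted_curve v"]
    by (simp add: \<tau>_def \<iota>.base_change_untwisted)
  then interpret tate_isomorphism "base_change \<iota> E" \<tau> "\<iota> v" using E by unfold_locales
  have act: "map_point s (Q n) = Q n" if s: "s \<in> G" for s n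
  proof -
    interpret s: field_embedding s by (rule embedding[OF s])
    have 1: "map_point s (Q 1) = Q 1"
      using s by (cases \<tau>0) (simp add: seven_points_1 s.map_point_move \<tau>_def fixes_base)
    show ?thesis
    proof (induction n)
      case (Suc n)
      have "map_point s (Q (n + 1))
          = add_points (base_change \<iota> E) (map_point s (Q n)) (map_point s (Q 1))"
        unfolding add_Q[symmetric] s.map_point_add fixes_curve[OF s] ..
      then show ?case unfolding Suc 1 add_Q by simp
    qed (simp add: seven_points_0)
  qed
  have "rational_subgroup \<iota> E (Q ` {..<7})"
    using subgroup_Q act unfolding rational_subgroup_def by auto
  moreover have "galois_acts_via \<iota> E \<chi> (Q ` {..<7})"
    using act triv pow_Q[of _ 1] unfolding galois_acts_via_def by auto
  ultimately show ?thesis using card_Q by blast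
qed

end

section \<open>Nontrivial characters\<close>

text \<open>For \<open>\<tau>\<close> and \<open>\<tau>'\<close> both changed by the same \<open>\<delta>\<close>, as happens under conjugation by \<open>s0\<close>, the
  substitution leading from one curve to the other is unchanged.\<close>
lemma comp_change_cancel:
  assumes "fst \<tau> \<noteq> 0" "fst \<tau>' \<noteq> 0" "fst \<delta> \<noteq> 0"
  shows "comp_change (comp_change \<tau> \<delta>) (inv_change (comp_change \<tau>' \<delta>))
    = comp_change \<tau> (inv_change \<tau>')"
  using assms
  by (cases \<tau>; cases \<tau>'; cases \<delta>) (simp add: field_simps power2_eq_square power3_eq_cube)

definition cubic_root :: "'a::field \<Rightarrow> 'a \<Rightarrow> bool" where
  "cubic_root t g \<longleftrightarrow> g^3 - (t + 3) * g^2 + t * g + 1 = 0"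

lemma cubic_root_nontrivial: "cubic_root t g \<Longrightarrow> g \<noteq> 0 \<and> g \<noteq> 1"
  by (auto simp: cubic_root_def)

lemma (in field_embedding) poly_adapted_cubic:
  "poly (map_poly h (adapted_cubic t)) x = 0 \<longleftrightarrow> cubic_root (h t) x"
  by (simp add: adapted_cubic_def map_poly_pCons cubic_root_def algebra_simps
      power2_eq_square power3_eq_cube)

text \<open>A root fixed by \<open>\<gamma> \<mapsto> 1 / (1 - \<gamma>)\<close> is a triple root.\<close>
lemma cubic_root_unique:
  fixes t :: "'a::field"
  assumes "cubic_root t g" "cubic_root t r" "g^2 - g + 1 = 0"
  shows "r = g"
proof -
  have "g^2 = (g^2 - g + 1) + (g - 1)" by simp
  then have g2: "g^2 = g - 1" unfolding assms(3) by simp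
  have "t = 3 * g - 3"
  proof -
    have "g^3 = g * g^2" by (simp add: power3_eq_cube power2_eq_square)
    also have "\<dots> = g * (g - 1)" by (simp only: g2)
    also have "\<dots> = g^2 - g" by (simp add: algebra_simps power2_eq_square)
    finally have g3: "g^3 = - 1" unfolding g2 by simp
    have "g^3 - (t + 3) * g^2 + t * g + 1 = t - (3 * g - 3)"
      unfolding g3 g2 by Groebner_Basis.algebra
    then have "t - (3 * g - 3) = 0" unfolding assms(1)[unfolded cubic_root_def] by (rule sym)
    then show ?thesis by (simp only: right_minus_eq)
  qed
  moreover have "(r - g)^3 = (r^3 - ((3 * g - 3) + 3) * r^2 + (3 * g - 3) * r + 1)
      + (g^2 - g + 1) * (3 * r - g - 1)"
    by Groebner_Basis.algebra
  ultimately have "(r - g)^3 = 0" using assms(2,3) by (simp add: cubic_root_def)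
  then show ?thesis by simp
qed

lemma generated_field_fixed:
  assumes "field_embedding s" "\<And>x. x \<in> H \<Longrightarrow> s x = x"
    and "x \<in> generate_field ring_of_type_algebra H"
  shows "s x = x"
proof -
  interpret s: field_embedding s by (rule assms(1))
  interpret R: Ring.field "ring_of_type_algebra :: 'a ring" by (rule field_from_type_algebra)
  have minus: "\<ominus>\<^bsub>ring_of_type_algebra\<^esub> y = - y" for y :: 'a
    by (rule R.minus_equality) (simp_all add: ring_of_type_algebra_def)
  have inv: "inv\<^bsub>ring_of_type_algebra\<^esub> y = 1 / y" if "y \<noteq> 0" for y :: 'a
    using that by (intro R.comm_inv_char) (simp_all add: ring_of_type_algebra_def)
  show ?thesis using assms(3)
  proof (induction rule: generate_field.induct)
    case (m_inv y)
    then have "y \<noteq> 0" by (simp add: ring_of_type_algebra_def)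
    then show ?case using inv m_inv(3) by simp
  qed (use assms(2) minus in \<open>simp_all add: ring_of_type_algebra_def\<close>)
qed

context cubic_character
begin

abbreviation "K \<equiv> field_cut_out \<iota> \<chi>"

lemma in_K_iff: "x \<in> K \<longleftrightarrow> (\<forall>s\<in>G. \<chi> s = 1 \<longrightarrow> s x = x)"
  by (auto simp: field_cut_out_def fixed_field_def kernel_eq)

lemma adapted_roots:
  assumes "adapted \<iota> K \<sigma> t"
  obtains rs g where "K = generate_field ring_of_type_algebra (range \<iota> \<union> set rs)"
    "g \<in> set rs" "\<And>r. r \<in> set rs \<Longrightarrow> cubic_root (\<iota> t) r"
    "\<And>r. cubic_root (\<iota> t) r \<Longrightarrow> \<sigma> r = 1 / (1 - r)"
proof -
  let ?f = "adapted_cubic t"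
  obtain rs where rs: "map_poly \<iota> ?f = smult (\<iota> (lead_coeff ?f)) (\<Prod>r\<leftarrow>rs. [:- r, 1:])"
    and K: "K = generate_field ring_of_type_algebra (range \<iota> \<union> set rs)"
    using assms unfolding adapted_def splitting_field_over_def by blast
  have root: "cubic_root (\<iota> t) r" if "r \<in> set rs" for r
  proof -
    have "poly (\<Prod>r\<leftarrow>rs. [:- r, 1:]) r = 0" using that by (induction rs) auto
    then have "poly (map_poly \<iota> ?f) r = 0" unfolding rs by simp
    then show ?thesis by (simp add: \<iota>.poly_adapted_cubic)
  qed
  have "rs \<noteq> []"
  proof
    assume "rs = []"
    then have "coeff (map_poly \<iota> ?f) 3 = 0" unfolding rs by (simp add: numeral_3_eq_3)
    then show False by (simp add: coeff_map_poly adapted_cubic_def numeral_3_eq_3)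
  qed
  then obtain g where "g \<in> set rs" by (cases rs) auto
  moreover have "\<sigma> r = 1 / (1 - r)" if "cubic_root (\<iota> t) r" for r
    using assms that unfolding adapted_def \<iota>.poly_adapted_cubic by blast
  ultimately show thesis using that K root by blast
qed

end

text \<open>The list \<open>rs\<close> consists of the roots of the adapted cubic, \<open>g\<close> is one of them, and \<open>s0\<close> extends
  the generator \<open>\<sigma>\<close>.\<close>
locale nontrivial_cubic_character = cubic_character \<iota> \<chi>
  for \<iota> :: "'k::field \<Rightarrow> 's::field" and \<chi> :: "('s \<Rightarrow> 's) \<Rightarrow> int" +
  fixes s0 :: "'s \<Rightarrow> 's" and t :: 'k and rs :: "'s list" and g :: 's
  assumes s0: "s0 \<in> G" "\<chi> s0 = 4"
    and K_gen: "K = generate_field ring_of_type_algebra (range \<iota> \<union> set rs)"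
    and g_rs: "g \<in> set rs"
    and roots: "\<And>r. r \<in> set rs \<Longrightarrow> cubic_root (\<iota> t) r"
    and s0_roots: "\<And>r. r \<in> set rs \<Longrightarrow> s0 r = 1 / (1 - r)"
begin

lemma root_g: "cubic_root (\<iota> t) g" and g: "g \<noteq> 0" "g \<noteq> 1" and s0_g: "s0 g = 1 / (1 - g)"
  using roots[OF g_rs] s0_roots[OF g_rs] cubic_root_nontrivial by blast+

lemma kernel_g: "s \<in> G \<Longrightarrow> \<chi> s = 1 \<Longrightarrow> s g = g"
proof -
  have "g \<in> K" unfolding K_gen by (rule generate_field.incl) (simp add: g_rs)
  then show "s \<in> G \<Longrightarrow> \<chi> s = 1 \<Longrightarrow> s g = g" by (simp add: in_K_iff)
qed

text \<open>If \<open>g\<close> is a triple root, \<open>s0\<close> fixes the only generator of the field cut out by the character.\<close>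
lemma generic_root:
  assumes "x \<in> K" "s0 x \<noteq> x"
  shows "g^2 - g + 1 \<noteq> 0"
proof
  assume q: "g^2 - g + 1 = 0"
  have "g * (1 - g) = 1" using q by (simp add: algebra_simps power2_eq_square)
  then have fixed: "s0 g = g" using s0_g g by (simp add: nonzero_divide_eq_eq)
  have "s0 y = y" if "y \<in> range \<iota> \<union> set rs" for y
    using that fixes_base[OF s0(1)] cubic_root_unique[OF root_g roots q] fixed by blast
  then have "s0 x = x"
    using generated_field_fixed[OF embedding[OF s0(1)]] assms(1) unfolding K_gen by blast
  then show False using assms(2) by simp
qed

lemma twist_at:
  assumes "g * \<iota> v - \<iota> v + 1 \<noteq> 0" "g^2 - g + 1 \<noteq> 0"
  shows "twist (\<iota> t) (\<iota> v) g"
  using assms g root_g unfolding cubic_root_def by unfold_locales auto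

text \<open>The parameter \<open>w\<close> and the root \<open>g\<close> are changed by \<open>s0\<close> in the same way, so
  \<open>z = (g - w) / (1 - w + w g)\<close> is rational. Then \<open>E\<close> and the twisted curve have the same normal
  form over the separable closure, and the isomorphism between them is Galois invariant. A zero
  denominator is avoided by passing from the point to its quadruple.\<close>
lemma forward:
  assumes E: "smooth (base_change \<iota> E)"
    and \<Psi>: "rational_subgroup \<iota> E \<Psi>" "card \<Psi> = 7" "galois_acts_via \<iota> E \<chi> \<Psi>"
  shows "\<exists>v. isomorphic_curves E (twisted_curve t v)"
proof -
  interpret s0: field_embedding s0 by (rule embedding[OF s0(1)])
  have stable: "map_point s0 P \<in> \<Psi>" if "P \<in> \<Psi>" for P
    using \<Psi>(1) s0(1) that unfolding rational_subgroup_def by blast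
  have act: "(s \<in> G \<longrightarrow> \<chi> s = 1 \<longrightarrow> map_change s \<tau> = \<tau> \<and> s w = w) \<and>
      map_point s0 (move \<tau> (Affine 0 0)) = seven_points \<tau> w 4 \<and>
      map_change s0 \<tau> = comp_change \<tau> (quadruple_change w) \<and> s0 w = 1 / (1 - w)"
    if iso: "iso_via \<tau> (base_change \<iota> E) (untwisted_curve w)" and P: "move \<tau> (Affine 0 0) \<in> \<Psi>"
    for s \<tau> w
  proof -
    interpret tate_isomorphism "base_change \<iota> E" \<tau> w using E iso by unfold_locales
    have act: "map_point s (move \<tau> (Affine 0 0)) = Q (nat (\<chi> s))" if "s \<in> G" for s
      using \<Psi>(3) that P pow_Q[of 1 "nat (\<chi> s)"] unfolding galois_acts_via_def
      by (simp add: seven_points_1)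
    have "map_change s \<tau> = \<tau> \<and> s w = w" if "s \<in> G" "\<chi> s = 1"
      using fixed_point_fixes_iso[OF that(1) E iso] act[OF that(1)] that(2)
      by (simp add: seven_points_1)
    moreover have 4: "map_point s0 (move \<tau> (Affine 0 0)) = Q 4" using act[OF s0(1)] s0(2) by simp
    ultimately show ?thesis using quadrupled_point_iso[OF s0(1) E iso 4] by blast
  qed
  obtain P where P: "P \<in> \<Psi>" "P \<noteq> Infinity" using nonzero_point[OF \<Psi>(2)] .
  obtain \<tau>1 w1 where 1: "iso_via \<tau>1 (base_change \<iota> E) (untwisted_curve w1)" "move \<tau>1 (Affine 0 0) = P"
    using subgroup_tate_isomorphism[OF E \<Psi>(1,2) P] .
  have P1: "move \<tau>1 (Affine 0 0) \<in> \<Psi>" using 1(2) P by simp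
  note act1 = act[OF 1(1) P1]
  have w1: "w1 \<noteq> 1" using smooth_untwisted_curve[OF smooth_iso_via[OF 1(1) E]] by blast
  \<comment> \<open>The coordinates of \<open>P\<close> lie in \<open>K\<close> and are moved by \<open>s0\<close>, so \<open>s0\<close> acts nontrivially on \<open>K\<close>.\<close>
  have q: "g^2 - g + 1 \<noteq> 0"
  proof -
    obtain x y where xy: "P = Affine x y" using P(2) by (cases P) auto
    interpret tate_isomorphism "base_change \<iota> E" \<tau>1 w1 using E 1(1) by unfold_locales
    have "Q 1 \<noteq> Q 4" using inj_onD[OF inj_Q, of 1 4] by auto
    then have "map_point s0 P \<noteq> P" using act1 1(2) by (simp add: seven_points_1)
    then have "s0 x \<noteq> x \<or> s0 y \<noteq> y" by (simp add: xy)
    moreover have "x \<in> K" "y \<in> K"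
    proof -
      have "map_point s P = P" if "s \<in> G" "\<chi> s = 1" for s
        using act1[of s] galois_conjugate_iso(2)[OF that(1) 1(1)] that 1(2) by simp
      then show "x \<in> K" "y \<in> K" by (simp_all add: in_K_iff xy)
    qed
    ultimately show ?thesis using generic_root by blast
  qed
  obtain \<tau> w where iso: "iso_via \<tau> (base_change \<iota> E) (untwisted_curve w)"
    and P: "move \<tau> (Affine 0 0) \<in> \<Psi>" and den: "1 - w + w * g \<noteq> 0"
  proof (cases "1 - w1 + w1 * g = 0")
    case False
    then show thesis using that 1 P1 by blast
  next
    case True
    let ?\<tau> = "comp_change \<tau>1 (quadruple_change w1)" and ?w = "1 / (1 - w1)"
    have "iso_via ?\<tau> (base_change \<iota> E) (untwisted_curve ?w)"
      using iso_via_comp[OF 1(1) quadruple_change(1)[OF w1]] .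
    moreover have "move ?\<tau> (Affine 0 0) = map_point s0 P"
      using act1 1(2) quadruple_change(2)[OF w1] by (simp add: move_comp_change seven_points_def)
    then have "move ?\<tau> (Affine 0 0) \<in> \<Psi>" using stable P(1) by simp
    moreover have "1 - ?w + ?w * g \<noteq> 0"
    proof
      assume w0: "1 - ?w + ?w * g = 0"
      have "(1 - w1) * (1 - ?w + ?w * g) = (1 - w1) - ((1 - w1) * ?w) * (1 - g)"
        by Groebner_Basis.algebra
      moreover have w1_inv: "(1 - w1) * ?w = 1" using w1 by simp
      ultimately have "0 = (1 - w1) - 1 * (1 - g)" by (simp only: w0 w1_inv mult_zero_right)
      then have "g = w1" by simp
      then show False using True q by (simp add: algebra_simps power2_eq_square)
    qed
    ultimately show thesis by (rule that)
  qed
  note act = act[OF iso P]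
  have w: "w \<noteq> 1" using smooth_untwisted_curve[OF smooth_iso_via[OF iso E]] by blast
  define z where "z = (g - w) / (1 - w + w * g)"
  have "s z = z" if "s \<in> G" for s
  proof (rule generated_by_coset[OF s0 _ _ that])
    fix s assume s: "s \<in> G" "\<chi> s = 1"
    interpret s: field_embedding s by (rule embedding[OF s(1)])
    show "s z = z" unfolding z_def using act[of s] s kernel_g[OF s] by simp
  next
    have w': "1 - w \<noteq> 0" and g': "1 - g \<noteq> 0" using w g by simp_all
    have num: "1 / (1 - g) - 1 / (1 - w) = (g - w) / ((1 - w) * (1 - g))"
      using w' g' by (simp add: divide_simps; simp add: algebra_simps)
    have den': "1 - 1 / (1 - w) + 1 / (1 - w) * (1 / (1 - g)) = (1 - w + w * g) / ((1 - w) * (1 - g))"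
      using w' g' by (simp add: divide_simps; simp add: algebra_simps)
    have "s0 z = (1 / (1 - g) - 1 / (1 - w)) / (1 - 1 / (1 - w) + 1 / (1 - w) * (1 / (1 - g)))"
      unfolding z_def using act s0_g by simp
    also have "\<dots> = z" unfolding num den' z_def using w' g' by simp
    finally show "s0 z = z" .
  qed
  then obtain v where v: "z = \<iota> v" using invariant_in_range by blast
  have den_z: "(1 - w + w * g) * z = g - w" using den by (simp add: z_def)
  have D: "(1 - w + w * g) * (g * z - z + 1) = g^2 - g + 1"
  proof -
    have "(1 - w + w * g) * (g * z - z + 1) = (g - 1) * ((1 - w + w * g) * z) + (1 - w + w * g)"
      by Groebner_Basis.algebra
    also have "(1 - w + w * g) * z = g - w" by (rule den_z)
    also have "(g - 1) * (g - w) + (1 - w + w * g) = g^2 - g + 1" by Groebner_Basis.algebra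
    finally show ?thesis .
  qed
  with q have D_nz: "g * z - z + 1 \<noteq> 0" by auto
  then interpret twist "\<iota> t" "\<iota> v" g using twist_at q v by simp
  have param: "twist_param (\<iota> v) g = w"
  proof -
    have "(1 - w + w * g) * (g - z) = (1 - w + w * g) * g - (g - w)"
      unfolding right_diff_distrib den_z ..
    also have "\<dots> = w * ((1 - w + w * g) * (g * z - z + 1))" unfolding D by Groebner_Basis.algebra
    finally have "(1 - w + w * g) * (g - z) = (1 - w + w * g) * (w * (g * z - z + 1))"
      by (simp only: mult.left_commute)
    then have "g - z = w * (g * z - z + 1)" using den by simp
    then show ?thesis using D_nz by (simp add: twist_param_def v[symmetric])
  qed
  define \<tau>A where "\<tau>A = twist_change (\<iota> t) (\<iota> v) g"
  have isoA: "iso_via \<tau>A (base_change \<iota> (twisted_curve t v)) (untwisted_curve w)"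
    using twist_iso by (simp add: \<tau>A_def param \<iota>.base_change_twisted)
  have isoEA: "iso_via (comp_change \<tau> (inv_change \<tau>A)) (base_change \<iota> E) (base_change \<iota> (twisted_curve t v))"
    using iso_via_comp[OF iso iso_via_inv[OF isoA]] .
  have A: "smooth (base_change \<iota> (twisted_curve t v))" using smooth_iso_via[OF isoEA E] .
  have "map_point s0 (move \<tau>A (Affine 0 0)) = seven_points \<tau>A w 4"
    unfolding s0.map_point_move seven_points_def \<tau>A_def s0.map_change_twist
    using twist_quadruple by (simp add: fixes_base[OF s0(1)] s0_g param)
  then have s0A: "map_change s0 \<tau>A = comp_change \<tau>A (quadruple_change w)"
    using quadrupled_point_iso(1)[OF s0(1) A isoA] by blast
  have fixed: "map_change s (comp_change \<tau> (inv_change \<tau>A)) = comp_change \<tau> (inv_change \<tau>A)"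
    if "s \<in> G" for s
  proof -
    obtain u r a b where \<phi>: "comp_change \<tau> (inv_change \<tau>A) = (u, r, a, b)"
      by (cases "comp_change \<tau> (inv_change \<tau>A)")
    have ker: "map_change s (u, r, a, b) = (u, r, a, b)" if s: "s \<in> G" "\<chi> s = 1" for s
    proof -
      interpret s: field_embedding s by (rule embedding[OF s(1)])
      show ?thesis
        unfolding \<phi>[symmetric] s.map_change_comp s.map_change_inv
        using act[of s] s by (simp add: \<tau>A_def s.map_change_twist fixes_base kernel_g)
    qed
    have "map_change s0 (u, r, a, b) = (u, r, a, b)"
      unfolding \<phi>[symmetric] s0.map_change_comp s0.map_change_inv s0A
      using act comp_change_cancel[of \<tau> \<tau>A "quadruple_change w"] w
        iso_via_nonzero[OF iso] iso_via_nonzero[OF isoA]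
      by (simp add: quadruple_change_def)
    with ker show ?thesis
      unfolding \<phi> using generated_by_coset[OF s0 _ _ that] by simp
  qed
  have "isomorphic_curves E (twisted_curve t v)"
    by (rule invariant_iso_descends[OF isoEA fixed])
  then show ?thesis by blast
qed

text \<open>The subgroup is generated by the marked point of the twisted curve, which the kernel of the
  character fixes and \<open>s0\<close> sends to its quadruple.\<close>
lemma backward:
  assumes E: "smooth (base_change \<iota> E)" and iso: "isomorphic_curves E (twisted_curve t v)"
  shows "\<exists>\<Psi>. rational_subgroup \<iota> E \<Psi> \<and> card \<Psi> = 7 \<and> galois_acts_via \<iota> E \<chi> \<Psi>"
proof -
  obtain \<tau>0 where "iso_via \<tau>0 E (twisted_curve t v)" using iso isomorphic_curves_iff by blast
  then have iso1: "iso_via (map_change \<iota> \<tau>0) (base_change \<iota> E) (twisted_curve (\<iota> t) (\<iota> v))"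
    using \<iota>.iso_via_base_change[of \<tau>0 E "twisted_curve t v"] by (simp add: \<iota>.base_change_twisted)
  have A: "smooth (twisted_curve (\<iota> t) (\<iota> v))" using smooth_iso_via[OF iso1 E] .
  let ?T = "\<iota> t" and ?V = "\<iota> v"
  interpret root: twist_root ?T ?V g using g root_g unfolding cubic_root_def by unfold_locales auto
  \<comment> \<open>If \<open>c\<close> or \<open>f(v)\<close> vanished, the twisted curve would be singular at the origin.\<close>
  have "root.c \<noteq> 0"
    using A by (auto simp: root.c_def twisted_curve_def Let_def dest: spec[of _ 0])
  then have q: "g^2 - g + 1 \<noteq> 0" using root.c_eq by (auto simp: root.q_def)
  have "root.f \<noteq> 0"
    using A by (auto simp: root.f_def twisted_curve_def Let_def dest: spec[of _ 0])
  then have D: "g * ?V - ?V + 1 \<noteq> 0"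
    using root.fp root.p_nz by (auto simp: root.D_def)
  interpret twist ?T ?V g using twist_at D q by simp
  define w where "w = twist_param ?V g"
  define \<tau> where "\<tau> = comp_change (map_change \<iota> \<tau>0) (twist_change ?T ?V g)"
  have "iso_via \<tau> (base_change \<iota> E) (untwisted_curve w)"
    unfolding \<tau>_def w_def using iso_via_comp[OF iso1 twist_iso] .
  then interpret tate_isomorphism "base_change \<iota> E" \<tau> w using E by unfold_locales
  have generator: "map_point s (Q n) = Q (j * n)"
    if s: "s \<in> G" and 1: "map_point s (Q 1) = Q j" for s n j
  proof -
    interpret s: field_embedding s by (rule embedding[OF s])
    show ?thesis
    proof (induction n)
      case (Suc n)
      have "map_point s (Q (n + 1)) = add_points (base_change \<iota> E) (map_point s (Q n)) (map_point s (Q 1))"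
        unfolding add_Q[symmetric] s.map_point_add fixes_curve[OF s] ..
      then show ?case unfolding Suc 1 add_Q by (simp add: add.commute)
    qed (simp add: seven_points_0)
  qed
  have conj: "map_point s (Q 1)
      = move (map_change \<iota> \<tau>0) (move (twist_change ?T ?V (s g)) (Affine 0 0))" if s: "s \<in> G" for s
  proof -
    interpret s: field_embedding s by (rule embedding[OF s])
    show ?thesis
      using s by (cases \<tau>0) (simp add: seven_points_1 \<tau>_def move_comp_change s.map_point_move
          s.map_change_twist fixes_base)
  qed
  have ker: "map_point s (Q n) = Q n" if "s \<in> G" "\<chi> s = 1" for s n
    using generator[OF that(1), of 1 n] conj[OF that(1)] kernel_g[OF that]
    by (simp add: seven_points_1 \<tau>_def move_comp_change)
  have act4: "map_point s0 (Q n) = Q (4 * n)" for n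
    using conj[OF s0(1)] twist_quadruple s0_g
    by (intro generator[OF s0(1)]) (simp add: seven_points_def \<tau>_def move_comp_change w_def)
  have act: "map_point s (Q n) = Q (nat (\<chi> s) * n)" if s: "s \<in> G" for s n
  proof -
    note m = comp_mem[OF s s0(1)] comp_mem[OF comp_mem[OF s s0(1)] s0(1)]
    have comp: "map_point (a \<circ> b) P = map_point a (map_point b P)" for a b :: "'s \<Rightarrow> 's" and P
      by (cases P) simp_all
    consider "\<chi> s = 1" | "\<chi> s = 2" | "\<chi> s = 4" using chi_values[OF s] by blast
    then show ?thesis
    proof cases
      case 1
      then show ?thesis using ker s by simp
    next
      case 2
      then have "\<chi> (s \<circ> s0) = 1" using chi_comp[OF s s0(1)] s0(2) by simp
      then have "map_point s (Q (4 * (2 * n))) = Q (2 * n)"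
        using ker[OF m(1), of "2 * n"] by (simp add: comp act4)
      moreover have "Q (4 * (2 * n)) = Q n"
        using seven_points_mod[of \<tau> w "4 * (2 * n)"] seven_points_mod[of \<tau> w n] by (simp add: mod_mult_left_eq[symmetric, of 8])
      ultimately show ?thesis using 2 by simp
    next
      case 3
      then have "\<chi> ((s \<circ> s0) \<circ> s0) = 1"
        using chi_comp[OF m(1) s0(1)] chi_comp[OF s s0(1)] s0(2) by simp
      then have "map_point s (Q (4 * (4 * (4 * n)))) = Q (4 * n)"
        using ker[OF m(2), of "4 * n"] by (simp add: comp act4)
      moreover have "Q (4 * (4 * (4 * n))) = Q n"
        using seven_points_mod[of \<tau> w "4 * (4 * (4 * n))"] seven_points_mod[of \<tau> w n] by (simp add: mod_mult_left_eq[symmetric, of 64])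
      ultimately show ?thesis using 3 by simp
    qed
  qed
  have "rational_subgroup \<iota> E (Q ` {..<7})"
    using subgroup_Q act Q_in unfolding rational_subgroup_def by auto
  moreover have "galois_acts_via \<iota> E \<chi> (Q ` {..<7})"
    using act pow_Q unfolding galois_acts_via_def by auto
  ultimately show ?thesis using card_Q by blast
qed

end

theorem theorem3p6:
  fixes \<iota> :: "'k::field \<Rightarrow> 's::field"
    and \<chi> :: "('s \<Rightarrow> 's) \<Rightarrow> int"
    and E :: "'k weierstrass"
    and \<sigma> :: "'s \<Rightarrow> 's"
    and t :: 'k
  assumes "CHAR('k) \<noteq> 7"
    and "separable_closure \<iota>"
    and "continuous_F7_character \<iota> \<chi>"
    and "\<forall>s \<in> carrier (absolute_galois_group \<iota>). \<chi> s [^]\<^bsub>F7_units\<^esub> (3::nat) = \<one>\<^bsub>F7_units\<^esub>"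
    and "elliptic_curve E"
    and "\<not> trivial_character \<iota> \<chi> \<Longrightarrow>
           \<sigma> \<in> carrier (galois_group \<iota> (field_cut_out \<iota> \<chi>)) \<and>
           (\<exists>s \<in> carrier (absolute_galois_group \<iota>).
              restrict s (field_cut_out \<iota> \<chi>) = \<sigma> \<and> \<chi> s = 4) \<and>
           adapted \<iota> (field_cut_out \<iota> \<chi>) \<sigma> t"
  shows "(\<exists>\<Psi>. rational_subgroup \<iota> E \<Psi> \<and> card \<Psi> = 7 \<and> galois_acts_via \<iota> E \<chi> \<Psi>) \<longleftrightarrow>
         (\<exists>v. isomorphic_curves E (A_curve \<iota> \<chi> t v))"
proof -
  interpret cubic_character \<iota> \<chi>
    using assms(2-4) unfolding continuous_F7_character_def by unfold_locales auto
  have E: "smooth (base_change \<iota> E)" by (rule \<iota>.smooth_base_change[OF assms(5)])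
  show ?thesis
  proof (cases "trivial_character \<iota> \<chi>")
    case True
    then have "\<chi> s = 1" if "s \<in> G" for s using that trivial_iff by blast
    then show ?thesis
      using trivial_forward[OF E] trivial_backward[OF E] True unfolding A_curve_def by auto
  next
    case False
    then obtain s0 where s0: "s0 \<in> G" "restrict s0 K = \<sigma>" "\<chi> s0 = 4" and "adapted \<iota> K \<sigma> t"
      using assms(6) by blast
    then obtain rs g where K: "K = generate_field ring_of_type_algebra (range \<iota> \<union> set rs)"
      and g: "g \<in> set rs" and roots: "\<And>r. r \<in> set rs \<Longrightarrow> cubic_root (\<iota> t) r"
      and \<sigma>: "\<And>r. cubic_root (\<iota> t) r \<Longrightarrow> \<sigma> r = 1 / (1 - r)"
      using adapted_roots by metis
    have "s0 r = 1 / (1 - r)" if "r \<in> set rs" for r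
    proof -
      have "r \<in> K" unfolding K by (rule generate_field.incl) (simp add: that)
      then have "s0 r = \<sigma> r" using s0(2) by auto
      then show ?thesis using \<sigma> roots that by simp
    qed
    then interpret nontrivial_cubic_character \<iota> \<chi> s0 t rs g
      using s0 K g roots by unfold_locales
    show ?thesis
      using forward[OF E] backward[OF E] False unfolding A_curve_def by auto
  qed
qed

end
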